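(* Let $A=T(V)/I$ be a graded algebra, let $g\in A$ be a homogeneous element of degree 1 that is both normal and regular in $A$, and let $B=A/gA$. Let $A$ be $\mathcal{K}_2$ and assume that $E^3(B)$ is generated by $E^1(B)$ and $E^2(B)$ (that is, $E^3(B)$ is contained in the subalgebra of $E(B)$ generated by $E^1(B)$ and $E^2(B)$). Then $B$ is $\mathcal{K}_2$.
   Context: Conventions. $K$ is a field. A "graded algebra" is a connected $\mathbb{N}$-graded $K$-algebra of the form $A=T(V)/I$, where $V$ is a finite-dimensional $K$-vector space placed in degree 1, $T(V)$ is its tensor algebra, and $I$ is an ideal generated by a (minimal) finite set of homogeneous elements of degree at least 2 (not necessarily all of the same degree). The field $K$ is identified with the trivial $A$-module $A/A_+$. The bigraded Yoneda algebra is $E(A)=\bigoplus_{n,m} E^{n,m}(A)$ with $E^{n,m}(A)=\mathrm{Ext}_A^{n}(K,K)_{-m}$ ($n$ is the cohomological degree, $-m$ the internal degree; Ext is computed in the category of $\mathbb{Z}$-graded locally finite $A$-modules with graded Hom spaces), with the Yoneda (cup) product; $E^n(A)=\bigoplus_m E^{n,m}(A)$. The graded algebra $A$ is called $\mathcal{K}_2$ if $E(A)$ is generated as an algebra by $E^1(A)$ and $E^2(A)$. An element $g\in A$ is normal if $gA=Ag$, and regular if it is neither a left nor a right zero divisor. *)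

theory Defs
  imports Complex_Main "HOL-Library.Poly_Mapping"
begin

section \<open>Tensor algebras and their graded quotients\<close>

datatype 'v word = Word (letters: "'v list")

instantiation word :: (type) monoid_add
begin

definition zero_word :: "'a word"
  where "0 = Word []"

definition plus_word :: "'a word \<Rightarrow> 'a word \<Rightarrow> 'a word"
  where "u + w = Word (letters u @ letters w)"

instance
  by standard (simp_all add: zero_word_def plus_word_def)

end

text \<open>
  Words form the free monoid, written additively, so the convolution product of
  \<^theory>\<open>HOL-Library.Poly_Mapping\<close> makes this type the tensor algebra \<open>T(V)\<close> of the vector
  space \<open>V\<close> with basis \<open>'v\<close>.
\<close>

type_synonym ('v, 'k) tensor_algebra = "'v word \<Rightarrow>\<^sub>0 'k"

definition tensor_power :: "nat \<Rightarrow> ('v, 'k::zero) tensor_algebra set"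
  where "tensor_power m = {t. \<forall>w \<in> Poly_Mapping.keys t. length (letters w) = m}"

inductive_set two_sided_ideal :: "'r::ring_1 set \<Rightarrow> 'r set" for R
  where
    zero: "0 \<in> two_sided_ideal R"
  | generator: "r \<in> R \<Longrightarrow> a * r * b \<in> two_sided_ideal R"
  | add: "x \<in> two_sided_ideal R \<Longrightarrow> y \<in> two_sided_ideal R \<Longrightarrow> x + y \<in> two_sided_ideal R"

text \<open>\<open>h\<close> exhibits its codomain as the quotient of its domain by the two-sided ideal \<open>J\<close>.\<close>

definition ring_quotient :: "('r::ring_1 \<Rightarrow> 's::ring_1) \<Rightarrow> 'r set \<Rightarrow> bool"
  where "ring_quotient h J \<longleftrightarrow>
    h 1 = 1 \<and> (\<forall>x y. h (x + y) = h x + h y) \<and> (\<forall>x y. h (x * y) = h x * h y) \<and>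
    surj h \<and> {x. h x = 0} = J"

definition admissible_relations :: "('v, 'k::zero) tensor_algebra set \<Rightarrow> bool"
  where "admissible_relations R \<longleftrightarrow> finite R \<and> (\<forall>r \<in> R. \<exists>m \<ge> 2. r \<in> tensor_power m)"

text \<open>
  The \<open>K\<close>-algebra structure map and the homogeneous components of a graded \<open>K\<close>-algebra whose
  underlying ring is a type.
\<close>

record ('k, 'a) graded_structure =
  scal :: "'k \<Rightarrow> 'a"
  gr :: "nat \<Rightarrow> 'a set"

definition tensor_structure :: "('k::field, ('v, 'k) tensor_algebra) graded_structure"
  where "tensor_structure = \<lparr>scal = (\<lambda>c. Poly_Mapping.single 0 c), gr = tensor_power\<rparr>"

definition image_structure ::
    "('a \<Rightarrow> 'b) \<Rightarrow> ('k, 'a) graded_structure \<Rightarrow> ('k, 'b) graded_structure"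
  where "image_structure h A = \<lparr>scal = (\<lambda>c. h (scal A c)), gr = (\<lambda>m. h ` gr A m)\<rparr>"

definition normal_element :: "'a::ring_1 \<Rightarrow> bool"
  where "normal_element g \<longleftrightarrow> {g * a | a. True} = {a * g | a. True}"

definition regular_element :: "'a::ring_1 \<Rightarrow> bool"
  where "regular_element g \<longleftrightarrow> (\<forall>a. g * a = 0 \<longrightarrow> a = 0) \<and> (\<forall>a. a * g = 0 \<longrightarrow> a = 0)"

text \<open>\<open>A\<^sub>+\<close>, and the augmentation \<open>A \<rightarrow> A/A\<^sub>+ = K\<close> of a connected graded algebra.\<close>

definition plus_part :: "('k, 'a::ring_1) graded_structure \<Rightarrow> 'a set"
  where "plus_part A =
    {a. \<exists>M f. finite M \<and> 0 \<notin> M \<and> (\<forall>m \<in> M. f m \<in> gr A m) \<and> a = (\<Sum>m \<in> M. f m)}"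

definition augmentation :: "('k, 'a::ring_1) graded_structure \<Rightarrow> 'a \<Rightarrow> 'k"
  where "augmentation A a = (THE c. a - scal A c \<in> plus_part A)"

section \<open>Graded free resolutions of the trivial module\<close>

text \<open>
  \<open>'x \<Rightarrow>\<^sub>0 'a\<close> is the free left module with basis \<open>'x\<close>.  A complex \<open>P\<close> of graded free modules is
  kept as one such module \<open>\<Oplus>\<^sub>n P\<^sub>n\<close>: each basis element carries a homological degree and an
  internal degree, and the differentials are assembled into one endomorphism.
\<close>

definition lmult :: "'a::ring_1 \<Rightarrow> ('x \<Rightarrow>\<^sub>0 'a) \<Rightarrow> ('x \<Rightarrow>\<^sub>0 'a)"
  where "lmult a p = Poly_Mapping.map (\<lambda>b. a * b) p"

record (overloaded) ('x, 'a, 'k) augmented_complex =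
  hdeg :: "'x \<Rightarrow> nat"
  ideg :: "'x \<Rightarrow> int"
  bd :: "('x \<Rightarrow>\<^sub>0 'a) \<Rightarrow> ('x \<Rightarrow>\<^sub>0 'a)"
  aug :: "('x \<Rightarrow>\<^sub>0 'a) \<Rightarrow> 'k"

definition gr_int :: "('k, 'a::ring_1) graded_structure \<Rightarrow> int \<Rightarrow> 'a set"
  where "gr_int A i = (if 0 \<le> i then gr A (nat i) else {0})"

definition component :: "('x, 'a::ring_1, 'k) augmented_complex \<Rightarrow> int \<Rightarrow> ('x \<Rightarrow>\<^sub>0 'a) set"
  where "component P n = {p. \<forall>x \<in> Poly_Mapping.keys p. int (hdeg P x) = n}"

definition bicomponent ::
    "('k, 'a::ring_1) graded_structure \<Rightarrow> ('x, 'a, 'k) augmented_complex \<Rightarrow>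
      int \<Rightarrow> int \<Rightarrow> ('x \<Rightarrow>\<^sub>0 'a) set"
  where "bicomponent A P n j =
    {p \<in> component P n. \<forall>x. Poly_Mapping.lookup p x \<in> gr_int A (j - ideg P x)}"

definition finite_dimensional ::
    "('k, 'a::ring_1) graded_structure \<Rightarrow> ('x \<Rightarrow>\<^sub>0 'a) set \<Rightarrow> bool"
  where "finite_dimensional A M \<longleftrightarrow>
    (\<exists>S. finite S \<and> S \<subseteq> M \<and> (\<forall>p \<in> M. \<exists>c. p = (\<Sum>s \<in> S. lmult (scal A (c s)) s)))"

definition module_endo :: "(('x \<Rightarrow>\<^sub>0 'a::ring_1) \<Rightarrow> ('x \<Rightarrow>\<^sub>0 'a)) \<Rightarrow> bool"
  where "module_endo F \<longleftrightarrow>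
    (\<forall>p q. F (p + q) = F p + F q) \<and> (\<forall>a p. F (lmult a p) = lmult a (F p))"

definition hom_to_trivial ::
    "('k::field, 'a::ring_1) graded_structure \<Rightarrow> (('x \<Rightarrow>\<^sub>0 'a) \<Rightarrow> 'k) \<Rightarrow> bool"
  where "hom_to_trivial A f \<longleftrightarrow>
    (\<forall>p q. f (p + q) = f p + f q) \<and> (\<forall>a p. f (lmult a p) = augmentation A a * f p)"

definition vanishes_off ::
    "('k::field, 'a::ring_1) graded_structure \<Rightarrow> ('x, 'a, 'k) augmented_complex \<Rightarrow>
      (int \<times> int) set \<Rightarrow> (('x \<Rightarrow>\<^sub>0 'a) \<Rightarrow> 'k) \<Rightarrow> bool"
  where "vanishes_off A P D f \<longleftrightarrow>
    (\<forall>n j. (n, j) \<notin> D \<longrightarrow> (\<forall>p \<in> bicomponent A P n j. f p = 0))"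

text \<open>
  The complex \<open>\<dots> \<rightarrow> P\<^sub>1 \<rightarrow> P\<^sub>0 \<rightarrow> K \<rightarrow> 0\<close> is an exact complex of graded \<open>A\<close>-modules with maps of
  internal degree \<open>0\<close>, the modules \<open>P\<^sub>n\<close> being free and locally finite.
\<close>

definition graded_free_resolution ::
    "('k::field, 'a::ring_1) graded_structure \<Rightarrow> ('x, 'a, 'k) augmented_complex \<Rightarrow> bool"
  where "graded_free_resolution A P \<longleftrightarrow>
    (\<forall>n j. finite_dimensional A (bicomponent A P n j)) \<and>
    module_endo (bd P) \<and>
    (\<forall>n j. bd P ` bicomponent A P n j \<subseteq> bicomponent A P (n - 1) j) \<and>
    hom_to_trivial A (aug P) \<and>
    vanishes_off A P {(0, 0)} (aug P) \<and>
    aug P ` component P 0 = UNIV \<and>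
    {p \<in> component P 0. aug P p = 0} = bd P ` component P 1 \<and>
    (\<forall>n \<ge> 1. {p \<in> component P n. bd P p = 0} = bd P ` component P (n + 1))"

section \<open>The Yoneda algebra\<close>

text \<open>
  The graded Hom space \<open>Hom\<^sub>A(P, K)\<close>, the direct sum of its bigraded pieces: a cochain lives in
  finitely many bidegrees.  An element of \<open>Hom\<^sub>A(P\<^sub>n, K)\<close> of internal degree \<open>-m\<close> is one that
  vanishes off \<open>{(n, m)}\<close>.
\<close>

definition cochains ::
    "('k::field, 'a::ring_1) graded_structure \<Rightarrow> ('x, 'a, 'k) augmented_complex \<Rightarrow>
      (('x \<Rightarrow>\<^sub>0 'a) \<Rightarrow> 'k) set"
  where "cochains A P = {f. hom_to_trivial A f \<and> (\<exists>D. finite D \<and> vanishes_off A P D f)}"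

definition cocycles ::
    "('k::field, 'a::ring_1) graded_structure \<Rightarrow> ('x, 'a, 'k) augmented_complex \<Rightarrow>
      (('x \<Rightarrow>\<^sub>0 'a) \<Rightarrow> 'k) set"
  where "cocycles A P = {f \<in> cochains A P. \<forall>p. f (bd P p) = 0}"

definition coboundaries ::
    "('k::field, 'a::ring_1) graded_structure \<Rightarrow> ('x, 'a, 'k) augmented_complex \<Rightarrow>
      (('x \<Rightarrow>\<^sub>0 'a) \<Rightarrow> 'k) set"
  where "coboundaries A P = {(\<lambda>p. f (bd P p)) | f. f \<in> cochains A P}"

definition ext_class ::
    "('k::field, 'a::ring_1) graded_structure \<Rightarrow> ('x, 'a, 'k) augmented_complex \<Rightarrow>
      (('x \<Rightarrow>\<^sub>0 'a) \<Rightarrow> 'k) \<Rightarrow> (('x \<Rightarrow>\<^sub>0 'a) \<Rightarrow> 'k) set"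
  where "ext_class A P f = {f' \<in> cocycles A P. (\<lambda>p. f' p - f p) \<in> coboundaries A P}"

definition ext_algebra ::
    "('k::field, 'a::ring_1) graded_structure \<Rightarrow> ('x, 'a, 'k) augmented_complex \<Rightarrow>
      (('x \<Rightarrow>\<^sub>0 'a) \<Rightarrow> 'k) set set"
  where "ext_algebra A P = ext_class A P ` cocycles A P"

definition ext_bipart ::
    "('k::field, 'a::ring_1) graded_structure \<Rightarrow> ('x, 'a, 'k) augmented_complex \<Rightarrow>
      (int \<times> int) set \<Rightarrow> (('x \<Rightarrow>\<^sub>0 'a) \<Rightarrow> 'k) set set"
  where "ext_bipart A P D = ext_class A P ` {f \<in> cocycles A P. vanishes_off A P D f}"

text \<open>\<open>E\<^sup>n\<close>; the bigraded piece \<open>E\<^sup>n\<^sup>,\<^sup>m\<close> is \<open>ext_bipart A P {(n, m)}\<close>.\<close>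

definition ext_part ::
    "('k::field, 'a::ring_1) graded_structure \<Rightarrow> ('x, 'a, 'k) augmented_complex \<Rightarrow>
      nat \<Rightarrow> (('x \<Rightarrow>\<^sub>0 'a) \<Rightarrow> 'k) set set"
  where "ext_part A P n = ext_bipart A P ({int n} \<times> UNIV)"

text \<open>Elements of the graded Hom space \<open>Hom\<^sub>A(P, P)\<close>: finite sums of bihomogeneous maps.\<close>

definition graded_endo ::
    "('k, 'a::ring_1) graded_structure \<Rightarrow> ('x, 'a, 'k) augmented_complex \<Rightarrow>
      (('x \<Rightarrow>\<^sub>0 'a) \<Rightarrow> ('x \<Rightarrow>\<^sub>0 'a)) \<Rightarrow> bool"
  where "graded_endo A P F \<longleftrightarrow> module_endo F \<and>
    (\<exists>D. finite D \<and> (\<forall>i j. \<forall>p \<in> bicomponent A P i j.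
      \<exists>q. (\<forall>(n, m) \<in> D. q (n, m) \<in> bicomponent A P (i - n) (j - m)) \<and> F p = (\<Sum>e \<in> D. q e)))"

text \<open>
  A lift of the cocycle \<open>f\<close>: for \<open>f\<close> on \<open>P\<^sub>n\<close>, a chain map \<open>P\<^sub>n\<^sub>+\<^sub>\<bullet> \<rightarrow> P\<^sub>\<bullet>\<close> over \<open>f : P\<^sub>n \<rightarrow> K\<close>.  Note
  that \<open>aug P\<close> vanishes on \<open>P\<^sub>i\<close> for \<open>i \<noteq> 0\<close>.
\<close>

definition lifts ::
    "('k::field, 'a::ring_1) graded_structure \<Rightarrow> ('x, 'a, 'k) augmented_complex \<Rightarrow>
      (('x \<Rightarrow>\<^sub>0 'a) \<Rightarrow> 'k) \<Rightarrow> (('x \<Rightarrow>\<^sub>0 'a) \<Rightarrow> ('x \<Rightarrow>\<^sub>0 'a)) \<Rightarrow> bool"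
  where "lifts A P f F \<longleftrightarrow>
    graded_endo A P F \<and> (\<forall>p. F (bd P p) = bd P (F p)) \<and> (\<forall>p. aug P (F p) = f p)"

text \<open>
  The algebra operations on classes.  By the comparison theorem every cocycle has a lift and the
  unions below do not depend on the choices made, so each is a single class.  Lifts are taken to
  commute with the differential without sign; the other convention changes products of
  homogeneous classes by a sign only.
\<close>

definition ext_one ::
    "('k::field, 'a::ring_1) graded_structure \<Rightarrow> ('x, 'a, 'k) augmented_complex \<Rightarrow>
      (('x \<Rightarrow>\<^sub>0 'a) \<Rightarrow> 'k) set"
  where "ext_one A P = ext_class A P (aug P)"

definition ext_add ::
    "('k::field, 'a::ring_1) graded_structure \<Rightarrow> ('x, 'a, 'k) augmented_complex \<Rightarrow>
      (('x \<Rightarrow>\<^sub>0 'a) \<Rightarrow> 'k) set \<Rightarrow> (('x \<Rightarrow>\<^sub>0 'a) \<Rightarrow> 'k) set \<Rightarrow> (('x \<Rightarrow>\<^sub>0 'a) \<Rightarrow> 'k) set"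
  where "ext_add A P u v = (\<Union>f \<in> u. \<Union>g \<in> v. ext_class A P (\<lambda>p. f p + g p))"

definition ext_scale ::
    "('k::field, 'a::ring_1) graded_structure \<Rightarrow> ('x, 'a, 'k) augmented_complex \<Rightarrow>
      'k \<Rightarrow> (('x \<Rightarrow>\<^sub>0 'a) \<Rightarrow> 'k) set \<Rightarrow> (('x \<Rightarrow>\<^sub>0 'a) \<Rightarrow> 'k) set"
  where "ext_scale A P c u = (\<Union>f \<in> u. ext_class A P (\<lambda>p. c * f p))"

definition yoneda_product ::
    "('k::field, 'a::ring_1) graded_structure \<Rightarrow> ('x, 'a, 'k) augmented_complex \<Rightarrow>
      (('x \<Rightarrow>\<^sub>0 'a) \<Rightarrow> 'k) set \<Rightarrow> (('x \<Rightarrow>\<^sub>0 'a) \<Rightarrow> 'k) set \<Rightarrow> (('x \<Rightarrow>\<^sub>0 'a) \<Rightarrow> 'k) set"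
  where "yoneda_product A P u v =
    (\<Union>g \<in> u. \<Union>f \<in> v. \<Union>F \<in> {F. lifts A P f F}. ext_class A P (\<lambda>p. g (F p)))"

inductive_set ext_subalgebra ::
    "('k::field, 'a::ring_1) graded_structure \<Rightarrow> ('x, 'a, 'k) augmented_complex \<Rightarrow>
      (('x \<Rightarrow>\<^sub>0 'a) \<Rightarrow> 'k) set set \<Rightarrow> (('x \<Rightarrow>\<^sub>0 'a) \<Rightarrow> 'k) set set"
  for A P S
  where
    one: "ext_one A P \<in> ext_subalgebra A P S"
  | generator: "u \<in> S \<Longrightarrow> u \<in> ext_subalgebra A P S"
  | add: "u \<in> ext_subalgebra A P S \<Longrightarrow> v \<in> ext_subalgebra A P S \<Longrightarrow>
      ext_add A P u v \<in> ext_subalgebra A P S"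
  | scale: "u \<in> ext_subalgebra A P S \<Longrightarrow> ext_scale A P c u \<in> ext_subalgebra A P S"
  | product: "u \<in> ext_subalgebra A P S \<Longrightarrow> v \<in> ext_subalgebra A P S \<Longrightarrow>
      yoneda_product A P u v \<in> ext_subalgebra A P S"

definition low_degree_subalgebra ::
    "('k::field, 'a::ring_1) graded_structure \<Rightarrow> ('x, 'a, 'k) augmented_complex \<Rightarrow>
      (('x \<Rightarrow>\<^sub>0 'a) \<Rightarrow> 'k) set set"
  where "low_degree_subalgebra A P = ext_subalgebra A P (ext_part A P 1 \<union> ext_part A P 2)"

text \<open>
  The property \<open>K\<^sub>2\<close>, with \<open>E(A)\<close> computed from the resolution \<open>P\<close> of the trivial module.
\<close>

definition K2 ::
    "('k::field, 'a::ring_1) graded_structure \<Rightarrow> ('x, 'a, 'k) augmented_complex \<Rightarrow> bool"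
  where "K2 A P \<longleftrightarrow> ext_algebra A P = low_degree_subalgebra A P"

end

theory Submission
  imports Defs "HOL-Library.Product_Plus" "HOL-Library.Set_Algebras"
begin

text \<open>
  Write \<open>\<phi>: E(B) \<rightarrow> E(A)\<close> for the map induced by \<open>A \<rightarrow> B\<close>. The element \<open>g\<close> gives \<open>B = A/gA\<close> an
  \<open>A\<close>-free resolution of length one, so the change of rings from \<open>A\<close> to \<open>B\<close> produces a long exact
  sequence with connecting maps \<open>E\<^sup>n\<^sup>-\<^sup>2(B) \<rightarrow> E\<^sup>n(B)\<close>. Because \<open>g\<close> has degree one, there is a class
  \<open>\<chi> \<in> E\<^sup>1\<^sup>,\<^sup>1(A)\<close> dual to \<open>g\<close>; it splits the sequence, and \<open>E(A) = \<phi>(E(B)) \<oplus> \<phi>(E(B)) \<chi>\<close> is the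
  sum of two copies of \<open>E(B)\<close>.

  Let \<open>D\<close> be the subalgebra of \<open>E(B)\<close> generated by \<open>E\<^sup>1(B)\<close> and \<open>E\<^sup>2(B)\<close>. Then
  \<open>G = \<phi>(D) + \<phi>(D) \<chi>\<close> is closed under products. It suffices that \<open>\<chi> \<phi>(u) \<in> G\<close> for generators \<open>u\<close> of \<open>D\<close>
  and that \<open>\<chi> \<chi> \<in> G\<close>. These products have cohomological degree 2 or 3, and
  \<open>E\<^sup>n(A) = \<phi>(E\<^sup>n(B)) + \<phi>(E\<^sup>n\<^sup>-\<^sup>1(B)) \<chi>\<close> lies in \<open>G\<close> for \<open>n \<le> 3\<close>, since \<open>E\<^sup>3(B) \<subseteq> D\<close> by assumption.
  So \<open>G\<close> is a subalgebra containing \<open>E\<^sup>1(A)\<close> and \<open>E\<^sup>2(A)\<close>, which is everything if \<open>A\<close> is \<open>\<K>\<^sub>2\<close>. For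
  \<open>e \<in> E(B)\<close> this gives \<open>\<phi>(e) = \<phi>(u) + \<phi>(v) \<chi>\<close> with \<open>u, v \<in> D\<close>, whence \<open>e = u \<in> D\<close>.

  On the level of complexes, let \<open>P\<close> and \<open>Q\<close> be the given resolutions over \<open>A\<close> and \<open>B\<close>. The maps \<open>\<pi>\<close> and \<open>X\<close>
  are chain maps \<open>P \<rightarrow> Q\<close>, semilinear over \<open>A \<rightarrow> B\<close>, that lift the augmentation of \<open>P\<close> and the cocycle \<open>\<chi>\<close>.
  A cocycle \<open>u\<close> of \<open>Q\<close> then has \<open>\<phi>(u) = u \<circ> \<pi>\<close> and \<open>\<phi>(u) \<chi> = u \<circ> X\<close>. The homology of \<open>P/gP\<close> is
  \<open>K\<close> in degrees 0 and 1, and \<open>\<pi>\<close> and \<open>X\<close> see these two copies, so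
  \<open>(\<pi>, X): P/gP \<rightarrow> Q \<oplus> Q[1]\<close> is a quasi-isomorphism of complexes of free \<open>B\<close>-modules. Its mapping cone is
  exact, hence contractible (\<open>cone_exact\<close>, \<open>cone_contraction\<close>), and both halves of the splitting are read off
  from the cochains of the cone (\<open>gysin_injective\<close>, \<open>gysin_splitting\<close>). Lifts of cocycles, their uniqueness
  up to homotopy and the contraction all come from one lemma, \<open>null_homotopy\<close>. The algebra of the second
  paragraph is carried out on cocycles in the locale \<open>gysin_sequence\<close>.
\<close>

section \<open>Linear maps out of free modules\<close>

(* Bidegrees are pairs; quantifiers over them are to stay intact. *)
declare split_paired_All [simp del] split_paired_Ex [simp del]

abbreviation unit_vector :: "'x \<Rightarrow> ('x \<Rightarrow>\<^sub>0 'a::ring_1)"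
  where "unit_vector k \<equiv> Poly_Mapping.single k 1"

lemma lookup_lmult [simp]: "Poly_Mapping.lookup (lmult a p) k = a * Poly_Mapping.lookup p k"
  by (simp add: lmult_def map.rep_eq when_def)

lemma lmult_algebra:
  "lmult (a + b) p = lmult a p + lmult b p"
  "lmult a (p + q) = lmult a p + lmult a q"
  "lmult (a * b) p = lmult a (lmult b p)"
  "lmult 1 p = p"
  by (auto intro!: poly_mapping_eqI simp: lookup_add algebra_simps)

text \<open>
  The action on the target is a parameter so that one notion covers differentials (\<open>act = lmult\<close>), maps
  semilinear over a ring homomorphism \<open>h\<close> (\<open>act = (\<lambda>a. lmult (h a))\<close>) and homomorphisms to the trivial
  module (\<open>act = (\<lambda>a y. \<epsilon> a * y)\<close>).
\<close>

definition linear_to :: "('a::ring_1 \<Rightarrow> 'n::ab_group_add \<Rightarrow> 'n) \<Rightarrow> (('x \<Rightarrow>\<^sub>0 'a) \<Rightarrow> 'n) \<Rightarrow> bool"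
  where "linear_to act F \<longleftrightarrow>
    (\<forall>p q. F (p + q) = F p + F q) \<and> (\<forall>a p. F (lmult a p) = act a (F p))"

definition extend :: "('a::ring_1 \<Rightarrow> 'n::ab_group_add \<Rightarrow> 'n) \<Rightarrow> ('x \<Rightarrow> 'n) \<Rightarrow> ('x \<Rightarrow>\<^sub>0 'a) \<Rightarrow> 'n"
  where "extend act \<phi> p = (\<Sum>k \<in> Poly_Mapping.keys p. act (Poly_Mapping.lookup p k) (\<phi> k))"

lemma linear_to_add: "linear_to act F \<Longrightarrow> F (p + q) = F p + F q"
  and linear_to_act: "linear_to act F \<Longrightarrow> F (lmult a p) = act a (F p)"
  by (simp_all add: linear_to_def)

lemma linear_to_zero: "linear_to act F \<Longrightarrow> F 0 = 0"
  using linear_to_add [of act F 0 0] by simp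

lemma linear_to_minus: "linear_to act F \<Longrightarrow> F (- p) = - F p"
  using linear_to_add [of act F "- p" p] linear_to_zero [of act F]
  by (simp add: eq_neg_iff_add_eq_0)

lemma linear_to_diff: "linear_to act F \<Longrightarrow> F (p - q) = F p - F q"
  using linear_to_add [of act F p "- q"] linear_to_minus [of act F q] by simp

lemma linear_to_sum: "linear_to act F \<Longrightarrow> F (sum f S) = (\<Sum>s \<in> S. F (f s))"
  by (induction S rule: infinite_finite_induct) (simp_all add: linear_to_zero linear_to_add)

lemma linear_to_comp:
  "linear_to (\<lambda>a. lmult (h a)) F \<Longrightarrow> linear_to act G \<Longrightarrow> linear_to (\<lambda>a. act (h a)) (\<lambda>p. G (F p))"
  by (simp add: linear_to_def)

lemma unit_vector_expansion:
  "p = (\<Sum>k \<in> Poly_Mapping.keys p. lmult (Poly_Mapping.lookup p k) (unit_vector k))"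
proof (rule poly_mapping_eqI)
  fix j
  have "Poly_Mapping.lookup (\<Sum>k \<in> Poly_Mapping.keys p. lmult (Poly_Mapping.lookup p k) (unit_vector k)) j
     = (\<Sum>k \<in> Poly_Mapping.keys p. if k = j then Poly_Mapping.lookup p k else 0)"
    unfolding lookup_sum by (rule sum.cong) (auto simp: lookup_single when_def)
  also have "\<dots> = Poly_Mapping.lookup p j" by (simp add: in_keys_iff)
  finally show "Poly_Mapping.lookup p j =
      Poly_Mapping.lookup (\<Sum>k \<in> Poly_Mapping.keys p. lmult (Poly_Mapping.lookup p k) (unit_vector k)) j" ..
qed

lemma linear_to_expand:
  assumes "linear_to act F"
  shows "F p = extend act (\<lambda>k. F (unit_vector k)) p"
proof -
  have "F p = F (\<Sum>k \<in> Poly_Mapping.keys p. lmult (Poly_Mapping.lookup p k) (unit_vector k))"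
    by (metis unit_vector_expansion)
  then show ?thesis
    by (simp add: linear_to_sum [OF assms] linear_to_act [OF assms] extend_def)
qed

lemma linear_to_eqI:
  assumes "linear_to act F" "linear_to act G" "\<And>k. F (unit_vector k) = G (unit_vector k)"
  shows "F p = G p"
  using linear_to_expand [OF assms(1), of p] linear_to_expand [OF assms(2), of p] assms(3) by simp

locale module_action =
  fixes act :: "'a::ring_1 \<Rightarrow> 'n::ab_group_add \<Rightarrow> 'n"
  assumes act_add_left: "act (a + b) y = act a y + act b y"
    and act_add_right: "act a (y + z) = act a y + act a z"
    and act_mult: "act (a * b) y = act a (act b y)"
    and act_one: "act 1 y = y"
begin

lemma act_zero_left [simp]: "act 0 y = 0"
  using act_add_left [of 0 0 y] by simp

lemma act_zero_right [simp]: "act a 0 = 0"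
  using act_add_right [of a 0 0] by simp

lemma act_minus_right: "act a (- y) = - act a y"
  using act_add_right [of a "- y" y] by (simp add: eq_neg_iff_add_eq_0)

lemma act_sum_right: "act a (sum f S) = (\<Sum>s \<in> S. act a (f s))"
  by (induction S rule: infinite_finite_induct) (simp_all add: act_add_right)

lemma extend_superset:
  assumes "finite S" "Poly_Mapping.keys p \<subseteq> S"
  shows "extend act \<phi> p = (\<Sum>k \<in> S. act (Poly_Mapping.lookup p k) (\<phi> k))"
  unfolding extend_def using assms by (intro sum.mono_neutral_left) (auto simp: in_keys_iff)

lemma linear_to_extend: "linear_to act (extend act \<phi>)"
  unfolding linear_to_def
proof (intro conjI allI)
  fix p q :: "'x \<Rightarrow>\<^sub>0 'a" and \<phi> :: "'x \<Rightarrow> 'n"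
  let ?S = "Poly_Mapping.keys p \<union> Poly_Mapping.keys q"
  have "Poly_Mapping.keys (p + q) \<subseteq> ?S" by (rule Poly_Mapping.keys_add)
  then show "extend act \<phi> (p + q) = extend act \<phi> p + extend act \<phi> q"
    by (simp add: extend_superset [of ?S] lookup_add act_add_left sum.distrib)
next
  fix p :: "'x \<Rightarrow>\<^sub>0 'a" and a and \<phi> :: "'x \<Rightarrow> 'n"
  have "Poly_Mapping.keys (lmult a p) \<subseteq> Poly_Mapping.keys p" by (auto simp: in_keys_iff)
  then show "extend act \<phi> (lmult a p) = act a (extend act \<phi> p)"
    by (simp add: extend_superset [of "Poly_Mapping.keys p"] act_mult act_sum_right)
qed

lemma extend_unit_vector [simp]: "extend act \<phi> (unit_vector k) = \<phi> k"
  by (simp add: extend_def act_one)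

lemma linear_to_plus:
  "linear_to act F \<Longrightarrow> linear_to act G \<Longrightarrow> linear_to act (\<lambda>p. F p + G p)"
  by (simp add: linear_to_def act_add_right algebra_simps)

lemma linear_to_uminus: "linear_to act F \<Longrightarrow> linear_to act (\<lambda>p. - F p)"
  by (simp add: linear_to_def act_minus_right)

lemma linear_to_subtract:
  "linear_to act F \<Longrightarrow> linear_to act G \<Longrightarrow> linear_to act (\<lambda>p. F p - G p)"
  using linear_to_plus [of F "\<lambda>p. - G p"] linear_to_uminus [of G] by simp

end

definition unital_hom :: "('a::ring_1 \<Rightarrow> 'b::ring_1) \<Rightarrow> bool"
  where "unital_hom h \<longleftrightarrow> h 1 = 1 \<and> (\<forall>x y. h (x + y) = h x + h y) \<and> (\<forall>x y. h (x * y) = h x * h y)"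

lemma unital_homD:
  assumes "unital_hom h"
  shows "h 1 = 1" "h (x + y) = h x + h y" "h (x * y) = h x * h y" "h 0 = 0" "h (- x) = - h x"
    "h (x - y) = h x - h y" "h (sum f S) = (\<Sum>s \<in> S. h (f s))"
proof -
  show a: "h 1 = 1" "\<And>x y. h (x + y) = h x + h y" "h (x * y) = h x * h y"
    using assms by (auto simp: unital_hom_def)
  show z: "h 0 = 0" using a(2) [of 0 0] by simp
  show m: "h (- x) = - h x" for x using a(2) [of "- x" x] z by (simp add: eq_neg_iff_add_eq_0)
  show "h (x - y) = h x - h y" using a(2) [of x "- y"] m by simp
  show "h (sum f S) = (\<Sum>s \<in> S. h (f s))"
    by (induction S rule: infinite_finite_induct) (simp_all add: z a)
qed

lemma module_action_lmult:
  assumes "unital_hom h"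
  shows "module_action (\<lambda>a. lmult (h a) :: ('x \<Rightarrow>\<^sub>0 'b::ring_1) \<Rightarrow> _)"
  by unfold_locales (simp_all add: unital_homD [OF assms] lmult_algebra)

lemma module_action_trivial:
  assumes "unital_hom (\<epsilon> :: 'a::ring_1 \<Rightarrow> 'k::field)"
  shows "module_action (\<lambda>a y. \<epsilon> a * y)"
  by unfold_locales (simp_all add: unital_homD [OF assms] algebra_simps)

lemma unital_hom_ident: "unital_hom (\<lambda>a. a)"
  by (simp add: unital_hom_def)

section \<open>Gradings\<close>

text \<open>
  A grading is kept as its family of projections. The index is an integer because products and shifts of
  bidegrees produce differences \<open>m - i\<close> that can be negative; those components vanish.
\<close>

locale graded_projections =
  fixes c :: "int \<Rightarrow> 'a::ring_1 \<Rightarrow> 'a"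
  assumes c_add: "c m (a + b) = c m a + c m b"
    and c_c: "c m (c n a) = (if m = n then c n a else 0)"
    and finite_c: "finite {m. c m a \<noteq> 0}"
    and sum_c: "(\<Sum>m | c m a \<noteq> 0. c m a) = a"
    and c_mult: "c m (c i a * b) = c i a * c (m - i) b"
    and c_negative: "m < 0 \<Longrightarrow> c m a = 0"
    and c_one: "m \<noteq> 0 \<Longrightarrow> c m 1 = 0"
begin

lemma c_zero [simp]: "c m 0 = 0"
  using c_add [of m 0 0] by simp

lemma c_sum: "c m (sum f S) = (\<Sum>s \<in> S. c m (f s))"
  by (induction S rule: infinite_finite_induct) (simp_all add: c_add)

lemma c_times: "c m (a * b) = (\<Sum>i | c i a \<noteq> 0. c i a * c (m - i) b)"
proof -
  have "c m (a * b) = c m ((\<Sum>i | c i a \<noteq> 0. c i a) * b)" by (simp add: sum_c)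
  then show ?thesis by (simp only: sum_distrib_right c_sum c_mult)
qed

end

text \<open>
  The projection of a free module to bidegree \<open>e = (n, j)\<close>, when the basis vector \<open>k\<close> has bidegree
  \<open>deg k\<close>: internal degree \<open>j\<close> asks for a coefficient of degree \<open>j - snd (deg k)\<close> in front of \<open>k\<close>.
\<close>

definition proj :: "(int \<Rightarrow> 'a::ring_1 \<Rightarrow> 'a) \<Rightarrow> ('x \<Rightarrow> int \<times> int) \<Rightarrow> int \<times> int \<Rightarrow>
    ('x \<Rightarrow>\<^sub>0 'a) \<Rightarrow> ('x \<Rightarrow>\<^sub>0 'a)"
  where "proj c deg e p = Poly_Mapping.mapp
    (\<lambda>k a. if fst (deg k) = fst e then c (snd e - snd (deg k)) a else 0) p"

context graded_projections
begin

lemma lookup_proj: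
  "Poly_Mapping.lookup (proj c deg e p) k =
    (if fst (deg k) = fst e then c (snd e - snd (deg k)) (Poly_Mapping.lookup p k) else 0)"
  by (simp add: proj_def lookup_mapp when_def in_keys_iff)

lemma proj_add: "proj c deg e (p + q) = proj c deg e p + proj c deg e q"
  by (rule poly_mapping_eqI) (simp add: lookup_proj lookup_add c_add)

lemma proj_zero [simp]: "proj c deg e 0 = 0"
  using proj_add [of deg e 0 0] by simp

lemma proj_sum: "proj c deg e (sum f S) = (\<Sum>s \<in> S. proj c deg e (f s))"
  by (induction S rule: infinite_finite_induct) (simp_all add: proj_add)

lemma proj_proj: "proj c deg e (proj c deg e' p) = (if e = e' then proj c deg e p else 0)"
  by (rule poly_mapping_eqI) (auto simp: lookup_proj c_c prod_eq_iff)

lemma finite_proj: "finite {e. proj c deg e p \<noteq> 0}"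
proof (rule finite_subset)
  let ?S = "\<Union>k \<in> Poly_Mapping.keys p. (\<lambda>m. (fst (deg k), m + snd (deg k))) ` {m. c m (Poly_Mapping.lookup p k) \<noteq> 0}"
  show "finite ?S" by (intro finite_UN_I finite_imageI finite_c) simp
  show "{e. proj c deg e p \<noteq> 0} \<subseteq> ?S"
  proof
    fix e assume "e \<in> {e. proj c deg e p \<noteq> 0}"
    then have "\<exists>k. Poly_Mapping.lookup (proj c deg e p) k \<noteq> 0"
      by (metis (mono_tags) mem_Collect_eq lookup_zero poly_mapping_eqI)
    then obtain k where k: "Poly_Mapping.lookup (proj c deg e p) k \<noteq> 0" ..
    then have f: "fst (deg k) = fst e" "c (snd e - snd (deg k)) (Poly_Mapping.lookup p k) \<noteq> 0"
      by (auto simp: lookup_proj split: if_splits)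
    then have "k \<in> Poly_Mapping.keys p" by (auto simp: in_keys_iff)
    moreover have "e = (fst (deg k), (snd e - snd (deg k)) + snd (deg k))" using f by (simp add: prod_eq_iff)
    ultimately show "e \<in> ?S" using f(2) by blast
  qed
qed

lemma sum_proj: "(\<Sum>e | proj c deg e p \<noteq> 0. proj c deg e p) = p"
proof (rule poly_mapping_eqI)
  fix k
  let ?a = "Poly_Mapping.lookup p k"
  let ?i = "\<lambda>m. (fst (deg k), m + snd (deg k))"
  let ?S = "{e. proj c deg e p \<noteq> 0}"
  have "Poly_Mapping.lookup (\<Sum>e \<in> ?S. proj c deg e p) k = (\<Sum>e \<in> ?S. Poly_Mapping.lookup (proj c deg e p) k)"
    by (simp add: lookup_sum)
  also have "\<dots> = (\<Sum>e \<in> ?i ` {m. c m ?a \<noteq> 0}. Poly_Mapping.lookup (proj c deg e p) k)"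
  proof (rule sum.mono_neutral_cong)
    fix e assume e: "e \<in> ?S - ?i ` {m. c m ?a \<noteq> 0}"
    show "Poly_Mapping.lookup (proj c deg e p) k = 0"
    proof (rule ccontr)
      assume "Poly_Mapping.lookup (proj c deg e p) k \<noteq> 0"
      then have "fst (deg k) = fst e" "c (snd e - snd (deg k)) ?a \<noteq> 0"
        by (auto simp: lookup_proj split: if_splits)
      then have "e \<in> ?i ` {m. c m ?a \<noteq> 0}"
        by (intro image_eqI [of _ _ "snd e - snd (deg k)"]) (auto simp: prod_eq_iff)
      then show False using e by blast
    qed
  qed (use finite_proj finite_c in auto)
  also have "\<dots> = (\<Sum>m | c m ?a \<noteq> 0. c m ?a)"
    by (subst sum.reindex) (auto simp: inj_on_def lookup_proj intro!: sum.cong)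
  finally show "Poly_Mapping.lookup (\<Sum>e \<in> ?S. proj c deg e p) k = ?a"
    by (simp add: sum_c)
qed

lemma proj_unit_vector: "proj c deg e (unit_vector k) = 0" if "e \<noteq> deg k"
  using that c_one by (intro poly_mapping_eqI) (auto simp: lookup_proj lookup_single when_def prod_eq_iff)

end

text \<open>
  For additive maps and finite \<open>D\<close> this says that \<open>F\<close> is a sum of bihomogeneous maps each of which lowers the bidegree
  by a member of \<open>D\<close>. Stated by vanishing alone, the property passes to composites without a choice of summands.
\<close>

definition spread :: "(int \<times> int \<Rightarrow> 'm::zero \<Rightarrow> 'm) \<Rightarrow> (int \<times> int \<Rightarrow> 'n::zero \<Rightarrow> 'n) \<Rightarrow>
    (int \<times> int) set \<Rightarrow> ('m \<Rightarrow> 'n) \<Rightarrow> bool"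
  where "spread prS prT D F \<longleftrightarrow> (\<forall>e p. (\<forall>d \<in> D. prS (e + d) p = 0) \<longrightarrow> prT e (F p) = 0)"

text \<open>
  The trivial module is concentrated in bidegree \<open>(0, 0)\<close>.
\<close>

definition trivial_proj :: "int \<times> int \<Rightarrow> 'k::zero \<Rightarrow> 'k"
  where "trivial_proj e y = (if e = 0 then y else 0)"

lemma spreadD:
  "spread prS prT D F \<Longrightarrow> (\<And>d. d \<in> D \<Longrightarrow> prS (e + d) p = 0) \<Longrightarrow> prT e (F p) = 0"
  unfolding spread_def by blast

lemma spread_comp:
  assumes "spread prR prS D F" "spread prS prT D' G"
  shows "spread prR prT (D' + D) (\<lambda>p. G (F p))"
  unfolding spread_def
proof (intro allI impI)
  fix e p assume *: "\<forall>d \<in> D' + D. prR (e + d) p = 0"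
  have "prS (e + d') (F p) = 0" if d': "d' \<in> D'" for d'
  proof -
    have "\<forall>d \<in> D. prR (e + d' + d) p = 0"
      using * set_plus_intro [OF d', of _ D] by (simp add: add.assoc)
    then show ?thesis using assms(1) unfolding spread_def by blast
  qed
  then show "prT e (G (F p)) = 0" using assms(2) unfolding spread_def by blast
qed

lemma spread_mono: "spread prS prT D F \<Longrightarrow> D \<subseteq> D' \<Longrightarrow> spread prS prT D' F"
  unfolding spread_def by blast

text \<open>
  The assumption \<open>pr_act\<close> expresses that a scalar of degree \<open>m\<close> raises the internal degree by \<open>m\<close>: a
  component of \<open>act a y\<close> has to come from a component of \<open>a\<close> and one of \<open>y\<close>.
\<close>

locale graded_target = module_action act
  for act :: "'a::ring_1 \<Rightarrow> 'n::ab_group_add \<Rightarrow> 'n" +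
  fixes c :: "int \<Rightarrow> 'a \<Rightarrow> 'a" and pr :: "int \<times> int \<Rightarrow> 'n \<Rightarrow> 'n"
  assumes pr_add: "pr e (y + z) = pr e y + pr e z"
    and pr_act: "(\<And>m. c m a = 0 \<or> pr (e - (0, m)) y = 0) \<Longrightarrow> pr e (act a y) = 0"
begin

lemma pr_zero: "pr e 0 = 0"
  using pr_add [of e 0 0] by simp

lemma pr_minus: "pr e (- y) = - pr e y"
  using pr_add [of e "- y" y] pr_zero by (simp add: eq_neg_iff_add_eq_0)

lemma pr_sum: "pr e (sum f S) = (\<Sum>s \<in> S. pr e (f s))"
  by (induction S rule: infinite_finite_induct) (simp_all add: pr_add pr_zero)

lemma spread_plus:
  "spread prS pr D F \<Longrightarrow> spread prS pr D G \<Longrightarrow> spread prS pr D (\<lambda>p. F p + G p)"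
  unfolding spread_def by (simp add: pr_add)

lemma spread_uminus: "spread prS pr D F \<Longrightarrow> spread prS pr D (\<lambda>p. - F p)"
  unfolding spread_def by (simp add: pr_minus)

lemma spread_subtract:
  "spread prS pr D F \<Longrightarrow> spread prS pr D G \<Longrightarrow> spread prS pr D (\<lambda>p. F p - G p)"
  using spread_plus [of prS D F "\<lambda>p. - G p"] spread_uminus [of prS D G] by simp

end

text \<open>
  The bound on \<open>\<phi>\<close> is asked for on the support of \<open>p\<close> only, since \<open>null_homotopy\<close> uses this while \<open>\<phi>\<close>
  is under construction and controlled just on basis vectors of lower homological degree.
\<close>

lemma (in graded_projections) pr_extend_eq_0:
  assumes T: "graded_target act c pr"
    and \<phi>: "\<And>k e. k \<in> Poly_Mapping.keys p \<Longrightarrow> deg k - e \<notin> D \<Longrightarrow> pr e (\<phi> k) = 0"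
    and p: "\<And>d. d \<in> D \<Longrightarrow> proj c deg (e + d) p = 0"
  shows "pr e (extend act \<phi> p) = 0"
proof -
  interpret T: graded_target act c pr by (rule T)
  have "pr e (act (Poly_Mapping.lookup p k) (\<phi> k)) = 0" if k: "k \<in> Poly_Mapping.keys p" for k
  proof (rule T.pr_act)
    fix m
    show "c m (Poly_Mapping.lookup p k) = 0 \<or> pr (e - (0, m)) (\<phi> k) = 0"
    proof (cases "deg k - (e - (0, m)) \<in> D")
      case True
      have "e + (deg k - (e - (0, m))) = deg k + (0, m)" by (simp add: prod_eq_iff)
      then have "proj c deg (deg k + (0, m)) p = 0" using p [OF True] by metis
      then have "Poly_Mapping.lookup (proj c deg (deg k + (0, m)) p) k = 0" by simp
      then show ?thesis by (simp add: lookup_proj)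
    next
      case False then show ?thesis using \<phi> [OF k] by blast
    qed
  qed
  then show ?thesis by (simp add: extend_def T.pr_sum)
qed

lemma (in graded_projections) spread_extend:
  assumes "graded_target act c pr" "\<And>k e. deg k - e \<notin> D \<Longrightarrow> pr e (\<phi> k) = 0"
  shows "spread (proj c deg) pr D (extend act \<phi>)"
  unfolding spread_def
proof (intro allI impI)
  fix e p assume "\<forall>d \<in> D. proj c deg (e + d) p = 0"
  then show "pr e (extend act \<phi> p) = 0"
    using assms(2) by (intro pr_extend_eq_0 [OF assms(1), of p deg D]) auto
qed

lemma graded_target_free:
  fixes deg :: "'x \<Rightarrow> int \<times> int" and h :: "'a::ring_1 \<Rightarrow> 'b::ring_1"
  assumes "graded_projections c" "graded_projections c'" "unital_hom h" "\<And>m a. h (c m a) = c' m (h a)"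
  shows "graded_target (\<lambda>a. lmult (h a)) c (proj c' deg)"
proof -
  interpret c: graded_projections c by fact
  interpret c': graded_projections c' by fact
  interpret module_action "\<lambda>a. lmult (h a) :: ('x \<Rightarrow>\<^sub>0 'b) \<Rightarrow> _" by (rule module_action_lmult) fact
  show ?thesis
  proof
    fix e :: "int \<times> int" and a and y :: "'x \<Rightarrow>\<^sub>0 'b"
    assume *: "\<And>m. c m a = 0 \<or> proj c' deg (e - (0, m)) y = 0"
    show "proj c' deg e (lmult (h a) y) = 0"
    proof (rule poly_mapping_eqI)
      fix k
      have "c' m (h a) * c' (snd e - snd (deg k) - m) (Poly_Mapping.lookup y k) = 0"
        if "fst (deg k) = fst e" for m
      proof (cases "c m a = 0")
        case True then show ?thesis using assms(4) [of m a] unital_homD(4) [OF assms(3)] by simp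
      next
        case False
        then have "Poly_Mapping.lookup (proj c' deg (e - (0, m)) y) k = 0" using * [of m] by simp
        then show ?thesis using that by (simp add: c'.lookup_proj algebra_simps)
      qed
      then show "Poly_Mapping.lookup (proj c' deg e (lmult (h a) y)) k = Poly_Mapping.lookup 0 k"
        by (simp add: c'.lookup_proj c'.c_times)
    qed
  qed (simp add: c'.proj_add)
qed

section \<open>Null-homotopies\<close>

text \<open>
  The homotopy is built on basis vectors by recursion on their homological degree. If \<open>H\<close> is known in
  lower degrees, then \<open>\<psi> + H \<circ> d\<close> sends a basis vector to a cycle, because \<open>\<delta> \<circ> \<psi> = - \<psi> \<circ> d\<close> and
  \<open>d \<circ> d = 0\<close>; exactness of the target provides the value of \<open>H\<close>. The submodule \<open>Z\<close> is the place where
  the target is exact: the kernel of the augmentation for a resolution, everything for an exact complex.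
  Existence of lifts, their uniqueness and contractions of exact complexes are instances, with different \<open>\<psi>\<close>.
\<close>

lemma (in graded_projections) null_homotopy:
  fixes deg :: "'x \<Rightarrow> int \<times> int" and act :: "'a \<Rightarrow> 'n::ab_group_add \<Rightarrow> 'n"
  assumes T: "graded_target act c pr"
    and deg: "\<And>k. 0 \<le> fst (deg k)"
    and lower: "\<And>k j. j \<in> Poly_Mapping.keys (d (unit_vector k)) \<Longrightarrow> fst (deg j) < fst (deg k)"
    and d: "linear_to lmult d" "spread (proj c deg) (proj c deg) {(1, 0)} d" "\<And>p. d (d p) = 0"
    and \<delta>: "\<And>y z. \<delta> (y + z) = \<delta> y + \<delta> z" "\<And>a y. \<delta> (act a y) = act a (\<delta> y)"
    and Z: "0 \<in> Z" "\<And>y z. y \<in> Z \<Longrightarrow> z \<in> Z \<Longrightarrow> y + z \<in> Z" "\<And>a y. y \<in> Z \<Longrightarrow> act a y \<in> Z"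
    and exact: "\<And>y. y \<in> Z \<Longrightarrow> \<delta> y = 0 \<Longrightarrow>
      \<exists>y' \<in> Z. \<delta> y' = y \<and> (\<forall>e. pr (e - (1, 0)) y = 0 \<longrightarrow> pr e y' = 0)"
    and \<psi>: "linear_to act \<psi>" "spread (proj c deg) pr (D + {(1, 0)}) \<psi>"
      "\<And>p. \<psi> p \<in> Z" "\<And>p. \<delta> (\<psi> p) = - \<psi> (d p)"
  obtains H where "linear_to act H" "\<And>p. \<delta> (H p) = \<psi> p + H (d p)" "\<And>p. H p \<in> Z"
    "spread (proj c deg) pr D H"
proof -
  interpret T: graded_target act c pr by (rule T)
  have \<delta>0: "\<delta> 0 = 0" using \<delta>(1) [of 0 0] by simp
  have \<delta>_sum: "\<delta> (sum f S) = (\<Sum>s \<in> S. \<delta> (f s))" for f :: "'x \<Rightarrow> 'n" and S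
    by (induction S rule: infinite_finite_induct) (simp_all add: \<delta>0 \<delta>)
  have Z_sum: "(\<And>s. s \<in> S \<Longrightarrow> f s \<in> Z) \<Longrightarrow> sum f S \<in> Z" for f :: "'x \<Rightarrow> 'n" and S
    by (induction S rule: infinite_finite_induct) (simp_all add: Z)
  let ?R = "measure (\<lambda>k. nat (fst (deg k)))"
  define good where "good f k r \<longleftrightarrow>
    \<delta> r = \<psi> (unit_vector k) + extend act f (d (unit_vector k)) \<and> r \<in> Z \<and>
    (\<forall>e. deg k - e \<notin> D \<longrightarrow> pr e r = 0)" for f k r
  have lt: "(j, k) \<in> ?R" if "j \<in> Poly_Mapping.keys (d (unit_vector k))" for j k
    using lower [OF that] deg [of j] by simp
  \<comment> \<open>The values of the homotopy on basis vectors; \<open>good f k r\<close> says that \<open>r\<close> may serve as the value at \<open>k\<close> when \<open>f\<close> gives the values in lower degrees.\<close>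
  have "\<exists>\<eta>. \<forall>k. good \<eta> k (\<eta> k)"
  proof (rule dependent_wf_choice [of ?R])
    fix f g :: "'x \<Rightarrow> 'n" and k r
    assume *: "\<And>j. (j, k) \<in> ?R \<Longrightarrow> f j = g j"
    have "extend act f (d (unit_vector k)) = extend act g (d (unit_vector k))"
      unfolding extend_def by (rule sum.cong) (auto simp: * [OF lt])
    then show "good f k r = good g k r" by (simp add: good_def)
  next
    fix k and f :: "'x \<Rightarrow> 'n"
    assume *: "\<And>j. (j, k) \<in> ?R \<Longrightarrow> good f j (f j)"
    let ?y = "\<psi> (unit_vector k) + extend act f (d (unit_vector k))"
    have f: "\<delta> (f j) = \<psi> (unit_vector j) + extend act f (d (unit_vector j))" "f j \<in> Z"
      "\<And>e. deg j - e \<notin> D \<Longrightarrow> pr e (f j) = 0"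
      if "j \<in> Poly_Mapping.keys (d (unit_vector k))" for j
      using * [OF lt [OF that]] by (auto simp: good_def)
    have lin: "linear_to act (\<lambda>p. \<psi> p + extend act f (d p))"
      using T.linear_to_plus [OF \<psi>(1)] linear_to_comp [OF d(1) T.linear_to_extend] by blast
    have "\<delta> (extend act f (d (unit_vector k))) =
        extend act (\<lambda>j. \<psi> (unit_vector j) + extend act f (d (unit_vector j))) (d (unit_vector k))"
      unfolding extend_def [of act _ "d (unit_vector k)"] \<delta>_sum \<delta>(2)
      by (rule sum.cong) (auto simp: f(1))
    also have "\<dots> = \<psi> (d (unit_vector k)) + extend act f (d (d (unit_vector k)))"
      using linear_to_expand [OF lin, of "d (unit_vector k)"] by simp
    finally have "\<delta> ?y = 0"
      by (simp add: \<delta> \<psi>(4) d(3) linear_to_zero [OF T.linear_to_extend])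
    moreover have "?y \<in> Z"
      unfolding extend_def by (intro Z(2) \<psi>(3) Z_sum Z(3) f(2))
    ultimately obtain r where r: "r \<in> Z" "\<delta> r = ?y" "\<And>e. pr (e - (1, 0)) ?y = 0 \<Longrightarrow> pr e r = 0"
      using exact by blast
    have "pr e r = 0" if e: "deg k - e \<notin> D" for e
    proof (rule r(3))
      have unit: "proj c deg (e - (1, 0) + x + (1, 0)) (unit_vector k) = 0" if "x \<in> D" for x
      proof (rule proj_unit_vector)
        have "deg k - e = x" if "e - (1, 0) + x + (1, 0) = deg k" using that by (auto simp: prod_eq_iff)
        then show "e - (1, 0) + x + (1, 0) \<noteq> deg k" using e that by blast
      qed
      have "pr (e - (1, 0)) (\<psi> (unit_vector k)) = 0"
      proof (rule spreadD [OF \<psi>(2)])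
        fix x assume "x \<in> D + {(1, 0)}"
        then obtain x' where "x' \<in> D" "x = x' + (1, 0)" by (auto elim!: set_plus_elim)
        then show "proj c deg (e - (1, 0) + x) (unit_vector k) = 0"
          using unit [of x'] by (simp only: add.assoc)
      qed
      moreover have "pr (e - (1, 0)) (extend act f (d (unit_vector k))) = 0"
      proof (rule pr_extend_eq_0 [OF T f(3)])
        fix x assume "x \<in> D"
        then show "proj c deg (e - (1, 0) + x) (d (unit_vector k)) = 0"
          using unit [of x] by (intro spreadD [OF d(2)]) simp
      qed
      ultimately show "pr (e - (1, 0)) ?y = 0" by (simp add: T.pr_add)
    qed
    then show "\<exists>r. good f k r" unfolding good_def using r(1,2) by blast
  qed simp
  then obtain \<eta> where \<eta>: "\<And>k. good \<eta> k (\<eta> k)" by blast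
  show thesis
  proof (rule that [of "extend act \<eta>"])
    show lin: "linear_to act (extend act \<eta>)" by (rule T.linear_to_extend)
    show "spread (proj c deg) pr D (extend act \<eta>)"
      using \<eta> unfolding good_def by (intro spread_extend [OF T]) blast
    show "extend act \<eta> p \<in> Z" for p
      unfolding extend_def using \<eta> unfolding good_def by (intro Z_sum Z(3)) blast
    have 1: "linear_to act (\<lambda>p. \<delta> (extend act \<eta> p))"
      using lin \<delta> by (simp add: linear_to_def)
    have 2: "linear_to act (\<lambda>p. \<psi> p + extend act \<eta> (d p))"
      using T.linear_to_plus [OF \<psi>(1)] linear_to_comp [OF d(1) lin] by blast
    show "\<delta> (extend act \<eta> p) = \<psi> p + extend act \<eta> (d p)" for p
    proof (rule linear_to_eqI [OF 1 2])
      fix k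
      show "\<delta> (extend act \<eta> (unit_vector k)) =
          \<psi> (unit_vector k) + extend act \<eta> (d (unit_vector k))"
        using \<eta> [of k] unfolding good_def T.extend_unit_vector by blast
    qed
  qed
qed

locale graded_differential = graded_projections c
  for c :: "int \<Rightarrow> 'a::ring_1 \<Rightarrow> 'a" +
  fixes deg :: "'x \<Rightarrow> int \<times> int" and d :: "('x \<Rightarrow>\<^sub>0 'a) \<Rightarrow> ('x \<Rightarrow>\<^sub>0 'a)"
  assumes d_linear: "linear_to lmult d"
    and d_spread: "spread (proj c deg) (proj c deg) {(1, 0)} d"
begin

abbreviation "pr \<equiv> proj c deg"

lemma deg_keys_d:
  assumes "j \<in> Poly_Mapping.keys (d (unit_vector k))"
  shows "fst (deg j) = fst (deg k) - 1"
proof (rule ccontr)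
  assume *: "fst (deg j) \<noteq> fst (deg k) - 1"
  let ?a = "Poly_Mapping.lookup (d (unit_vector k)) j"
  have "c m ?a = 0" for m
  proof -
    let ?e = "(fst (deg j), m + snd (deg j))"
    have "pr (?e + (1, 0)) (unit_vector k) = 0"
      using * by (intro proj_unit_vector) (auto simp: prod_eq_iff)
    then have "pr ?e (d (unit_vector k)) = 0" using d_spread unfolding spread_def by blast
    then have "Poly_Mapping.lookup (pr ?e (d (unit_vector k))) j = 0" by simp
    then show ?thesis by (simp add: lookup_proj)
  qed
  then have "?a = 0" using sum_c [of ?a] by simp
  then show False using assms by (simp add: in_keys_iff)
qed

lemma d_proj: "d (pr e p) = pr (e - (1, 0)) (d p)"
proof -
  have *: "pr e' (d (pr e p)) = (if e' = e - (1, 0) then d (pr e p) else 0)" for e' e p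
  proof (cases "e' = e - (1, 0)")
    case False
    then have "pr (e' + (1, 0)) (pr e p) = 0" by (auto simp: proj_proj)
    then have "pr e' (d (pr e p)) = 0" using d_spread unfolding spread_def by blast
    then show ?thesis using False by simp
  next
    case True
    have "pr e'' (d (pr e p)) = 0" if "e'' \<noteq> e'" for e''
    proof -
      have "pr (e'' + (1, 0)) (pr e p) = 0" using that True by (auto simp: proj_proj)
      then show ?thesis using d_spread unfolding spread_def by blast
    qed
    then have "{e''. pr e'' (d (pr e p)) \<noteq> 0} \<subseteq> {e'}" by auto
    then have "(\<Sum>e'' | pr e'' (d (pr e p)) \<noteq> 0. pr e'' (d (pr e p))) = (\<Sum>e'' \<in> {e'}. pr e'' (d (pr e p)))"
      by (intro sum.mono_neutral_left) auto
    then show ?thesis using True by (simp add: sum_proj)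
  qed
  let ?S = "insert e {e. pr e p \<noteq> 0}"
  have "pr (e - (1, 0)) (d p) = pr (e - (1, 0)) (d (\<Sum>e' \<in> {e. pr e p \<noteq> 0}. pr e' p))"
    by (simp add: sum_proj)
  also have "(\<Sum>e' \<in> {e. pr e p \<noteq> 0}. pr e' p) = (\<Sum>e' \<in> ?S. pr e' p)"
    by (rule sum.mono_neutral_left) (auto simp: finite_proj)
  also have "pr (e - (1, 0)) (d \<dots>) = (\<Sum>e' \<in> ?S. if e' = e then d (pr e p) else 0)"
    unfolding linear_to_sum [OF d_linear] proj_sum * by (rule sum.cong) auto
  also have "\<dots> = d (pr e p)" by (simp add: finite_proj)
  finally show ?thesis ..
qed

text \<open>
  The components of a preimage outside the shifted support of \<open>p\<close> can be discarded, as \<open>d\<close> is homogeneous.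
\<close>

lemma graded_preimage:
  assumes "d q = p"
  obtains q' where "d q' = p" "\<And>e. pr (e - (1, 0)) p = 0 \<Longrightarrow> pr e q' = 0"
proof
  let ?S = "{e. pr e p \<noteq> 0}"
  let ?q' = "\<Sum>e \<in> ?S. pr (e + (1, 0)) q"
  show "d ?q' = p" by (simp add: linear_to_sum [OF d_linear] d_proj assms sum_proj)
  fix e assume *: "pr (e - (1, 0)) p = 0"
  have "pr e (pr (e' + (1, 0)) q) = 0" if "e' \<in> ?S" for e'
    using that * by (auto simp: proj_proj)
  then show "pr e ?q' = 0" by (simp add: proj_sum)
qed

end

section \<open>Connected algebras and free resolutions\<close>

locale connected_algebra = graded_projections c
  for c :: "int \<Rightarrow> 'a::ring_1 \<Rightarrow> 'a" +
  fixes \<kappa> :: "'k::field \<Rightarrow> 'a" and \<epsilon> :: "'a \<Rightarrow> 'k"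
  assumes \<epsilon>_hom: "unital_hom \<epsilon>"
    and \<epsilon>_\<kappa>: "\<epsilon> (\<kappa> x) = x"
    and \<kappa>_\<epsilon>: "\<kappa> (\<epsilon> a) = c 0 a"
    and \<kappa>_central: "\<kappa> x * a = a * \<kappa> x"
begin

lemma \<epsilon>_eq_0: "c 0 a = 0 \<longleftrightarrow> \<epsilon> a = 0"
  by (metis \<epsilon>_\<kappa> \<kappa>_\<epsilon> c_zero unital_homD(4) [OF \<epsilon>_hom])

lemma graded_target_trivial: "graded_target (\<lambda>a y. \<epsilon> a * y) c trivial_proj"
proof -
  interpret module_action "\<lambda>a y. \<epsilon> a * y" by (rule module_action_trivial [OF \<epsilon>_hom])
  show ?thesis
  proof
    fix e :: "int \<times> int" and a and y :: 'k
    assume *: "\<And>m. c m a = 0 \<or> trivial_proj (e - (0, m)) y = 0"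
    show "trivial_proj e (\<epsilon> a * y) = 0"
      using * [of 0] by (auto simp: trivial_proj_def \<epsilon>_eq_0 simp flip: zero_prod_def)
  qed (simp add: trivial_proj_def)
qed

lemma graded_target_self: "graded_target lmult c (proj c deg)"
  using graded_target_free [OF graded_projections_axioms graded_projections_axioms unital_hom_ident]
  by simp

end

abbreviation (input) trivial_hom :: "('a::ring_1 \<Rightarrow> 'k::field) \<Rightarrow> (('x \<Rightarrow>\<^sub>0 'a) \<Rightarrow> 'k) \<Rightarrow> bool"
  where "trivial_hom \<epsilon> f \<equiv> linear_to (\<lambda>a y. \<epsilon> a * y) f"

lemma spread_trivial:
  "spread pr trivial_proj D f \<longleftrightarrow> (\<forall>p. (\<forall>d \<in> D. pr d p = 0) \<longrightarrow> f p = 0)"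
  unfolding spread_def trivial_proj_def by (auto simp del: split_paired_All)

locale free_resolution = connected_algebra c \<kappa> \<epsilon> + graded_differential c deg d
  for c :: "int \<Rightarrow> 'a::ring_1 \<Rightarrow> 'a" and \<kappa> :: "'k::field \<Rightarrow> 'a" and \<epsilon>
    and deg :: "'x \<Rightarrow> int \<times> int" and d :: "('x \<Rightarrow>\<^sub>0 'a) \<Rightarrow> ('x \<Rightarrow>\<^sub>0 'a)" +
  fixes \<alpha> :: "('x \<Rightarrow>\<^sub>0 'a) \<Rightarrow> 'k"
  assumes deg_nonneg: "0 \<le> fst (deg k)"
    and d_d: "d (d p) = 0"
    and \<alpha>_hom: "trivial_hom \<epsilon> \<alpha>"
    and \<alpha>_spread: "spread (proj c deg) trivial_proj {0} \<alpha>"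
    and \<alpha>_d: "\<alpha> (d p) = 0"
    and exact: "d p = 0 \<Longrightarrow> \<alpha> p = 0 \<Longrightarrow> \<exists>p'. d p' = p"
    and \<alpha>_surj: "\<exists>p. \<alpha> p = 1"
begin

sublocale triv: graded_target "\<lambda>a y. \<epsilon> a * y" c trivial_proj
  by (rule graded_target_trivial)

sublocale self: graded_target lmult c "proj c deg"
  by (rule graded_target_self)

lemma proj_negative: "fst e < 0 \<Longrightarrow> pr e p = 0"
proof (rule poly_mapping_eqI)
  fix k assume "fst e < 0"
  then show "Poly_Mapping.lookup (pr e p) k = Poly_Mapping.lookup 0 k"
    using deg_nonneg [of k] by (simp add: lookup_proj)
qed

text \<open>
  The component of bidegree \<open>(0, 0)\<close> of any preimage of 1 qualifies: the augmentation sees no other component,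
  and \<open>d\<close> takes it to homological degree \<open>-1\<close>, where the resolution vanishes.
\<close>

lemma homogeneous_unit: obtains u where "\<And>e. e \<noteq> 0 \<Longrightarrow> pr e u = 0" "\<alpha> u = 1" "d u = 0"
proof -
  obtain p where p: "\<alpha> p = 1" using \<alpha>_surj ..
  have "\<alpha> (p - pr 0 p) = 0"
  proof -
    have "pr 0 (p - pr 0 p) = 0" using self.pr_add [of 0 p "- pr 0 p"] self.pr_minus [of 0 "pr 0 p"] by (simp add: proj_proj)
    then show ?thesis using \<alpha>_spread by (simp add: spread_trivial)
  qed
  then have "\<alpha> (pr 0 p) = 1" using p linear_to_diff [OF \<alpha>_hom, of p "pr 0 p"] by simp
  moreover have "d (pr 0 p) = 0" by (simp add: d_proj proj_negative)
  ultimately show thesis using that [of "pr 0 p"] by (simp add: proj_proj)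
qed

lemma exact_graded:
  assumes "\<alpha> p = 0" "d p = 0"
  shows "\<exists>p'. \<alpha> p' = 0 \<and> d p' = p \<and> (\<forall>e. pr (e - (1, 0)) p = 0 \<longrightarrow> pr e p' = 0)"
proof -
  obtain q where "d q = p" using exact assms by blast
  then obtain p' where p': "d p' = p" "\<And>e. pr (e - (1, 0)) p = 0 \<Longrightarrow> pr e p' = 0"
    by (rule graded_preimage) blast
  have "pr 0 p' = 0" by (rule p'(2)) (simp add: proj_negative)
  then have "\<alpha> p' = 0" using \<alpha>_spread by (simp add: spread_trivial)
  then show ?thesis using p' by blast
qed

definition cochain :: "(('x \<Rightarrow>\<^sub>0 'a) \<Rightarrow> 'k) \<Rightarrow> bool"
  where "cochain f \<longleftrightarrow> trivial_hom \<epsilon> f \<and> (\<exists>D. finite D \<and> spread pr trivial_proj D f)"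

definition cocycle :: "(('x \<Rightarrow>\<^sub>0 'a) \<Rightarrow> 'k) \<Rightarrow> bool"
  where "cocycle f \<longleftrightarrow> cochain f \<and> (\<forall>p. f (d p) = 0)"

definition cohomologous :: "(('x \<Rightarrow>\<^sub>0 'a) \<Rightarrow> 'k) \<Rightarrow> (('x \<Rightarrow>\<^sub>0 'a) \<Rightarrow> 'k) \<Rightarrow> bool"
  where "cohomologous f f' \<longleftrightarrow> (\<exists>w. cochain w \<and> (\<forall>p. f p - f' p = w (d p)))"

lemma cochainE:
  assumes "cochain f"
  obtains D where "finite D" "spread pr trivial_proj D f" "trivial_hom \<epsilon> f"
  using assms unfolding cochain_def by blast

lemma cocycleD:
  assumes "cocycle f"
  shows "cochain f" "f (d p) = 0" "trivial_hom \<epsilon> f"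
  using assms unfolding cocycle_def cochain_def by blast+

lemma cochain_plus: "cochain f \<Longrightarrow> cochain f' \<Longrightarrow> cochain (\<lambda>p. f p + f' p)"
  unfolding cochain_def
proof (elim conjE exE)
  fix D D' assume *: "trivial_hom \<epsilon> f" "trivial_hom \<epsilon> f'" "finite D" "finite D'"
    "spread pr trivial_proj D f" "spread pr trivial_proj D' f'"
  have "spread pr trivial_proj (D \<union> D') (\<lambda>p. f p + f' p)"
    by (intro triv.spread_plus spread_mono [OF *(5)] spread_mono [OF *(6)]) auto
  then show "trivial_hom \<epsilon> (\<lambda>p. f p + f' p) \<and> (\<exists>D. finite D \<and> spread pr trivial_proj D (\<lambda>p. f p + f' p))"
    using * triv.linear_to_plus by blast
qed

lemma cochain_scale: "cochain f \<Longrightarrow> cochain (\<lambda>p. x * f p)"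
  unfolding cochain_def linear_to_def spread_trivial by (auto simp: algebra_simps)

lemma cochain_0: "cochain (\<lambda>p. 0)"
  unfolding cochain_def linear_to_def spread_trivial by auto

lemma cocycle_plus: "cocycle f \<Longrightarrow> cocycle f' \<Longrightarrow> cocycle (\<lambda>p. f p + f' p)"
  by (simp add: cocycle_def cochain_plus)

lemma cocycle_scale: "cocycle f \<Longrightarrow> cocycle (\<lambda>p. x * f p)"
  by (simp add: cocycle_def cochain_scale)

lemma cocycle_\<alpha>: "cocycle \<alpha>"
  using \<alpha>_hom \<alpha>_spread \<alpha>_d unfolding cocycle_def cochain_def by blast

lemma cohomologous_refl: "cohomologous f f"
  unfolding cohomologous_def using cochain_0 by fastforce

lemma cohomologous_eq: "(\<And>p. f p = f' p) \<Longrightarrow> cohomologous f f'"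
  using cohomologous_refl [of f] by presburger

lemma cohomologous_trans: "cohomologous f f' \<Longrightarrow> cohomologous f' f'' \<Longrightarrow> cohomologous f f''"
  unfolding cohomologous_def
proof (elim exE conjE)
  fix w w' assume "cochain w" "cochain w'" "\<forall>p. f p - f' p = w (d p)" "\<forall>p. f' p - f'' p = w' (d p)"
  then show "\<exists>w. cochain w \<and> (\<forall>p. f p - f'' p = w (d p))"
    by (intro exI [of _ "\<lambda>p. w p + w' p"]) (auto simp: cochain_plus algebra_simps)
qed

lemma cohomologous_sym: "cohomologous f f' \<Longrightarrow> cohomologous f' f"
  unfolding cohomologous_def
proof (elim exE conjE)
  fix w assume "cochain w" "\<forall>p. f p - f' p = w (d p)"
  then show "\<exists>w. cochain w \<and> (\<forall>p. f' p - f p = w (d p))"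
    by (intro exI [of _ "\<lambda>p. -1 * w p"] conjI cochain_scale) (auto simp: algebra_simps)
qed

lemma cohomologous_plus:
  "cohomologous f f' \<Longrightarrow> cohomologous h h' \<Longrightarrow> cohomologous (\<lambda>p. f p + h p) (\<lambda>p. f' p + h' p)"
  unfolding cohomologous_def
proof (elim exE conjE)
  fix w w' assume "cochain w" "cochain w'" "\<forall>p. f p - f' p = w (d p)" "\<forall>p. h p - h' p = w' (d p)"
  then show "\<exists>w. cochain w \<and> (\<forall>p. f p + h p - (f' p + h' p) = w (d p))"
    by (intro exI [of _ "\<lambda>p. w p + w' p"]) (auto simp: cochain_plus algebra_simps)
qed

lemma cohomologous_scale: "cohomologous f f' \<Longrightarrow> cohomologous (\<lambda>p. x * f p) (\<lambda>p. x * f' p)"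
  unfolding cohomologous_def
proof (elim exE conjE)
  fix w assume "cochain w" "\<forall>p. f p - f' p = w (d p)"
  then show "\<exists>w. cochain w \<and> (\<forall>p. x * f p - x * f' p = w (d p))"
    by (intro exI [of _ "\<lambda>p. x * w p"] conjI cochain_scale) (auto simp flip: right_diff_distrib)
qed

text \<open>
  This combines a finite set of bidegrees with a set such as \<open>{n} \<times> UNIV\<close> fixing the cohomological degree.
\<close>

lemma cochain_spread_inter:
  assumes "trivial_hom \<epsilon> f" "spread pr trivial_proj D f" "spread pr trivial_proj E f"
  shows "spread pr trivial_proj (D \<inter> E) f"
  unfolding spread_trivial
proof (intro allI impI)
  fix p assume p: "\<forall>e \<in> D \<inter> E. pr e p = 0"
  have "f (pr e p) = 0" for e
  proof (cases "e \<in> D \<inter> E")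
    case True
    then show ?thesis using p linear_to_zero [OF assms(1)] by simp
  next
    case False
    then have "(\<forall>x \<in> D. pr x (pr e p) = 0) \<or> (\<forall>x \<in> E. pr x (pr e p) = 0)"
      by (auto simp: proj_proj)
    then show ?thesis using assms(2,3) by (auto simp: spread_trivial)
  qed
  then have "f (\<Sum>e | pr e p \<noteq> 0. pr e p) = 0" by (simp add: linear_to_sum [OF assms(1)])
  then show "f p = 0" by (simp add: sum_proj)
qed

end

section \<open>The comparison theorem\<close>

text \<open>
  No homological degree is fixed: a lift of a cocycle of degree \<open>n\<close> lowers it by \<open>n\<close>, and a general cocycle
  has components of several degrees.
\<close>

definition semilinear_chain_map ::
    "(int \<Rightarrow> 'a::ring_1 \<Rightarrow> 'a) \<Rightarrow> ('x \<Rightarrow> int \<times> int) \<Rightarrow> (('x \<Rightarrow>\<^sub>0 'a) \<Rightarrow> ('x \<Rightarrow>\<^sub>0 'a)) \<Rightarrow>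
      (int \<Rightarrow> 'b::ring_1 \<Rightarrow> 'b) \<Rightarrow> ('y \<Rightarrow> int \<times> int) \<Rightarrow> (('y \<Rightarrow>\<^sub>0 'b) \<Rightarrow> ('y \<Rightarrow>\<^sub>0 'b)) \<Rightarrow>
      ('a \<Rightarrow> 'b) \<Rightarrow> (('x \<Rightarrow>\<^sub>0 'a) \<Rightarrow> ('y \<Rightarrow>\<^sub>0 'b)) \<Rightarrow> bool"
  where "semilinear_chain_map c deg d c' deg' d' h F \<longleftrightarrow>
    linear_to (\<lambda>a. lmult (h a)) F \<and>
    (\<exists>D. finite D \<and> spread (proj c deg) (proj c' deg') D F) \<and> (\<forall>p. F (d p) = d' (F p))"

lemma semilinear_chain_map_comp:
  assumes "semilinear_chain_map c deg d c' deg' d' h F"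
    "semilinear_chain_map c' deg' d' c'' deg'' d'' h' G"
  shows "semilinear_chain_map c deg d c'' deg'' d'' (\<lambda>a. h' (h a)) (\<lambda>p. G (F p))"
proof -
  obtain D D' where "finite D" "finite D'" "spread (proj c deg) (proj c' deg') D F"
    "spread (proj c' deg') (proj c'' deg'') D' G"
    using assms unfolding semilinear_chain_map_def by blast
  then have "finite (D' + D)" "spread (proj c deg) (proj c'' deg'') (D' + D) (\<lambda>p. G (F p))"
    by (auto intro: finite_set_plus spread_comp)
  moreover have "linear_to (\<lambda>a. lmult (h' (h a))) (\<lambda>p. G (F p))"
    using assms linear_to_comp [of h F "\<lambda>a. lmult (h' a)" G] unfolding semilinear_chain_map_def by blast
  ultimately show ?thesis using assms unfolding semilinear_chain_map_def by auto
qed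

locale change_of_rings =
  P: free_resolution c \<kappa> \<epsilon> deg d \<alpha> + Q: free_resolution c' \<kappa>' \<epsilon>' deg' d' \<alpha>'
  for c :: "int \<Rightarrow> 'a::ring_1 \<Rightarrow> 'a" and \<kappa> :: "'k::field \<Rightarrow> 'a" and \<epsilon>
    and deg :: "'x \<Rightarrow> int \<times> int" and d and \<alpha>
    and c' :: "int \<Rightarrow> 'b::ring_1 \<Rightarrow> 'b" and \<kappa>' :: "'k \<Rightarrow> 'b" and \<epsilon>'
    and deg' :: "'y \<Rightarrow> int \<times> int" and d' and \<alpha>' +
  fixes h :: "'a \<Rightarrow> 'b"
  assumes h_hom: "unital_hom h"
    and h_c: "h (c m a) = c' m (h a)"
    and \<epsilon>'_h: "\<epsilon>' (h a) = \<epsilon> a"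
begin

sublocale h: graded_target "\<lambda>a. lmult (h a) :: ('y \<Rightarrow>\<^sub>0 'b) \<Rightarrow> _" c "proj c' deg'"
  by (rule graded_target_free)
    (use h_hom h_c P.graded_projections_axioms Q.graded_projections_axioms in auto)

abbreviation semilinear :: "(('x \<Rightarrow>\<^sub>0 'a) \<Rightarrow> ('y \<Rightarrow>\<^sub>0 'b)) \<Rightarrow> bool"
  where "semilinear \<equiv> linear_to (\<lambda>a. lmult (h a))"

abbreviation chain_map :: "(('x \<Rightarrow>\<^sub>0 'a) \<Rightarrow> ('y \<Rightarrow>\<^sub>0 'b)) \<Rightarrow> bool"
  where "chain_map \<equiv> semilinear_chain_map c deg d c' deg' d' h"

lemma trivial_hom_comp: "trivial_hom \<epsilon>' f \<Longrightarrow> semilinear F \<Longrightarrow> trivial_hom \<epsilon> (\<lambda>p. f (F p))"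
  using linear_to_comp [of h F "\<lambda>a y. \<epsilon>' a * y" f] by (simp add: \<epsilon>'_h)

lemma cochain_comp:
  assumes "Q.cochain f" "semilinear F" "finite D" "spread P.pr Q.pr D F"
  shows "P.cochain (\<lambda>p. f (F p))"
  using assms trivial_hom_comp [of f F] spread_comp [of P.pr Q.pr D F trivial_proj _ f]
    finite_set_plus [of _ D]
  unfolding P.cochain_def Q.cochain_def by blast

lemma cocycle_comp: "Q.cocycle f \<Longrightarrow> chain_map F \<Longrightarrow> P.cocycle (\<lambda>p. f (F p))"
  unfolding P.cocycle_def Q.cocycle_def semilinear_chain_map_def using cochain_comp [of f F] by auto

lemma cohomologous_comp:
  assumes "Q.cohomologous f f'" "chain_map F"
  shows "P.cohomologous (\<lambda>p. f (F p)) (\<lambda>p. f' (F p))"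
proof -
  obtain w where w: "Q.cochain w" "\<And>p. f p - f' p = w (d' p)"
    using assms(1) unfolding Q.cohomologous_def by blast
  show ?thesis unfolding P.cohomologous_def
    using assms(2) w cochain_comp [of w F] unfolding semilinear_chain_map_def
    by (intro exI [of _ "\<lambda>p. w (F p)"]) auto
qed

text \<open>
  Send each basis vector to the appropriate multiple of a homogeneous element that \<open>Q\<close> augments to 1. A
  multiple that is not zero occurs only for basis vectors with bidegree in \<open>D\<close>, which bounds the spread.
\<close>

lemma factor_augmentation:
  assumes "trivial_hom \<epsilon> f" "spread P.pr trivial_proj D f"
  obtains W where "semilinear W" "spread P.pr Q.pr D W" "\<And>p. \<alpha>' (W p) = f p"
proof -
  obtain u where u: "\<And>e. e \<noteq> 0 \<Longrightarrow> Q.pr e u = 0" "\<alpha>' u = 1" "d' u = 0"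
    using Q.homogeneous_unit by blast
  define W where "W = extend (\<lambda>a. lmult (h a)) (\<lambda>k. lmult (\<kappa>' (f (unit_vector k))) u)"
  have lin: "semilinear W" unfolding W_def by (rule h.linear_to_extend)
  have \<alpha>u: "\<alpha>' (lmult a u) = \<epsilon>' a" for a using linear_to_act [OF Q.\<alpha>_hom] u(2) by simp
  show thesis
  proof (rule that [OF lin])
    show "\<alpha>' (W p) = f p" for p
      by (rule linear_to_eqI [OF trivial_hom_comp [OF Q.\<alpha>_hom lin] assms(1)])
        (simp add: W_def \<alpha>u Q.\<epsilon>_\<kappa>)
    show "spread P.pr Q.pr D W"
      unfolding W_def
    proof (rule P.spread_extend)
      fix k e assume *: "deg k - e \<notin> D"
      let ?y = "f (unit_vector k)"
      have "e \<noteq> 0 \<or> ?y = 0"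
      proof (cases "deg k \<in> D")
        case True then show ?thesis using * by auto
      next
        case False
        then have "\<forall>x \<in> D. P.pr x (unit_vector k) = 0" by (auto intro: P.proj_unit_vector)
        then show ?thesis using assms(2) by (auto simp: spread_trivial)
      qed
      moreover have "lmult (\<kappa>' 0) u = 0"
        by (metis Q.\<epsilon>_eq_0 Q.\<epsilon>_\<kappa> Q.\<kappa>_\<epsilon> Q.self.act_zero_left)
      moreover have "Q.pr e (lmult (\<kappa>' ?y) u) = 0" if "e \<noteq> 0"
      proof (rule Q.self.pr_act)
        fix m
        have "c' m (\<kappa>' ?y) = 0" if "m \<noteq> 0"
          using that by (metis Q.\<kappa>_\<epsilon> Q.c_c Q.\<epsilon>_\<kappa>)
        then show "c' m (\<kappa>' ?y) = 0 \<or> Q.pr (e - (0, m)) u = 0"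
          using u(1) [of e] \<open>e \<noteq> 0\<close> by (cases "m = 0") (auto simp flip: zero_prod_def)
      qed
      ultimately show "Q.pr e (lmult (\<kappa>' ?y) u) = 0" by (metis Q.proj_zero)
    next
      show "graded_target (\<lambda>a. lmult (h a)) c Q.pr" by (rule h.graded_target_axioms)
    qed
  qed
qed

text \<open>
  The sign \<open>s\<close> allows for both conventions in the homotopy equation: \<open>d' \<circ> H - H \<circ> d = \<psi>\<close> in the construction
  of lifts, \<open>d' \<circ> H + H \<circ> d = \<psi>\<close> for a homotopy between chain maps.
\<close>

lemma signed_null_homotopy:
  assumes s: "s = (\<lambda>p. p) \<or> s = uminus"
    and \<psi>: "semilinear \<psi>" "spread P.pr Q.pr (D + {(1, 0)}) \<psi>"
      "\<And>p. \<alpha>' (\<psi> p) = 0" "\<And>p. d' (\<psi> p) = - \<psi> (s (d p))"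
  obtains H where "semilinear H" "\<And>p. d' (H p) = \<psi> p + H (s (d p))" "\<And>p. \<alpha>' (H p) = 0"
    "spread P.pr Q.pr D H"
proof (rule P.null_homotopy [of "\<lambda>a. lmult (h a)" "Q.pr" deg "\<lambda>p. s (d p)" d' "{q. \<alpha>' q = 0}" \<psi> D])
  show "graded_target (\<lambda>a. lmult (h a)) c Q.pr" by (rule h.graded_target_axioms)
  show "0 \<le> fst (deg k)" for k by (rule P.deg_nonneg)
  show "fst (deg j) < fst (deg k)" if "j \<in> Poly_Mapping.keys (s (d (unit_vector k)))" for j k
    using that P.deg_keys_d [of j k] s by (auto simp: in_keys_iff)
  show "linear_to lmult (\<lambda>p. s (d p))"
    using s P.d_linear P.self.linear_to_uminus [OF P.d_linear] by auto
  show "spread P.pr P.pr {(1, 0)} (\<lambda>p. s (d p))"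
    using s P.d_spread P.self.spread_uminus [OF P.d_spread] by auto
  show "s (d (s (d p))) = 0" for p
    using s by (auto simp: P.d_d linear_to_minus [OF P.d_linear])
  show "d' (y + z) = d' y + d' z" "d' (lmult (h a) y) = lmult (h a) (d' y)" for y z a
    by (simp_all add: linear_to_add [OF Q.d_linear] linear_to_act [OF Q.d_linear])
  show "\<exists>y' \<in> {q. \<alpha>' q = 0}. d' y' = y \<and> (\<forall>e. Q.pr (e - (1, 0)) y = 0 \<longrightarrow> Q.pr e y' = 0)"
    if "y \<in> {q. \<alpha>' q = 0}" "d' y = 0" for y
    using Q.exact_graded [of y] that by auto
qed (use \<psi> that in \<open>auto simp: linear_to_zero [OF Q.\<alpha>_hom] linear_to_add [OF Q.\<alpha>_hom]
    linear_to_act [OF Q.\<alpha>_hom]\<close>)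

text \<open>
  Factor \<open>f\<close> through the augmentation of \<open>Q\<close> by a module map \<open>W\<close>. Its failure \<open>W \<circ> d - d' \<circ> W\<close> to be a chain map
  dies under the augmentation and anticommutes with the differentials, so it is killed by a homotopy \<open>H\<close>, and
  \<open>W + H\<close> is the lift.
\<close>

lemma lift_exists:
  assumes f: "trivial_hom \<epsilon> f" "spread P.pr trivial_proj D f" "\<And>p. f (d p) = 0"
  obtains F where "semilinear F" "spread P.pr Q.pr D F" "\<And>p. F (d p) = d' (F p)" "\<And>p. \<alpha>' (F p) = f p"
proof -
  obtain W where W: "semilinear W" "spread P.pr Q.pr D W" "\<And>p. \<alpha>' (W p) = f p"
    using factor_augmentation [OF f(1,2)] by blast
  have lin1: "semilinear (\<lambda>p. W (d p))" using linear_to_comp [OF P.d_linear W(1)] .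
  have lin2: "semilinear (\<lambda>p. d' (W p))" using linear_to_comp [OF W(1) Q.d_linear] .
  have spread1: "spread P.pr Q.pr (D + {(1, 0)}) (\<lambda>p. W (d p))" by (rule spread_comp [OF P.d_spread W(2)])
  have spread2: "spread P.pr Q.pr (D + {(1, 0)}) (\<lambda>p. d' (W p))"
    using spread_comp [OF W(2) Q.d_spread] by (simp add: add.commute)
  obtain H where H: "semilinear H" "\<And>p. d' (H p) = W (d p) - d' (W p) + H (d p)" "\<And>p. \<alpha>' (H p) = 0"
    "spread P.pr Q.pr D H"
  proof (rule signed_null_homotopy [of "\<lambda>p. p" "\<lambda>p. W (d p) - d' (W p)" D])
    show "semilinear (\<lambda>p. W (d p) - d' (W p))" by (rule h.linear_to_subtract [OF lin1 lin2])
    show "spread P.pr Q.pr (D + {(1, 0)}) (\<lambda>p. W (d p) - d' (W p))"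
      by (rule h.spread_subtract [OF spread1 spread2])
  qed (auto simp: linear_to_diff [OF Q.\<alpha>_hom] linear_to_diff [OF Q.d_linear] W f Q.\<alpha>_d Q.d_d P.d_d
      linear_to_zero [OF W(1)])
  show thesis
  proof (rule that [of "\<lambda>p. W p + H p"])
    show "semilinear (\<lambda>p. W p + H p)" by (rule h.linear_to_plus [OF W(1) H(1)])
    show "spread P.pr Q.pr D (\<lambda>p. W p + H p)" by (rule h.spread_plus [OF W(2) H(4)])
  qed (simp_all add: linear_to_add [OF Q.d_linear] linear_to_add [OF Q.\<alpha>_hom] H W)
qed

text \<open>
  Chain maps over cohomologous cocycles are homotopic up to a correction. With \<open>w\<close> bounding the difference and
  \<open>W\<close> factoring \<open>w\<close> through the augmentation, \<open>F - F' - (W \<circ> d + d' \<circ> W)\<close> is a chain map over 0, hence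
  null-homotopic by some \<open>H\<close>; composing with the cocycle \<open>f\<close> leaves the coboundary of \<open>f \<circ> (W + H)\<close>.
\<close>

lemma lift_unique:
  assumes F: "chain_map F" "chain_map F'"
    and coh: "P.cohomologous (\<lambda>p. \<alpha>' (F p)) (\<lambda>p. \<alpha>' (F' p))"
    and f: "Q.cocycle f"
  shows "P.cohomologous (\<lambda>p. f (F p)) (\<lambda>p. f (F' p))"
proof -
  obtain w where w: "P.cochain w" "\<And>p. \<alpha>' (F p) - \<alpha>' (F' p) = w (d p)"
    using coh unfolding P.cohomologous_def by blast
  obtain D1 where D1: "finite D1" "trivial_hom \<epsilon> w" "spread P.pr trivial_proj D1 w"
    using w(1) unfolding P.cochain_def by blast
  obtain D2 D3 where D: "finite D2" "finite D3" "spread P.pr Q.pr D2 F" "spread P.pr Q.pr D3 F'"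
    and lin: "semilinear F" "semilinear F'" and comm: "\<And>p. F (d p) = d' (F p)" "\<And>p. F' (d p) = d' (F' p)"
    using F unfolding semilinear_chain_map_def by blast
  obtain W where W: "semilinear W" "spread P.pr Q.pr D1 W" "\<And>p. \<alpha>' (W p) = w p"
    using factor_augmentation [OF D1(2,3)] by blast
  define G where "G p = F p - F' p - (W (d p) + d' (W p))" for p
  have lin1: "semilinear (\<lambda>p. W (d p))" using linear_to_comp [OF P.d_linear W(1)] .
  have lin2: "semilinear (\<lambda>p. d' (W p))" using linear_to_comp [OF W(1) Q.d_linear] .
  have spread1: "spread P.pr Q.pr (D1 + {(1, 0)}) (\<lambda>p. W (d p))" by (rule spread_comp [OF P.d_spread W(2)])
  have spread2: "spread P.pr Q.pr (D1 + {(1, 0)}) (\<lambda>p. d' (W p))"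
    using spread_comp [OF W(2) Q.d_spread] by (simp add: add.commute)
  \<comment> \<open>The homotopy raises the homological degree by one more than the chain maps, hence the shift by \<open>(-1, 0)\<close>.\<close>
  let ?D = "(D2 + {(-1, 0)}) \<union> (D3 + {(-1, 0)}) \<union> D1"
  have shift: "E \<subseteq> E' + {(1, 0)}" if "E + {(-1, 0)} \<subseteq> E'" for E E' :: "(int \<times> int) set"
  proof
    fix e assume "e \<in> E"
    then have "e + (-1, 0) \<in> E'" using that by (auto intro: set_plus_intro)
    then have "e + (-1, 0) + (1, 0) \<in> E' + {(1, 0)}" by (auto intro: set_plus_intro)
    then show "e \<in> E' + {(1, 0)}" by (simp add: add.assoc flip: zero_prod_def)
  qed
  have mono: "D1 + {(1, 0)} \<subseteq> ?D + {(1, 0)}" by (rule set_plus_mono2) auto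
  have fin: "finite ?D" using D D1 by (simp add: finite_set_plus)
  have "semilinear G"
    unfolding G_def by (intro h.linear_to_subtract h.linear_to_plus lin lin1 lin2)
  moreover have "spread P.pr Q.pr (?D + {(1, 0)}) G"
    unfolding G_def
    by (intro h.spread_subtract h.spread_plus spread_mono [OF spread1 mono] spread_mono [OF spread2 mono]
        spread_mono [OF D(3) shift] spread_mono [OF D(4) shift]) auto
  moreover have "\<alpha>' (G p) = 0" for p
    by (simp add: G_def linear_to_diff [OF Q.\<alpha>_hom] linear_to_add [OF Q.\<alpha>_hom] W w Q.\<alpha>_d)
  moreover have "d' (G p) = - G (- d p)" for p
    by (simp add: G_def linear_to_diff [OF Q.d_linear] linear_to_add [OF Q.d_linear] comm P.d_d Q.d_d
        linear_to_zero [OF W(1)] linear_to_minus [OF W(1)] linear_to_minus [OF lin(1)] linear_to_zero [OF Q.d_linear]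
        linear_to_minus [OF lin(2)] linear_to_minus [OF P.d_linear] linear_to_minus [OF Q.d_linear])
  ultimately obtain H where H: "semilinear H" "\<And>p. d' (H p) = G p + H (- d p)" "spread P.pr Q.pr ?D H"
    using signed_null_homotopy [of uminus G ?D] by blast
  have f': "trivial_hom \<epsilon>' f" "\<And>q. f (d' q) = 0" using f unfolding Q.cocycle_def Q.cochain_def by blast+
  have WH: "semilinear (\<lambda>p. W p + H p)" "spread P.pr Q.pr ?D (\<lambda>p. W p + H p)"
    using h.linear_to_plus [OF W(1) H(1)] h.spread_plus [OF spread_mono [OF W(2)] H(3)] by blast+
  have "f (F p) - f (F' p) = f (W (d p) + H (d p))" for p
  proof -
    have "F p - F' p = W (d p) + d' (W p) + (d' (H p) + H (d p))"
      using H(2) [of p] by (simp add: G_def linear_to_minus [OF H(1)] algebra_simps)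
    then have "f (F p) - f (F' p) = f (W (d p) + d' (W p) + (d' (H p) + H (d p)))"
      by (simp flip: linear_to_diff [OF f'(1)])
    then show ?thesis by (simp add: linear_to_add [OF f'(1)] f'(2))
  qed
  then show ?thesis
    unfolding P.cohomologous_def using cochain_comp [OF _ WH(1) fin WH(2)] f
    unfolding Q.cocycle_def by blast
qed

lemma lift_of_cocycle:
  assumes "P.cocycle f"
  obtains F where "chain_map F" "\<And>p. \<alpha>' (F p) = f p"
  using assms lift_exists [of f] unfolding P.cocycle_def P.cochain_def semilinear_chain_map_def by metis

lemma chain_map_plus:
  assumes "chain_map F" "chain_map G"
  shows "chain_map (\<lambda>p. F p + G p)"
proof -
  obtain D D' where D: "finite D" "finite D'" "spread P.pr Q.pr D F" "spread P.pr Q.pr D' G"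
    using assms unfolding semilinear_chain_map_def by blast
  have "spread P.pr Q.pr (D \<union> D') (\<lambda>p. F p + G p)"
    by (intro h.spread_plus spread_mono [OF D(3)] spread_mono [OF D(4)]) auto
  then show ?thesis
    using assms D h.linear_to_plus [of F G] finite_UnI [OF D(1,2)]
    unfolding semilinear_chain_map_def by (auto simp: linear_to_add [OF Q.d_linear])
qed

lemma chain_map_scale:
  assumes "chain_map F"
  shows "chain_map (\<lambda>p. lmult (\<kappa>' s) (F p))"
proof -
  obtain D where D: "finite D" "spread P.pr Q.pr D F"
    using assms unfolding semilinear_chain_map_def by blast
  have "spread P.pr Q.pr D (\<lambda>p. lmult (\<kappa>' s) (F p))"
    unfolding spread_def
  proof (intro allI impI)
    fix e p assume "\<forall>x \<in> D. P.pr (e + x) p = 0"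
    then have *: "Q.pr e (F p) = 0" using D(2) by (auto intro: spreadD)
    have "c' m (\<kappa>' s) = 0" if "m \<noteq> 0" for m
      using that by (metis Q.\<kappa>_\<epsilon> Q.c_c Q.\<epsilon>_\<kappa>)
    then show "Q.pr e (lmult (\<kappa>' s) (F p)) = 0"
      using * by (intro Q.self.pr_act) (metis diff_zero zero_prod_def)
  qed
  moreover have "semilinear (\<lambda>p. lmult (\<kappa>' s) (F p))"
    using assms unfolding semilinear_chain_map_def
    by (auto simp: linear_to_def lmult_algebra(2) Q.\<kappa>_central simp flip: lmult_algebra(3))
  ultimately show ?thesis
    using assms D(1) unfolding semilinear_chain_map_def by (auto simp: linear_to_act [OF Q.d_linear])
qed

end

section \<open>A derivation detecting an element of degree one\<close>

context connected_algebra
begin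

text \<open>
  The map \<open>\<kappa>\<close> is the inverse of the isomorphism that \<open>\<epsilon>\<close> induces on the component of degree 0.
\<close>

lemma \<kappa>_hom: "\<kappa> (x + y) = \<kappa> x + \<kappa> y" "\<kappa> (x * y) = \<kappa> x * \<kappa> y" "\<kappa> 1 = 1"
proof -
  have c: "c 0 (\<kappa> x) = \<kappa> x" for x using \<kappa>_\<epsilon> [of "\<kappa> x"] by (simp add: \<epsilon>_\<kappa>)
  show "\<kappa> (x + y) = \<kappa> x + \<kappa> y"
    using \<kappa>_\<epsilon> [of "\<kappa> x + \<kappa> y"] by (simp add: unital_homD [OF \<epsilon>_hom] \<epsilon>_\<kappa> c_add c)
  show "\<kappa> (x * y) = \<kappa> x * \<kappa> y"
    using \<kappa>_\<epsilon> [of "\<kappa> x * \<kappa> y"] c_mult [of 0 0 "\<kappa> x" "\<kappa> y"] by (simp add: unital_homD [OF \<epsilon>_hom] \<epsilon>_\<kappa> c)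
  have "{m. c m 1 \<noteq> 0} \<subseteq> {0}" using c_one by blast
  then have "(\<Sum>m | c m 1 \<noteq> 0. c m 1) = (\<Sum>m \<in> {0}. c m 1)"
    by (intro sum.mono_neutral_left) auto
  then have "c 0 1 = 1" using sum_c [of 1] by simp
  then show "\<kappa> 1 = 1" using \<kappa>_\<epsilon> [of 1] by (simp add: unital_homD [OF \<epsilon>_hom])
qed

lemma c_1_times: "c 1 (a * b) = \<kappa> (\<epsilon> a) * c 1 b + \<kappa> (\<epsilon> b) * c 1 a"
proof -
  have "c 1 (a * b) = (\<Sum>i \<in> {0, 1}. c i a * c (1 - i) b)"
    unfolding c_times
  proof (rule sum.mono_neutral_cong)
    fix i assume "i \<in> {i. c i a \<noteq> 0} - {0, 1}"
    then have "1 - i < 0" using c_negative [of i a] by (cases "i < 0") auto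
    then show "c i a * c (1 - i) b = 0" using c_negative [of "1 - i" b] by simp
  qed (auto simp: finite_c)
  then show ?thesis by (simp add: \<kappa>_\<epsilon> [symmetric] \<kappa>_central)
qed

text \<open>
  Compose the projection to degree 1 with a \<open>K\<close>-linear functional that takes the value 1 at \<open>g\<close>. The Leibniz rule
  holds for any functional on degree 1, since a product has its component of degree 1 from factors
  of degrees 0 and 1, in either order.
\<close>

lemma derivation_exists:
  assumes "c 1 g = g" "g \<noteq> 0"
  obtains \<xi> :: "'a \<Rightarrow> 'k"
  where "\<And>a b. \<xi> (a + b) = \<xi> a + \<xi> b" "\<And>a b. \<xi> (a * b) = \<xi> a * \<epsilon> b + \<epsilon> a * \<xi> b"
    "\<And>a. c 1 a = 0 \<Longrightarrow> \<xi> a = 0" "\<xi> g = 1"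
proof -
  interpret V: vector_space "\<lambda>x a. \<kappa> x * a"
    by unfold_locales (simp_all add: \<kappa>_hom algebra_simps)
  have ind: "V.independent {g}" using assms(2) by simp
  let ?B = "V.extend_basis {g}"
  have B: "V.independent ?B" "g \<in> ?B" "\<And>a. a \<in> V.span ?B"
    using V.independent_extend_basis [OF ind] V.extend_basis_superset [OF ind] V.span_extend_basis [OF ind]
    by auto
  define l where "l a = V.representation ?B a g" for a
  have l_add: "l (a + b) = l a + l b" for a b unfolding l_def by (simp add: V.representation_add B)
  have l_scale: "l (\<kappa> x * a) = x * l a" for a x unfolding l_def by (simp add: V.representation_scale B)
  have l_g: "l g = 1" unfolding l_def by (simp add: V.representation_basis B)
  show thesis
  proof (rule that [of "\<lambda>a. l (c 1 a)"])
    show "l (c 1 a) = 0" if "c 1 a = 0" for a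
      using that l_scale [of 0 0] by simp
    show "l (c 1 (a * b)) = l (c 1 a) * \<epsilon> b + \<epsilon> a * l (c 1 b)" for a b
      by (simp add: c_1_times l_add l_scale)
  qed (simp_all add: c_add l_add l_g assms)
qed

end

section \<open>The mapping cone of a pair of lifts\<close>

lemma lookup_extend_unit_vector:
  assumes "inj i" "h 0 = 0"
  shows "Poly_Mapping.lookup (extend (\<lambda>a. lmult (h a)) (\<lambda>k. unit_vector (i k)) p) (i k) =
      h (Poly_Mapping.lookup p k)"
    and "z \<notin> range i \<Longrightarrow> Poly_Mapping.lookup (extend (\<lambda>a. lmult (h a)) (\<lambda>k. unit_vector (i k)) p) z = 0"
proof -
  have *: "Poly_Mapping.lookup (extend (\<lambda>a. lmult (h a)) (\<lambda>k. unit_vector (i k)) p) z =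
      (\<Sum>k \<in> Poly_Mapping.keys p. if i k = z then h (Poly_Mapping.lookup p k) else 0)" for z
    unfolding extend_def lookup_sum by (rule sum.cong) (auto simp: lookup_single)
  show "Poly_Mapping.lookup (extend (\<lambda>a. lmult (h a)) (\<lambda>k. unit_vector (i k)) p) (i k) =
      h (Poly_Mapping.lookup p k)"
    unfolding * using assms by (simp add: inj_eq in_keys_iff)
  show "z \<notin> range i \<Longrightarrow> Poly_Mapping.lookup (extend (\<lambda>a. lmult (h a)) (\<lambda>k. unit_vector (i k)) p) z = 0"
    unfolding * by (intro sum.neutral) auto
qed

text \<open>
  Here \<open>h\<close> is the quotient map \<open>A \<rightarrow> A/gA\<close>. Normality of \<open>g\<close> enters through \<open>gA\<close> being the kernel of a ring
  homomorphism.
\<close>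

locale quotient_by_regular = change_of_rings c \<kappa> \<epsilon> deg d \<alpha> c' \<kappa>' \<epsilon>' deg' d' \<alpha>' h
  for c :: "int \<Rightarrow> 'a::ring_1 \<Rightarrow> 'a" and \<kappa> :: "'k::field \<Rightarrow> 'a" and \<epsilon>
    and deg :: "'x \<Rightarrow> int \<times> int" and d and \<alpha>
    and c' :: "int \<Rightarrow> 'b::ring_1 \<Rightarrow> 'b" and \<kappa>' :: "'k \<Rightarrow> 'b" and \<epsilon>'
    and deg' :: "'y \<Rightarrow> int \<times> int" and d' and \<alpha>' and h +
  fixes g :: 'a
  assumes h_surj: "surj h"
    and h_kernel: "h a = 0 \<Longrightarrow> \<exists>b. a = g * b"
    and h_g: "h g = 0"
    and g_degree: "c 1 g = g"
    and g_regular: "g * a = 0 \<Longrightarrow> a = 0"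
begin

lemma \<epsilon>_g: "\<epsilon> g = 0"
  using P.c_c [of 0 1 g] P.\<epsilon>_eq_0 [of g] g_degree by simp

lemma lmult_g_injective: "lmult g w = 0 \<Longrightarrow> w = 0"
  using g_regular by (metis lookup_lmult lookup_zero poly_mapping_eqI)

lemma coefficients_divisible:
  assumes "\<And>k. h (Poly_Mapping.lookup p k) = 0"
  obtains w where "p = lmult g w"
proof -
  have "\<forall>k. \<exists>b. Poly_Mapping.lookup p k = g * b" using assms h_kernel by blast
  then obtain b where b: "\<And>k. Poly_Mapping.lookup p k = g * b k" by metis
  define w where "w = (\<Sum>k \<in> Poly_Mapping.keys p. Poly_Mapping.single k (b k))"
  have "Poly_Mapping.lookup w j = (if j \<in> Poly_Mapping.keys p then b j else 0)" for j
    unfolding w_def lookup_sum by (simp add: lookup_single when_def)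
  then have "p = lmult g w"
    using b by (intro poly_mapping_eqI) (auto simp: in_keys_iff)
  then show thesis by (rule that)
qed

text \<open>
  With the derivation \<open>\<xi>\<close> applied to coefficients, \<open>\<Xi>\<close> satisfies \<open>\<Xi> (a p) = \<xi> a * \<alpha> p + \<epsilon> a * \<Xi> p\<close>. The first
  summand vanishes on boundaries, so \<open>\<Xi> \<circ> d\<close> is linear and evidently a cocycle; on \<open>g w\<close> only the first summand
  survives, which gives the value \<open>\<alpha> w\<close>.
\<close>

lemma dual_class:
  obtains \<chi> where "trivial_hom \<epsilon> \<chi>" "spread P.pr trivial_proj {(1, 1)} \<chi>" "\<And>p. \<chi> (d p) = 0"
    "\<And>p w. d p = lmult g w \<Longrightarrow> \<chi> p = \<alpha> w"
proof -
  have "g \<noteq> 0" using g_regular [of 1] by auto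
  then obtain \<xi> where \<xi>: "\<And>a b. \<xi> (a + b) = \<xi> a + \<xi> b"
    "\<And>a b. \<xi> (a * b) = \<xi> a * \<epsilon> b + \<epsilon> a * \<xi> b" "\<And>a. c 1 a = 0 \<Longrightarrow> \<xi> a = 0" "\<xi> g = 1"
    using P.derivation_exists [OF g_degree] by blast
  define \<Xi> where "\<Xi> p = (\<Sum>k \<in> Poly_Mapping.keys p. \<xi> (Poly_Mapping.lookup p k) * \<alpha> (unit_vector k))"
    for p
  have \<xi>0: "\<xi> 0 = 0" using \<xi>(3) by simp
  have super: "\<Xi> p = (\<Sum>k \<in> S. \<xi> (Poly_Mapping.lookup p k) * \<alpha> (unit_vector k))"
    if "finite S" "Poly_Mapping.keys p \<subseteq> S" for p S
    unfolding \<Xi>_def using that by (intro sum.mono_neutral_left) (auto simp: in_keys_iff \<xi>0)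
  have add: "\<Xi> (p + q) = \<Xi> p + \<Xi> q" for p q
    using Poly_Mapping.keys_add [of p q]
    by (simp add: super [of "Poly_Mapping.keys p \<union> Poly_Mapping.keys q"] lookup_add \<xi>(1)
        distrib_right sum.distrib)
  have mult: "\<Xi> (lmult a p) = \<xi> a * \<alpha> p + \<epsilon> a * \<Xi> p" for a p
  proof -
    have "Poly_Mapping.keys (lmult a p) \<subseteq> Poly_Mapping.keys p" by (auto simp: in_keys_iff)
    then have "\<Xi> (lmult a p) = (\<Sum>k \<in> Poly_Mapping.keys p.
        \<xi> (a * Poly_Mapping.lookup p k) * \<alpha> (unit_vector k))"
      by (simp add: super [of "Poly_Mapping.keys p"])
    also have "\<dots> = \<xi> a * extend (\<lambda>a y. \<epsilon> a * y) (\<lambda>k. \<alpha> (unit_vector k)) p + \<epsilon> a * \<Xi> p"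
      by (simp add: \<xi>(2) extend_def \<Xi>_def sum_distrib_left sum.distrib algebra_simps)
    finally show ?thesis using linear_to_expand [OF P.\<alpha>_hom, of p] by simp
  qed
  have spread: "spread P.pr trivial_proj {(0, 1)} \<Xi>"
    unfolding spread_trivial
  proof (intro allI impI)
    fix p assume p: "\<forall>e \<in> {(0, 1)}. P.pr e p = 0"
    have "\<xi> (Poly_Mapping.lookup p k) * \<alpha> (unit_vector k) = 0" for k
    proof (cases "deg k = 0")
      case True
      have "Poly_Mapping.lookup (P.pr (0, 1) p) k = 0" using p by simp
      then have "c 1 (Poly_Mapping.lookup p k) = 0" using True by (simp add: P.lookup_proj)
      then show ?thesis using \<xi>(3) by simp
    next
      case False
      then have "P.pr 0 (unit_vector k) = 0" by (intro P.proj_unit_vector) auto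
      then show ?thesis using P.\<alpha>_spread by (simp add: spread_trivial)
    qed
    then show "\<Xi> p = 0" unfolding \<Xi>_def by (intro sum.neutral) blast
  qed
  show thesis
  proof (rule that [of "\<lambda>p. \<Xi> (d p)"])
    show "trivial_hom \<epsilon> (\<lambda>p. \<Xi> (d p))"
      by (simp add: linear_to_def linear_to_add [OF P.d_linear] linear_to_act [OF P.d_linear] add mult P.\<alpha>_d)
    show "spread P.pr trivial_proj {(1, 1)} (\<lambda>p. \<Xi> (d p))"
      using spread_comp [OF P.d_spread spread] by (simp add: set_plus_def)
    show "\<Xi> (d (d p)) = 0" for p by (simp add: P.d_d \<Xi>_def)
    show "\<Xi> (d p) = \<alpha> w" if "d p = lmult g w" for p w
      by (simp add: that mult \<xi>(4) \<epsilon>_g)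
  qed
qed

end

text \<open>
  The chain map \<open>X\<close> lifts the class dual to \<open>g\<close>. Its last property is what ties it to the homology of \<open>P/gP\<close> in
  degree 1: such a class is represented by \<open>p\<close> with \<open>d p = g w\<close>, and it is measured by \<open>\<alpha> w\<close>.
\<close>

locale lifted_pair = quotient_by_regular c \<kappa> \<epsilon> deg d \<alpha> c' \<kappa>' \<epsilon>' deg' d' \<alpha>' h g
  for c :: "int \<Rightarrow> 'a::ring_1 \<Rightarrow> 'a" and \<kappa> :: "'k::field \<Rightarrow> 'a" and \<epsilon>
    and deg :: "'x \<Rightarrow> int \<times> int" and d and \<alpha>
    and c' :: "int \<Rightarrow> 'b::ring_1 \<Rightarrow> 'b" and \<kappa>' :: "'k \<Rightarrow> 'b" and \<epsilon>'
    and deg' :: "'y \<Rightarrow> int \<times> int" and d' and \<alpha>' and h and g +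
  fixes \<pi> X :: "('x \<Rightarrow>\<^sub>0 'a) \<Rightarrow> ('y \<Rightarrow>\<^sub>0 'b)"
  assumes \<pi>: "semilinear \<pi>" "spread P.pr Q.pr {0} \<pi>" "\<And>p. \<pi> (d p) = d' (\<pi> p)" "\<And>p. \<alpha>' (\<pi> p) = \<alpha> p"
    and X: "semilinear X" "spread P.pr Q.pr {(1, 1)} X" "\<And>p. X (d p) = d' (X p)"
      "\<And>p w. d p = lmult g w \<Longrightarrow> \<alpha>' (X p) = \<alpha> w"
begin

text \<open>
  The bidegrees of the cone of \<open>(\<pi>, X)\<close>. The shift by \<open>(1, 1)\<close> undoes the degree of \<open>X\<close>, and \<open>(1, 0)\<close> is the
  suspension of the source.
\<close>

definition cone_deg :: "'x + 'y + 'y \<Rightarrow> int \<times> int"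
  where "cone_deg = case_sum (\<lambda>k. deg k + (1, 0)) (case_sum deg' (\<lambda>k. deg' k + (1, 1)))"

text \<open>
  The source of \<open>(\<pi>, X)\<close> is \<open>P/gP\<close>, the free \<open>B\<close>-module on the basis of \<open>P\<close>. It enters through \<open>P\<close>, and \<open>in_P\<close>
  has kernel \<open>gP\<close>.
\<close>

definition in_P :: "('x \<Rightarrow>\<^sub>0 'a) \<Rightarrow> ('x + 'y + 'y \<Rightarrow>\<^sub>0 'b)"
  where "in_P = extend (\<lambda>a. lmult (h a)) (\<lambda>k. unit_vector (Inl k))"

definition in_Q :: "('y \<Rightarrow>\<^sub>0 'b) \<Rightarrow> ('x + 'y + 'y \<Rightarrow>\<^sub>0 'b)"
  where "in_Q = extend (\<lambda>b. lmult b) (\<lambda>k. unit_vector (Inr (Inl k)))"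

definition in_Q' :: "('y \<Rightarrow>\<^sub>0 'b) \<Rightarrow> ('x + 'y + 'y \<Rightarrow>\<^sub>0 'b)"
  where "in_Q' = extend (\<lambda>b. lmult b) (\<lambda>k. unit_vector (Inr (Inr k)))"

abbreviation "cone_pr \<equiv> proj c' cone_deg"

sublocale hT: graded_target "\<lambda>a. lmult (h a) :: ('x + 'y + 'y \<Rightarrow>\<^sub>0 'b) \<Rightarrow> _" c cone_pr
  by (rule graded_target_free)
    (use h_hom h_c P.graded_projections_axioms Q.graded_projections_axioms in auto)

sublocale T: graded_target "lmult :: _ \<Rightarrow> ('x + 'y + 'y \<Rightarrow>\<^sub>0 'b) \<Rightarrow> _" c' cone_pr
  by (rule Q.graded_target_self)

lemma in_P_linear: "linear_to (\<lambda>a. lmult (h a)) in_P"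
  unfolding in_P_def by (rule hT.linear_to_extend)

lemma in_Q_linear: "linear_to lmult in_Q"
  unfolding in_Q_def by (rule T.linear_to_extend)

lemma in_Q'_linear: "linear_to lmult in_Q'"
  unfolding in_Q'_def by (rule T.linear_to_extend)

lemmas in_P_simps = linear_to_add [OF in_P_linear] linear_to_diff [OF in_P_linear]
  linear_to_minus [OF in_P_linear] linear_to_zero [OF in_P_linear]
lemmas in_Q_simps = linear_to_add [OF in_Q_linear] linear_to_diff [OF in_Q_linear]
  linear_to_minus [OF in_Q_linear] linear_to_zero [OF in_Q_linear]
lemmas in_Q'_simps = linear_to_add [OF in_Q'_linear] linear_to_diff [OF in_Q'_linear]
  linear_to_minus [OF in_Q'_linear] linear_to_zero [OF in_Q'_linear]

lemma in_P_unit [simp]: "in_P (unit_vector k) = unit_vector (Inl k)"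
  and in_Q_unit [simp]: "in_Q (unit_vector j) = unit_vector (Inr (Inl j))"
  and in_Q'_unit [simp]: "in_Q' (unit_vector j) = unit_vector (Inr (Inr j))"
  unfolding in_P_def in_Q_def in_Q'_def
  by (simp_all add: hT.extend_unit_vector T.extend_unit_vector)

lemma in_P_spread: "spread P.pr cone_pr {(-1, 0)} in_P"
  unfolding in_P_def
  by (rule P.spread_extend [OF hT.graded_target_axioms])
    (auto intro!: Q.proj_unit_vector simp: cone_deg_def)

lemma in_Q_spread: "spread Q.pr cone_pr {0} in_Q"
  unfolding in_Q_def
  by (rule Q.spread_extend [OF T.graded_target_axioms])
    (auto intro!: Q.proj_unit_vector simp: cone_deg_def)

lemma in_Q'_spread: "spread Q.pr cone_pr {(-1, -1)} in_Q'"
  unfolding in_Q'_def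
  by (rule Q.spread_extend [OF T.graded_target_axioms])
    (auto intro!: Q.proj_unit_vector simp: cone_deg_def)

lemma cone_decompose: obtains p q r where "t = in_P p + in_Q q + in_Q' r"
proof -
  let ?S = "{t. \<exists>p q r. t = in_P p + in_Q q + in_Q' r}"
  have add: "s + t \<in> ?S" if "s \<in> ?S" "t \<in> ?S" for s t
  proof -
    from that obtain p q r p' q' r' where "s = in_P p + in_Q q + in_Q' r" "t = in_P p' + in_Q q' + in_Q' r'"
      by blast
    then have "s + t = in_P (p + p') + in_Q (q + q') + in_Q' (r + r')"
      by (simp add: in_P_simps in_Q_simps in_Q'_simps)
    then show ?thesis by blast
  qed
  have zero: "0 \<in> ?S"
    by (rule CollectI, rule exI [of _ 0], rule exI [of _ 0], rule exI [of _ 0])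
      (simp add: in_P_simps in_Q_simps in_Q'_simps)
  have mult: "lmult b (unit_vector z) \<in> ?S" for b z
  proof -
    obtain a where b: "b = h a" using h_surj by (metis surjD)
    consider (P) k where "z = Inl k" | (Q) k where "z = Inr (Inl k)" | (Q') k where "z = Inr (Inr k)"
      by (metis sum.exhaust)
    then show ?thesis
    proof cases
      case P
      have "lmult b (unit_vector z) = in_P (lmult a (unit_vector k)) + in_Q 0 + in_Q' 0"
        by (simp add: b P linear_to_act [OF in_P_linear] in_Q_simps in_Q'_simps)
      then show ?thesis by blast
    next
      case Q
      have "lmult b (unit_vector z) = in_P 0 + in_Q (lmult b (unit_vector k)) + in_Q' 0"
        by (simp add: Q linear_to_act [OF in_Q_linear] in_P_simps in_Q'_simps)
      then show ?thesis by blast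
    next
      case Q'
      have "lmult b (unit_vector z) = in_P 0 + in_Q 0 + in_Q' (lmult b (unit_vector k))"
        by (simp add: Q' linear_to_act [OF in_Q'_linear] in_P_simps in_Q_simps)
      then show ?thesis by blast
    qed
  qed
  have "(\<Sum>k \<in> S. lmult (Poly_Mapping.lookup t k) (unit_vector k)) \<in> ?S" for S
    by (induction S rule: infinite_finite_induct) (use zero add mult in auto)
  from this [of "Poly_Mapping.keys t"] have "t \<in> ?S" by (simp only: unit_vector_expansion [symmetric])
  then show thesis using that by blast
qed

lemma cone_eq_0:
  assumes "in_P p + in_Q q + in_Q' r = 0"
  shows "\<exists>w. p = lmult g w" "q = 0" "r = 0"
proof -
  have h0: "h 0 = 0" using unital_homD [OF h_hom] by simp
  have *: "Poly_Mapping.lookup (in_P p) z + Poly_Mapping.lookup (in_Q q) z + Poly_Mapping.lookup (in_Q' r) z = 0"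
    for z using assms by (metis lookup_add lookup_zero)
  have lookup_P: "Poly_Mapping.lookup (in_P p) (Inl k) = h (Poly_Mapping.lookup p k)"
    "Poly_Mapping.lookup (in_P p) (Inr j) = 0" for k j
    unfolding in_P_def
    using lookup_extend_unit_vector [where i = "Inl :: 'x \<Rightarrow> 'x + 'y + 'y" and h = h] h0 by (auto simp: inj_def)
  have lookup_Q: "Poly_Mapping.lookup (in_Q q) (Inr (Inl k)) = Poly_Mapping.lookup q k"
    "Poly_Mapping.lookup (in_Q q) (Inl i) = 0" "Poly_Mapping.lookup (in_Q q) (Inr (Inr j)) = 0" for k i j
    unfolding in_Q_def
    using lookup_extend_unit_vector [where i = "\<lambda>k. Inr (Inl k) :: 'x + 'y + 'y" and h = "\<lambda>a :: 'b. a"]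
    by (auto simp: inj_def image_iff)
  have lookup_Q': "Poly_Mapping.lookup (in_Q' r) (Inr (Inr k)) = Poly_Mapping.lookup r k"
    "Poly_Mapping.lookup (in_Q' r) (Inl i) = 0" "Poly_Mapping.lookup (in_Q' r) (Inr (Inl j)) = 0" for k i j
    unfolding in_Q'_def
    using lookup_extend_unit_vector [where i = "\<lambda>k. Inr (Inr k) :: 'x + 'y + 'y" and h = "\<lambda>a :: 'b. a"]
    by (auto simp: inj_def image_iff)
  show "q = 0"
    using * [of "Inr (Inl _)"] by (intro poly_mapping_eqI) (simp add: lookup_P lookup_Q lookup_Q')
  show "r = 0"
    using * [of "Inr (Inr _)"] by (intro poly_mapping_eqI) (simp add: lookup_P lookup_Q lookup_Q')
  have "h (Poly_Mapping.lookup p k) = 0" for k using * [of "Inl k"] by (simp add: lookup_P lookup_Q lookup_Q')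
  then show "\<exists>w. p = lmult g w" using coefficients_divisible by blast
qed

definition cone_d :: "('x + 'y + 'y \<Rightarrow>\<^sub>0 'b) \<Rightarrow> ('x + 'y + 'y \<Rightarrow>\<^sub>0 'b)"
  where "cone_d = extend lmult (case_sum
    (\<lambda>k. in_Q (\<pi> (unit_vector k)) + in_Q' (X (unit_vector k)) - in_P (d (unit_vector k)))
    (case_sum (\<lambda>k. in_Q (d' (unit_vector k))) (\<lambda>k. in_Q' (d' (unit_vector k)))))"

lemma cone_d_linear: "linear_to lmult cone_d"
  unfolding cone_d_def by (rule T.linear_to_extend)

lemma cone_d_in_Q: "cone_d (in_Q q) = in_Q (d' q)"
proof -
  have "linear_to lmult (\<lambda>q. cone_d (in_Q q))" "linear_to lmult (\<lambda>q. in_Q (d' q))"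
    using linear_to_comp [where h = "\<lambda>a. a"] in_Q_linear cone_d_linear Q.d_linear by blast+
  then show ?thesis by (rule linear_to_eqI) (simp add: cone_d_def T.extend_unit_vector)
qed

lemma cone_d_in_Q': "cone_d (in_Q' q) = in_Q' (d' q)"
proof -
  have "linear_to lmult (\<lambda>q. cone_d (in_Q' q))" "linear_to lmult (\<lambda>q. in_Q' (d' q))"
    using linear_to_comp [where h = "\<lambda>a. a"] in_Q'_linear cone_d_linear Q.d_linear by blast+
  then show ?thesis by (rule linear_to_eqI) (simp add: cone_d_def T.extend_unit_vector)
qed

lemma cone_d_in_P: "cone_d (in_P p) = in_Q (\<pi> p) + in_Q' (X p) - in_P (d p)"
proof -
  have 1: "linear_to (\<lambda>a. lmult (h a)) (\<lambda>q. cone_d (in_P q))"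
    using linear_to_comp [OF in_P_linear cone_d_linear] .
  have 2: "linear_to (\<lambda>a. lmult (h a)) (\<lambda>p. in_Q (\<pi> p) + in_Q' (X p) - in_P (d p))"
    by (intro hT.linear_to_plus hT.linear_to_subtract linear_to_comp [OF \<pi>(1) in_Q_linear]
        linear_to_comp [OF X(1) in_Q'_linear]
        linear_to_comp [where h = "\<lambda>a. a", OF P.d_linear in_P_linear])
  show ?thesis by (rule linear_to_eqI [OF 1 2]) (simp add: cone_d_def T.extend_unit_vector)
qed

lemma cone_d_spread: "spread cone_pr cone_pr {(1, 0)} cone_d"
  unfolding cone_d_def
proof (rule Q.spread_extend [OF T.graded_target_axioms])
  fix z e assume *: "cone_deg z - e \<notin> {(1, 0)}"
  have Q: "cone_pr e (in_Q q) = 0" if "Q.pr e q = 0" for q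
    using that by (intro spreadD [OF in_Q_spread]) simp
  have Q': "cone_pr e (in_Q' q) = 0" if "Q.pr (e - (1, 1)) q = 0" for q
  proof (rule spreadD [OF in_Q'_spread])
    show "Q.pr (e + x) q = 0" if "x \<in> {(-1, -1)}" for x
      using that \<open>Q.pr (e - (1, 1)) q = 0\<close> by (simp add: minus_prod_def plus_prod_def)
  qed
  have P: "cone_pr e (in_P q) = 0" if "P.pr (e - (1, 0)) q = 0" for q
  proof (rule spreadD [OF in_P_spread])
    show "P.pr (e + x) q = 0" if "x \<in> {(-1, 0)}" for x
      using that \<open>P.pr (e - (1, 0)) q = 0\<close> by (simp add: minus_prod_def plus_prod_def)
  qed
  consider (P) k where "z = Inl k" | (Q) k where "z = Inr (Inl k)" | (Q') k where "z = Inr (Inr k)"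
    by (metis sum.exhaust)
  then show "cone_pr e (case_sum
    (\<lambda>k. in_Q (\<pi> (unit_vector k)) + in_Q' (X (unit_vector k)) - in_P (d (unit_vector k)))
    (case_sum (\<lambda>k. in_Q (d' (unit_vector k))) (\<lambda>k. in_Q' (d' (unit_vector k)))) z) = 0"
  proof cases
    case P
    have e: "e \<noteq> deg k" using * P by (auto simp: cone_deg_def)
    have "Q.pr e (\<pi> (unit_vector k)) = 0"
      by (rule spreadD [OF \<pi>(2)]) (use e in \<open>auto intro!: P.proj_unit_vector\<close>)
    moreover have "Q.pr (e - (1, 1)) (X (unit_vector k)) = 0"
      by (rule spreadD [OF X(2)]) (use e in \<open>auto intro!: P.proj_unit_vector\<close>)
    moreover have "P.pr (e - (1, 0)) (d (unit_vector k)) = 0"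
      by (rule spreadD [OF P.d_spread]) (use e in \<open>auto intro!: P.proj_unit_vector\<close>)
    ultimately show ?thesis
      using Q Q' \<open>\<And>q. P.pr (e - (1, 0)) q = 0 \<Longrightarrow> cone_pr e (in_P q) = 0\<close>
      by (simp add: P diff_conv_add_uminus T.pr_add T.pr_minus del: add_uminus_conv_diff)
  next
    case Q
    have "Q.pr e (d' (unit_vector k)) = 0"
      by (rule spreadD [OF Q.d_spread]) (use * Q in \<open>auto intro!: Q.proj_unit_vector simp: cone_deg_def prod_eq_iff\<close>)
    then show ?thesis using \<open>\<And>q. Q.pr e q = 0 \<Longrightarrow> cone_pr e (in_Q q) = 0\<close> by (simp add: Q)
  next
    case Q'
    have "Q.pr (e - (1, 1)) (d' (unit_vector k)) = 0"
      by (rule spreadD [OF Q.d_spread])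
        (use * Q' in \<open>auto intro!: Q.proj_unit_vector simp: cone_deg_def prod_eq_iff\<close>)
    then show ?thesis
      using \<open>\<And>q. Q.pr (e - (1, 1)) q = 0 \<Longrightarrow> cone_pr e (in_Q' q) = 0\<close> by (simp add: Q')
  qed
qed

lemmas cone_d_simps = linear_to_add [OF cone_d_linear] linear_to_diff [OF cone_d_linear]
  linear_to_minus [OF cone_d_linear] cone_d_in_P cone_d_in_Q cone_d_in_Q'

lemma cone_d_cone_d: "cone_d (cone_d t) = 0"
proof -
  obtain p q r where "t = in_P p + in_Q q + in_Q' r" by (rule cone_decompose)
  then show ?thesis
    by (simp add: cone_d_simps \<pi>(3) X(3) P.d_d Q.d_d in_P_simps in_Q_simps in_Q'_simps)
qed

text \<open>
  Let \<open>t = (p, q, r)\<close> be a cycle. It says that \<open>d p = - g w\<close> for some \<open>w\<close>, and augmenting its other two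
  components gives \<open>\<alpha> p = 0\<close> and \<open>\<alpha> w = 0\<close>. So \<open>w\<close> is a boundary, \<open>p\<close> is one modulo \<open>g\<close>, and we may assume
  \<open>p = 0\<close>. Then \<open>q\<close> and \<open>r\<close> are cycles of \<open>Q\<close>, possibly with nonzero augmentation. The cycle \<open>p2\<close> of
  \<open>P/gP\<close> is chosen so that \<open>\<pi> p2\<close> and \<open>X p2\<close> have the same augmentations as \<open>q\<close> and \<open>r\<close>, and the differences
  are boundaries in \<open>Q\<close>.
\<close>

lemma cone_exact:
  assumes "cone_d t = 0"
  obtains t' where "cone_d t' = t"
proof -
  obtain p q r where t: "t = in_P p + in_Q q + in_Q' r" by (rule cone_decompose)
  have "in_P (- d p) + in_Q (\<pi> p + d' q) + in_Q' (X p + d' r) = 0"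
    using assms unfolding t by (simp add: cone_d_simps in_P_simps in_Q_simps in_Q'_simps algebra_simps)
  from cone_eq_0 [OF this] obtain w where w: "- d p = lmult g w" "\<pi> p + d' q = 0" "X p + d' r = 0"
    by blast
  have dp: "d p = lmult g (- w)" using w(1) by (metis P.self.act_minus_right minus_minus)
  have "\<alpha>' (X p) = 0"
    using w(3) Q.\<alpha>_d [of r] linear_to_minus [OF Q.\<alpha>_hom, of "d' r"] by (simp add: add_eq_0_iff2)
  then have "\<alpha> (- w) = 0" using X(4) [OF dp] by simp
  moreover have "d (- w) = 0"
    using lmult_g_injective [of "d (- w)"] P.d_d [of p] linear_to_act [OF P.d_linear, of g "- w"] dp by simp
  ultimately obtain w' where w': "d w' = - w" using P.exact by blast
  have "d (p - lmult g w') = 0"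
    using dp w' by (simp add: linear_to_diff [OF P.d_linear] linear_to_act [OF P.d_linear])
  moreover have "\<alpha> (p - lmult g w') = 0"
  proof -
    have "\<alpha> p = 0"
      using w(2) Q.\<alpha>_d [of q] linear_to_minus [OF Q.\<alpha>_hom, of "d' q"] \<pi>(4) [of p] by (simp add: add_eq_0_iff2)
    then show ?thesis by (simp add: linear_to_diff [OF P.\<alpha>_hom] linear_to_act [OF P.\<alpha>_hom] \<epsilon>_g)
  qed
  ultimately obtain p'' where p'': "d p'' = p - lmult g w'" using P.exact by blast
  have in_g: "in_P (lmult g w') = 0"
    by (simp add: linear_to_act [OF in_P_linear] h_g)
  let ?q = "q + \<pi> p''" and ?r = "r + X p''"
  have t1: "t = cone_d (in_P (- p'')) + in_Q ?q + in_Q' ?r"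
    by (simp add: t cone_d_simps in_P_simps in_Q_simps in_Q'_simps linear_to_minus [OF P.d_linear]
        linear_to_minus [OF \<pi>(1)] linear_to_minus [OF X(1)] p'' in_g)
  have dq: "d' ?q = 0"
    using w(2) \<pi>(3) [of p''] p''
    by (simp add: linear_to_add [OF Q.d_linear] linear_to_diff [OF \<pi>(1)] linear_to_act [OF \<pi>(1)] h_g add.commute)
  have dr: "d' ?r = 0"
    using w(3) X(3) [of p''] p''
    by (simp add: linear_to_add [OF Q.d_linear] linear_to_diff [OF X(1)] linear_to_act [OF X(1)] h_g add.commute)
  \<comment> \<open>The classes of \<open>p0\<close> and \<open>p1\<close> generate the homology of \<open>P/gP\<close>.\<close>
  obtain p0 where p0: "\<alpha> p0 = 1" "d p0 = 0" using P.homogeneous_unit by blast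
  have "\<exists>p1. d p1 = lmult g p0"
    using p0 by (intro P.exact) (simp_all add: linear_to_act [OF P.d_linear] linear_to_act [OF P.\<alpha>_hom] \<epsilon>_g)
  then obtain p1 where p1: "d p1 = lmult g p0" ..
  \<comment> \<open>The last summand of \<open>p2\<close> removes the augmentation of \<open>p1\<close>.\<close>
  define p2 where "p2 = lmult (\<kappa> (\<alpha>' ?q)) p0 + lmult (\<kappa> (\<alpha>' ?r)) p1
     - lmult (\<kappa> (\<alpha>' ?r)) (lmult (\<kappa> (\<alpha> p1)) p0)"
  have dp2: "d p2 = lmult g (lmult (\<kappa> (\<alpha>' ?r)) p0)"
  proof -
    have "lmult (\<kappa> s) (lmult g p0) = lmult g (lmult (\<kappa> s) p0)" for s
      using P.\<kappa>_central [of s g] by (metis lmult_algebra(3))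
    then show ?thesis
      by (simp add: p2_def linear_to_add [OF P.d_linear] linear_to_diff [OF P.d_linear]
          linear_to_act [OF P.d_linear] p0 p1)
  qed
  have "\<alpha>' (?q - \<pi> p2) = 0"
    by (simp add: linear_to_diff [OF Q.\<alpha>_hom] \<pi>(4) p2_def linear_to_add [OF P.\<alpha>_hom]
        linear_to_diff [OF P.\<alpha>_hom] linear_to_act [OF P.\<alpha>_hom] p0 P.\<epsilon>_\<kappa>)
  moreover have "d' (?q - \<pi> p2) = 0"
    by (simp add: linear_to_diff [OF Q.d_linear] dq dp2 linear_to_act [OF \<pi>(1)] h_g flip: \<pi>(3))
  ultimately obtain q' where q': "d' q' = ?q - \<pi> p2" using Q.exact by blast
  have "\<alpha>' (?r - X p2) = 0"
    using X(4) [OF dp2] by (simp add: linear_to_diff [OF Q.\<alpha>_hom] linear_to_act [OF P.\<alpha>_hom] p0 P.\<epsilon>_\<kappa>)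
  moreover have "d' (?r - X p2) = 0"
    by (simp add: linear_to_diff [OF Q.d_linear] dr dp2 linear_to_act [OF X(1)] h_g flip: X(3))
  ultimately obtain r' where r': "d' r' = ?r - X p2" using Q.exact by blast
  have "cone_d (in_P (- p'') + in_P p2 + in_Q q' + in_Q' r') = t"
    by (simp add: t1 cone_d_simps q' r' dp2 linear_to_act [OF in_P_linear] h_g
        linear_to_diff [OF in_Q_linear] linear_to_diff [OF in_Q'_linear] del: linear_to_minus)
  then show thesis by (rule that)
qed

text \<open>
  An exact complex of free modules that is bounded below is contractible: the identity is null-homotopic.
\<close>

lemma cone_contraction:
  obtains H where "linear_to lmult H" "\<And>t. cone_d (H t) = t - H (cone_d t)"
    "spread cone_pr cone_pr {(-1, 0)} H"
proof -
  interpret cone: graded_differential c' cone_deg cone_d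
    by unfold_locales (rule cone_d_linear cone_d_spread)+
  show thesis
  proof (rule Q.null_homotopy [of lmult cone_pr cone_deg "\<lambda>t. - cone_d t" cone_d UNIV "\<lambda>t. t" "{(-1, 0)}"])
    show "0 \<le> fst (cone_deg k)" for k
      using P.deg_nonneg Q.deg_nonneg by (auto simp: cone_deg_def split: sum.split)
    show "fst (cone_deg j) < fst (cone_deg k)"
      if "j \<in> Poly_Mapping.keys (- cone_d (unit_vector k))" for j k
      using cone.deg_keys_d [of j k] that by (simp add: in_keys_iff)
    show "linear_to lmult (\<lambda>t. - cone_d t)" by (rule T.linear_to_uminus [OF cone_d_linear])
    show "spread cone_pr cone_pr {(1, 0)} (\<lambda>t. - cone_d t)" by (rule T.spread_uminus [OF cone_d_spread])
    show "\<exists>y' \<in> UNIV. cone_d y' = y \<and> (\<forall>e. cone_pr (e - (1, 0)) y = 0 \<longrightarrow> cone_pr e y' = 0)"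
      if y: "cone_d y = 0" for y
    proof -
      obtain y0 where "cone_d y0 = y" using cone_exact [OF y] by blast
      then obtain y' where "cone_d y' = y" "\<And>e. cone_pr (e - (1, 0)) y = 0 \<Longrightarrow> cone_pr e y' = 0"
        by (rule cone.graded_preimage) blast
      then show ?thesis by blast
    qed
    show "spread cone_pr cone_pr ({(-1, 0)} + {(1, 0)}) (\<lambda>t. t)"
      by (simp add: spread_def set_plus_def flip: zero_prod_def)
    show "linear_to lmult (\<lambda>t :: 'x + 'y + 'y \<Rightarrow>\<^sub>0 'b. t)" by (simp add: linear_to_def)
    show thesis if "linear_to lmult H" "\<And>p. cone_d (H p) = p + H (- cone_d p)"
      "\<And>p. H p \<in> UNIV" "spread cone_pr cone_pr {(-1, 0)} H" for H
      using \<open>\<And>H. linear_to lmult H \<Longrightarrow> (\<And>t. cone_d (H t) = t - H (cone_d t)) \<Longrightarrow>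
        spread cone_pr cone_pr {(-1, 0)} H \<Longrightarrow> thesis\<close> [OF that(1) _ that(4)] that(2)
      by (simp add: linear_to_minus [OF that(1)])
    show "graded_target lmult c' cone_pr" by (rule T.graded_target_axioms)
    show "- cone_d (- cone_d t) = 0" for t by (simp add: linear_to_minus [OF cone_d_linear] cone_d_cone_d)
    show "cone_d (y + z) = cone_d y + cone_d z" for y z by (rule linear_to_add [OF cone_d_linear])
    show "cone_d (lmult a y) = lmult a (cone_d y)" for a y by (rule linear_to_act [OF cone_d_linear])
    show "cone_d t = - (- cone_d t)" for t by simp
  qed blast+
qed

text \<open>
  Cochains of the cone are triples of cochains, of \<open>P\<close> and twice of \<open>Q\<close>. The spread is
  bounded for all choices of \<open>D\<close>, \<open>E\<close>, \<open>E'\<close> at once, since it is needed both for finite sets and for sets that fix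
  the cohomological degree.
\<close>

lemma cone_cochain:
  assumes f: "trivial_hom \<epsilon> f" and u: "trivial_hom \<epsilon>' u" and v: "trivial_hom \<epsilon>' v"
  obtains F where "trivial_hom \<epsilon>' F" "\<And>p. F (in_P p) = f p" "\<And>q. F (in_Q q) = u q" "\<And>q. F (in_Q' q) = v q"
    "\<And>D E E'. spread P.pr trivial_proj D f \<Longrightarrow> spread Q.pr trivial_proj E u \<Longrightarrow>
      spread Q.pr trivial_proj E' v \<Longrightarrow>
      spread cone_pr trivial_proj (D + {(1, 0)} \<union> E \<union> (E' + {(1, 1)})) F"
proof -
  define \<phi> where "\<phi> = case_sum (\<lambda>k. f (unit_vector k)) (case_sum (\<lambda>k. u (unit_vector k)) (\<lambda>k. v (unit_vector k)))"
  let ?F = "extend (\<lambda>a y. \<epsilon>' a * y) \<phi>"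
  have lin: "trivial_hom \<epsilon>' ?F" by (rule Q.triv.linear_to_extend)
  show thesis
  proof (rule that [OF lin])
    show "?F (in_P p) = f p" for p
    proof -
      have "trivial_hom \<epsilon> (\<lambda>p. ?F (in_P p))"
        using linear_to_comp [OF in_P_linear lin] by (simp add: \<epsilon>'_h)
      then show ?thesis using f by (rule linear_to_eqI) (simp add: \<phi>_def Q.triv.extend_unit_vector)
    qed
    show "?F (in_Q q) = u q" for q
    proof -
      have "trivial_hom \<epsilon>' (\<lambda>p. ?F (in_Q p))"
        using linear_to_comp [where h = "\<lambda>a. a", OF in_Q_linear lin] .
      then show ?thesis using u by (rule linear_to_eqI) (simp add: \<phi>_def Q.triv.extend_unit_vector)
    qed
    show "?F (in_Q' q) = v q" for q
    proof -
      have "trivial_hom \<epsilon>' (\<lambda>p. ?F (in_Q' p))"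
        using linear_to_comp [where h = "\<lambda>a. a", OF in_Q'_linear lin] .
      then show ?thesis using v by (rule linear_to_eqI) (simp add: \<phi>_def Q.triv.extend_unit_vector)
    qed
    fix D E E'
    assume s: "spread P.pr trivial_proj D f" "spread Q.pr trivial_proj E u" "spread Q.pr trivial_proj E' v"
    let ?D = "D + {(1, 0)} \<union> E \<union> (E' + {(1, 1)})"
    show "spread cone_pr trivial_proj ?D ?F"
    proof (rule Q.spread_extend [OF Q.triv.graded_target_axioms])
      fix z e assume *: "cone_deg z - e \<notin> ?D"
      have "\<phi> z = 0" if e: "cone_deg z \<notin> ?D"
      proof -
        consider (P) k where "z = Inl k" | (Q) k where "z = Inr (Inl k)" | (Q') k where "z = Inr (Inr k)"
          by (metis sum.exhaust)
        then show ?thesis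
        proof cases
          case P
          then have "deg k \<notin> D" using e by (auto simp: cone_deg_def intro: set_plus_intro)
          then have "\<forall>x \<in> D. P.pr x (unit_vector k) = 0" by (auto intro: P.proj_unit_vector)
          then show ?thesis using s(1) P by (simp add: spread_trivial \<phi>_def)
        next
          case Q
          then have "deg' k \<notin> E" using e by (auto simp: cone_deg_def intro: set_plus_intro)
          then have "\<forall>x \<in> E. Q.pr x (unit_vector k) = 0" by (auto intro: Q.proj_unit_vector)
          then show ?thesis using s(2) Q by (simp add: spread_trivial \<phi>_def)
        next
          case Q'
          then have "deg' k \<notin> E'" using e by (auto simp: cone_deg_def intro: set_plus_intro)
          then have "\<forall>x \<in> E'. Q.pr x (unit_vector k) = 0" by (auto intro: Q.proj_unit_vector)
          then show ?thesis using s(3) Q' by (simp add: spread_trivial \<phi>_def)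
        qed
      qed
      then show "trivial_proj e (\<phi> z) = 0" using * by (auto simp: trivial_proj_def)
    qed
  qed
qed

lemma cone_acyclic:
  assumes F: "trivial_hom \<epsilon>' F" "\<And>t. F (cone_d t) = 0"
  obtains F' where "trivial_hom \<epsilon>' F'" "\<And>t. F t = F' (cone_d t)"
    "\<And>D. spread cone_pr trivial_proj D F \<Longrightarrow> spread cone_pr trivial_proj (D + {(-1, 0)}) F'"
proof -
  obtain H where H: "linear_to lmult H" "\<And>t. cone_d (H t) = t - H (cone_d t)"
    "spread cone_pr cone_pr {(-1, 0)} H" using cone_contraction by blast
  show thesis
  proof (rule that [of "\<lambda>t. F (H t)"])
    show "trivial_hom \<epsilon>' (\<lambda>t. F (H t))" using linear_to_comp [where h = "\<lambda>a. a", OF H(1) F(1)] .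
    show "F t = F (H (cone_d t))" for t
      using F(2) [of "H t"] H(2) [of t] by (simp add: linear_to_diff [OF F(1)])
    show "spread cone_pr trivial_proj (D + {(-1, 0)}) (\<lambda>t. F (H t))"
      if "spread cone_pr trivial_proj D F" for D using spread_comp [OF H(3) that] .
  qed
qed

text \<open>
  If \<open>w\<close> bounds \<open>u \<circ> \<pi> + v \<circ> X\<close>, then \<open>(w, u, v)\<close> is a cocycle of the cone, hence a coboundary, and so is its
  component \<open>u\<close>.
\<close>

lemma gysin_injective:
  assumes u: "Q.cocycle u" and v: "Q.cocycle v"
    and w: "P.cohomologous (\<lambda>p. u (\<pi> p) + v (X p)) (\<lambda>p. 0)"
  shows "Q.cohomologous u (\<lambda>q. 0)"
proof -
  obtain w where w: "P.cochain w" "\<And>p. u (\<pi> p) + v (X p) = w (d p)"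
    using w unfolding P.cohomologous_def by auto
  obtain D where D: "finite D" "spread P.pr trivial_proj D w" "trivial_hom \<epsilon> w"
    using w(1) by (rule P.cochainE)
  obtain E where E: "finite E" "spread Q.pr trivial_proj E u" "trivial_hom \<epsilon>' u"
    using Q.cocycleD(1) [OF u] by (rule Q.cochainE)
  obtain E' where E': "finite E'" "spread Q.pr trivial_proj E' v" "trivial_hom \<epsilon>' v"
    using Q.cocycleD(1) [OF v] by (rule Q.cochainE)
  obtain F where F: "trivial_hom \<epsilon>' F" "\<And>p. F (in_P p) = w p" "\<And>q. F (in_Q q) = u q" "\<And>q. F (in_Q' q) = v q"
    and sF': "\<And>D E E'. spread P.pr trivial_proj D w \<Longrightarrow> spread Q.pr trivial_proj E u \<Longrightarrow>
      spread Q.pr trivial_proj E' v \<Longrightarrow>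
      spread cone_pr trivial_proj (D + {(1, 0)} \<union> E \<union> (E' + {(1, 1)})) F"
    by (fact cone_cochain [OF D(3) E(3) E'(3)])
  note sF = sF' [OF D(2) E(2) E'(2)]
  have "F (cone_d t) = 0" for t
  proof -
    obtain p q r where "t = in_P p + in_Q q + in_Q' r" by (rule cone_decompose)
    then show ?thesis
      by (simp add: cone_d_simps linear_to_add [OF F(1)] linear_to_diff [OF F(1)] F w
          Q.cocycleD(2) [OF u] Q.cocycleD(2) [OF v])
  qed
  then obtain F' where F': "trivial_hom \<epsilon>' F'" "\<And>t. F t = F' (cone_d t)"
    "\<And>D. spread cone_pr trivial_proj D F \<Longrightarrow> spread cone_pr trivial_proj (D + {(-1, 0)}) F'"
    using cone_acyclic [OF F(1)] by blast
  have "Q.cochain (\<lambda>q. F' (in_Q q))"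
    unfolding Q.cochain_def
  proof (intro conjI exI)
    show "trivial_hom \<epsilon>' (\<lambda>q. F' (in_Q q))"
      using linear_to_comp [where h = "\<lambda>a. a", OF in_Q_linear F'(1)] .
    show "spread Q.pr trivial_proj (D + {(1, 0)} \<union> E \<union> (E' + {(1, 1)}) + {(-1, 0)} + {0}) (\<lambda>q. F' (in_Q q))"
      by (rule spread_comp [OF in_Q_spread F'(3) [OF sF]])
    show "finite (D + {(1, 0)} \<union> E \<union> (E' + {(1, 1)}) + {(-1, 0)} + {0})"
      using D E E' by (simp add: finite_set_plus)
  qed
  moreover have "u q - 0 = F' (in_Q (d' q))" for q
    using F'(2) [of "in_Q q"] by (simp add: F cone_d_simps)
  ultimately show ?thesis unfolding Q.cohomologous_def by blast
qed

text \<open>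
  If \<open>f\<close> is a cocycle of \<open>P\<close>, then \<open>(f, 0, 0)\<close> is a cocycle of the cone. A cochain \<open>(f', u, v)\<close> that bounds it
  satisfies \<open>f = u \<circ> \<pi> + v \<circ> X - f' \<circ> d\<close>, while \<open>u \<circ> d'\<close> and \<open>v \<circ> d'\<close> vanish.
\<close>

lemma gysin_splitting:
  assumes f: "P.cocycle f"
  obtains u v where "Q.cocycle u" "Q.cocycle v" "P.cohomologous f (\<lambda>p. u (\<pi> p) + v (X p))"
    "\<And>n. spread P.pr trivial_proj ({n} \<times> UNIV) f \<Longrightarrow>
      spread Q.pr trivial_proj ({n} \<times> UNIV) u \<and> spread Q.pr trivial_proj ({n - 1} \<times> UNIV) v"
proof -
  obtain D where D: "finite D" "spread P.pr trivial_proj D f" "trivial_hom \<epsilon> f"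
    using P.cocycleD(1) [OF f] by (rule P.cochainE)
  have 0: "trivial_hom \<epsilon>' (\<lambda>q :: 'y \<Rightarrow>\<^sub>0 'b. 0)" "spread Q.pr trivial_proj {} (\<lambda>q. 0 :: 'k)"
    by (auto simp: linear_to_def spread_trivial)
  obtain F where F: "trivial_hom \<epsilon>' F" "\<And>p. F (in_P p) = f p" "\<And>q. F (in_Q q) = 0" "\<And>q. F (in_Q' q) = 0"
    "\<And>D E E'. spread P.pr trivial_proj D f \<Longrightarrow> spread Q.pr trivial_proj E (\<lambda>q. 0 :: 'k) \<Longrightarrow>
      spread Q.pr trivial_proj E' (\<lambda>q. 0 :: 'k) \<Longrightarrow>
      spread cone_pr trivial_proj (D + {(1, 0)} \<union> E \<union> (E' + {(1, 1)})) F"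
    by (fact cone_cochain [OF D(3) 0(1) 0(1)])
  have "F (cone_d t) = 0" for t
  proof -
    obtain p q r where "t = in_P p + in_Q q + in_Q' r" by (rule cone_decompose)
    then show ?thesis
      by (simp add: cone_d_simps linear_to_add [OF F(1)] linear_to_diff [OF F(1)] F
          P.cocycleD(2) [OF f])
  qed
  then obtain F' where F': "trivial_hom \<epsilon>' F'" "\<And>t. F t = F' (cone_d t)"
    "\<And>D. spread cone_pr trivial_proj D F \<Longrightarrow> spread cone_pr trivial_proj (D + {(-1, 0)}) F'"
    using cone_acyclic [OF F(1)] by blast
  have sF': "spread cone_pr trivial_proj E F'" if "spread P.pr trivial_proj E f" for E
  proof -
    have "E + {(1, 0)} \<union> {} \<union> ({} + {(1, 1)}) + {(-1, 0)} = E"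
      by (auto simp: set_plus_def plus_prod_def)
    then show ?thesis using F'(3) [OF F(5) [OF that 0(2) 0(2)]] by simp
  qed
  have su: "spread Q.pr trivial_proj (E + {0}) (\<lambda>q. F' (in_Q q))"
    and sv: "spread Q.pr trivial_proj (E + {(-1, -1)}) (\<lambda>q. F' (in_Q' q))"
    and sw: "spread P.pr trivial_proj (E + {(-1, 0)}) (\<lambda>q. F' (in_P q))"
    if "spread P.pr trivial_proj E f" for E
    using spread_comp [OF in_Q_spread sF' [OF that]] spread_comp [OF in_Q'_spread sF' [OF that]]
      spread_comp [OF in_P_spread sF' [OF that]] by blast+
  have lin: "trivial_hom \<epsilon>' (\<lambda>q. F' (in_Q q))" "trivial_hom \<epsilon>' (\<lambda>q. F' (in_Q' q))"
    using linear_to_comp [where h = "\<lambda>a. a", OF in_Q_linear F'(1)]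
      linear_to_comp [where h = "\<lambda>a. a", OF in_Q'_linear F'(1)] by blast+
  have linP: "trivial_hom \<epsilon> (\<lambda>p. F' (in_P p))"
    using linear_to_comp [OF in_P_linear F'(1)] by (simp add: \<epsilon>'_h)
  show thesis
  proof (rule that [of "\<lambda>q. F' (in_Q q)" "\<lambda>q. F' (in_Q' q)"])
    have fin: "finite (D + {x})" for x using D(1) by (simp add: finite_set_plus)
    show "Q.cocycle (\<lambda>q. F' (in_Q q))"
      unfolding Q.cocycle_def Q.cochain_def
      using F(3) by (intro conjI allI exI [of _ "D + {0}"] lin(1) su [OF D(2)] fin) (simp flip: cone_d_in_Q F'(2))
    show "Q.cocycle (\<lambda>q. F' (in_Q' q))"
      unfolding Q.cocycle_def Q.cochain_def
      using F(4) by (intro conjI allI exI [of _ "D + {(-1, -1)}"] lin(2) sv [OF D(2)] fin)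
        (simp flip: cone_d_in_Q' F'(2))
    have "P.cochain (\<lambda>p. - 1 * F' (in_P p))"
      unfolding P.cochain_def
      by (intro P.cochain_scale [unfolded P.cochain_def] conjI exI [of _ "D + {(-1, 0)}"] linP sw [OF D(2)] fin)
    moreover have "f p - (F' (in_Q (\<pi> p)) + F' (in_Q' (X p))) = - 1 * F' (in_P (d p))" for p
      using F'(2) [of "in_P p"] by (simp add: F cone_d_in_P linear_to_add [OF F'(1)] linear_to_diff [OF F'(1)])
    ultimately show "P.cohomologous f (\<lambda>p. F' (in_Q (\<pi> p)) + F' (in_Q' (X p)))"
      unfolding P.cohomologous_def by blast
    fix n assume s: "spread P.pr trivial_proj ({n} \<times> UNIV) f"
    show "spread Q.pr trivial_proj ({n} \<times> UNIV) (\<lambda>q. F' (in_Q q)) \<and>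
        spread Q.pr trivial_proj ({n - 1} \<times> UNIV) (\<lambda>q. F' (in_Q' q))"
      by (intro conjI spread_mono [OF su [OF s]] spread_mono [OF sv [OF s]])
        (auto elim!: set_plus_elim)
  qed
qed

end

section \<open>The subalgebra generated in low degrees\<close>

context free_resolution
begin

abbreviation endo_chain_map :: "(('x \<Rightarrow>\<^sub>0 'a) \<Rightarrow> ('x \<Rightarrow>\<^sub>0 'a)) \<Rightarrow> bool"
  where "endo_chain_map \<equiv> semilinear_chain_map c deg d c deg d (\<lambda>a. a)"

lemma change_of_rings_self: "change_of_rings c \<kappa> \<epsilon> deg d \<alpha> c \<kappa> \<epsilon> deg d \<alpha> (\<lambda>a. a)"
  by unfold_locales (simp_all add: unital_hom_def)

text \<open>
  The cocycles whose classes lie in the subalgebra generated by \<open>E\<^sup>1\<close> and \<open>E\<^sup>2\<close>. The rule \<open>cohomologous\<close> makes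
  the predicate one about classes; the product of \<open>u\<close> and \<open>v\<close> is represented by \<open>u\<close> after a lift of \<open>v\<close>.
\<close>

inductive low_generated :: "(('x \<Rightarrow>\<^sub>0 'a) \<Rightarrow> 'k) \<Rightarrow> bool"
  where
    one: "low_generated \<alpha>"
  | low: "cocycle f \<Longrightarrow> n \<in> {1, 2} \<Longrightarrow> spread pr trivial_proj ({n} \<times> UNIV) f \<Longrightarrow> low_generated f"
  | plus: "low_generated u \<Longrightarrow> low_generated v \<Longrightarrow> low_generated (\<lambda>p. u p + v p)"
  | scale: "low_generated u \<Longrightarrow> low_generated (\<lambda>p. s * u p)"
  | product: "low_generated u \<Longrightarrow> low_generated v \<Longrightarrow> endo_chain_map F \<Longrightarrow> (\<And>p. \<alpha> (F p) = v p) \<Longrightarrow>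
      low_generated (\<lambda>p. u (F p))"
  | cohomologous: "low_generated u \<Longrightarrow> cocycle v \<Longrightarrow> cohomologous v u \<Longrightarrow> low_generated v"

lemma low_generated_cocycle: "low_generated f \<Longrightarrow> cocycle f"
proof (induction rule: low_generated.induct)
  case (product u v F)
  interpret change_of_rings c \<kappa> \<epsilon> deg d \<alpha> c \<kappa> \<epsilon> deg d \<alpha> "\<lambda>a. a" by (rule change_of_rings_self)
  show ?case using cocycle_comp [OF product.IH(1) product.hyps(3)] .
qed (simp_all add: cocycle_\<alpha> cocycle_plus cocycle_scale)

text \<open>
  \<open>E\<^sup>0 = K\<close>: the part of \<open>p\<close> of homological degree 0 differs from a multiple of \<open>u\<close> by a boundary, so \<open>f\<close> is
  a multiple of the augmentation.
\<close>

lemma low_generated_degree_0: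
  assumes f: "cocycle f" "spread pr trivial_proj ({0} \<times> UNIV) f"
  shows "low_generated f"
proof -
  have lin: "trivial_hom \<epsilon> f" by (rule cocycleD(3) [OF f(1)])
  obtain u where u: "\<alpha> u = 1" "d u = 0" using homogeneous_unit by blast
  have "f p = f u * \<alpha> p" for p
  proof -
    let ?p = "\<Sum>e | pr e p \<noteq> 0. if fst e = 0 then pr e p else 0"
    have fin: "finite {e. pr e p \<noteq> 0}" by (rule finite_proj)
    have prj: "pr e ?p = (if fst e = 0 then pr e p else 0)" for e
    proof -
      have "pr e ?p = (\<Sum>e' | pr e' p \<noteq> 0. if e' = e then (if fst e = 0 then pr e p else 0) else 0)"
        unfolding proj_sum by (rule sum.cong) (auto simp: proj_proj)
      then show ?thesis using fin by simp
    qed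
    have diff: "pr e (p - ?p) = (if fst e = 0 then 0 else pr e p)" for e
      using self.pr_add [of e p "- ?p"] self.pr_minus [of e ?p] prj [of e] by simp
    have "f (p - ?p) = 0"
      using f(2) unfolding spread_trivial by (auto simp: diff)
    then have fp: "f p = f ?p" by (simp add: linear_to_diff [OF lin])
    have "\<alpha> (p - ?p) = 0"
      using \<alpha>_spread unfolding spread_trivial by (auto simp: diff)
    then have ap: "\<alpha> p = \<alpha> ?p" by (simp add: linear_to_diff [OF \<alpha>_hom])
    let ?r = "?p - lmult (\<kappa> (\<alpha> ?p)) u"
    have "d ?p = 0"
      unfolding linear_to_sum [OF d_linear]
      by (rule sum.neutral) (auto simp: d_proj proj_negative linear_to_zero [OF d_linear])
    then have "d ?r = 0" by (simp add: linear_to_diff [OF d_linear] linear_to_act [OF d_linear] u)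
    moreover have "\<alpha> ?r = 0" by (simp add: linear_to_diff [OF \<alpha>_hom] linear_to_act [OF \<alpha>_hom] u \<epsilon>_\<kappa>)
    ultimately obtain r where "d r = ?r" using exact by blast
    then have "f ?r = 0" using f(1) unfolding cocycle_def by metis
    then show ?thesis by (simp add: fp ap linear_to_diff [OF lin] linear_to_act [OF lin] \<epsilon>_\<kappa> mult.commute)
  qed
  then have "f = (\<lambda>p. f u * \<alpha> p)" by blast
  then show ?thesis using scale [OF one] by metis
qed

end

section \<open>Descent of generation in low degrees\<close>

text \<open>
  The assumptions \<open>splitting\<close> and \<open>injective\<close> state that \<open>E(A)\<close> is the sum of \<open>\<phi>(E(B))\<close> and \<open>\<phi>(E(B)) \<chi>\<close>, and that
  \<open>\<phi>(u) + \<phi>(v) \<chi> = 0\<close> forces \<open>u = 0\<close>. Products are formed with the left factor applied last, so multiplying by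
  \<open>\<chi>\<close> on the left means to compose \<open>\<chi>\<close> with a lift.
\<close>

locale gysin_sequence = change_of_rings c \<kappa> \<epsilon> deg d \<alpha> c' \<kappa>' \<epsilon>' deg' d' \<alpha>' h
  for c :: "int \<Rightarrow> 'a::ring_1 \<Rightarrow> 'a" and \<kappa> :: "'k::field \<Rightarrow> 'a" and \<epsilon>
    and deg :: "'x \<Rightarrow> int \<times> int" and d and \<alpha>
    and c' :: "int \<Rightarrow> 'b::ring_1 \<Rightarrow> 'b" and \<kappa>' :: "'k \<Rightarrow> 'b" and \<epsilon>'
    and deg' :: "'y \<Rightarrow> int \<times> int" and d' and \<alpha>' and h +
  fixes \<pi> X :: "('x \<Rightarrow>\<^sub>0 'a) \<Rightarrow> ('y \<Rightarrow>\<^sub>0 'b)"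
  assumes \<pi>: "chain_map \<pi>" "\<And>p. \<alpha>' (\<pi> p) = \<alpha> p" "spread P.pr Q.pr {0} \<pi>"
    and X: "chain_map X" "spread P.pr trivial_proj {(1, 1)} (\<lambda>p. \<alpha>' (X p))"
    and injective: "\<And>u v. Q.cocycle u \<Longrightarrow> Q.cocycle v \<Longrightarrow>
      P.cohomologous (\<lambda>p. u (\<pi> p) + v (X p)) (\<lambda>p. 0) \<Longrightarrow> Q.cohomologous u (\<lambda>q. 0)"
    and splitting: "\<And>f. P.cocycle f \<Longrightarrow>
      \<exists>u v. Q.cocycle u \<and> Q.cocycle v \<and> P.cohomologous f (\<lambda>p. u (\<pi> p) + v (X p)) \<and>
        (\<forall>n. spread P.pr trivial_proj ({n} \<times> UNIV) f \<longrightarrow>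
          spread Q.pr trivial_proj ({n} \<times> UNIV) u \<and> spread Q.pr trivial_proj ({n - 1} \<times> UNIV) v)"
    and degree_3: "\<And>u. Q.cocycle u \<Longrightarrow> spread Q.pr trivial_proj ({3} \<times> UNIV) u \<Longrightarrow> Q.low_generated u"
begin

sublocale PP: change_of_rings c \<kappa> \<epsilon> deg d \<alpha> c \<kappa> \<epsilon> deg d \<alpha> "\<lambda>a. a"
  by (rule P.change_of_rings_self)

sublocale QQ: change_of_rings c' \<kappa>' \<epsilon>' deg' d' \<alpha>' c' \<kappa>' \<epsilon>' deg' d' \<alpha>' "\<lambda>a. a"
  by (rule Q.change_of_rings_self)

lemma chain_map_comp_right: "PP.chain_map F \<Longrightarrow> chain_map G \<Longrightarrow> chain_map (\<lambda>p. G (F p))"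
  using semilinear_chain_map_comp [of c deg d c deg d "\<lambda>a. a" F] by blast

lemma chain_map_comp_left: "chain_map F \<Longrightarrow> QQ.chain_map G \<Longrightarrow> chain_map (\<lambda>p. G (F p))"
  using semilinear_chain_map_comp [of c deg d c' deg' d' h F] by blast

lemma chain_map_comp_self: "PP.chain_map F \<Longrightarrow> PP.chain_map G \<Longrightarrow> PP.chain_map (\<lambda>p. G (F p))"
  using semilinear_chain_map_comp [of c deg d c deg d "\<lambda>a. a" F] by blast

abbreviation \<chi> :: "('x \<Rightarrow>\<^sub>0 'a) \<Rightarrow> 'k" where "\<chi> \<equiv> \<lambda>p. \<alpha>' (X p)"

lemma cocycle_\<chi>: "P.cocycle \<chi>"
  by (rule cocycle_comp [OF Q.cocycle_\<alpha> X(1)])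

text \<open>
  The classes in \<open>\<phi>(D) + \<phi>(D) \<chi>\<close>, where \<open>D \<subseteq> E(B)\<close> is generated by \<open>E\<^sup>1(B)\<close> and \<open>E\<^sup>2(B)\<close>.
\<close>

definition spanned :: "(('x \<Rightarrow>\<^sub>0 'a) \<Rightarrow> 'k) \<Rightarrow> bool"
  where "spanned f \<longleftrightarrow> P.cocycle f \<and>
    (\<exists>u v. Q.low_generated u \<and> Q.low_generated v \<and> P.cohomologous f (\<lambda>p. u (\<pi> p) + v (X p)))"

lemma spanned_cocycle: "spanned f \<Longrightarrow> P.cocycle f"
  by (simp add: spanned_def)

lemma spanned_cohomologous: "spanned f \<Longrightarrow> P.cocycle f' \<Longrightarrow> P.cohomologous f' f \<Longrightarrow> spanned f'"
  unfolding spanned_def using P.cohomologous_trans by blast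

lemma spanned_plus:
  assumes "spanned f" "spanned f'"
  shows "spanned (\<lambda>p. f p + f' p)"
proof -
  obtain u v u' v' where *: "Q.low_generated u" "Q.low_generated v" "Q.low_generated u'" "Q.low_generated v'"
    "P.cohomologous f (\<lambda>p. u (\<pi> p) + v (X p))" "P.cohomologous f' (\<lambda>p. u' (\<pi> p) + v' (X p))"
    using assms unfolding spanned_def by blast
  have "P.cohomologous (\<lambda>p. f p + f' p) (\<lambda>p. (u (\<pi> p) + u' (\<pi> p)) + (v (X p) + v' (X p)))"
    using P.cohomologous_plus [OF *(5,6)] by (simp add: algebra_simps)
  then show ?thesis
    using * assms Q.low_generated.plus [OF *(1,3)] Q.low_generated.plus [OF *(2,4)] unfolding spanned_def
    by (intro conjI P.cocycle_plus exI [of _ "\<lambda>q. u q + u' q"] exI [of _ "\<lambda>q. v q + v' q"]) auto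
qed

lemma spanned_scale:
  assumes "spanned f"
  shows "spanned (\<lambda>p. s * f p)"
proof -
  obtain u v where *: "Q.low_generated u" "Q.low_generated v"
    "P.cohomologous f (\<lambda>p. u (\<pi> p) + v (X p))"
    using assms unfolding spanned_def by blast
  have "P.cohomologous (\<lambda>p. s * f p) (\<lambda>p. s * u (\<pi> p) + s * v (X p))"
    using P.cohomologous_scale [OF *(3), of s] by (simp add: algebra_simps)
  then show ?thesis
    using * assms Q.low_generated.scale [OF *(1), of s] Q.low_generated.scale [OF *(2), of s]
    unfolding spanned_def
    by (intro conjI P.cocycle_scale exI [of _ "\<lambda>q. s * u q"] exI [of _ "\<lambda>q. s * v q"]) auto
qed

lemma low_generated_0: "Q.low_generated (\<lambda>q. 0)"
  using Q.low_generated.scale [OF Q.low_generated.one, of 0] by simp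

lemma spanned_\<pi>: "Q.low_generated u \<Longrightarrow> spanned (\<lambda>p. u (\<pi> p))"
  unfolding spanned_def
  using low_generated_0 cocycle_comp [OF Q.low_generated_cocycle \<pi>(1)]
  by (intro conjI exI [of _ u] exI [of _ "\<lambda>q. 0"] P.cohomologous_eq) auto

text \<open>
  The components \<open>u\<close> and \<open>v\<close> of a class of degree \<open>n\<close> have degrees \<open>n\<close> and \<open>n - 1\<close>, which lie between 0 and 3.
  For \<open>n = 3\<close> this rests on the hypothesis about \<open>E\<^sup>3(B)\<close>.
\<close>

lemma spanned_low:
  assumes f: "P.cocycle f" "spread P.pr trivial_proj ({n} \<times> UNIV) f" and n: "n \<in> {1, 2, 3}"
  shows "spanned f"
proof -
  obtain u v where *: "Q.cocycle u" "Q.cocycle v" "P.cohomologous f (\<lambda>p. u (\<pi> p) + v (X p))"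
    "spread Q.pr trivial_proj ({n} \<times> UNIV) u" "spread Q.pr trivial_proj ({n - 1} \<times> UNIV) v"
    using splitting [OF f(1)] f(2) by blast
  have low: "Q.low_generated w" if "Q.cocycle w" "spread Q.pr trivial_proj ({m} \<times> UNIV) w" "m \<in> {0, 1, 2, 3}"
    for w m using that Q.low_generated_degree_0 [of w] Q.low_generated.low [of w m] degree_3 [of w] by auto
  have "Q.low_generated u" "Q.low_generated v"
    using low [OF *(1,4)] low [OF *(2,5)] n by auto
  then show ?thesis unfolding spanned_def using * f by blast
qed

lemma spanned_\<chi>: "spanned \<chi>"
  by (rule spanned_low [OF cocycle_\<chi> spread_mono [OF X(2)], of 1]) auto

text \<open>
  \<open>\<phi>(D) (\<phi>(D) + \<phi>(D) \<chi>) \<subseteq> \<phi>(D) + \<phi>(D) \<chi>\<close>. If \<open>Y\<close> lifts \<open>\<phi>(u2) + \<phi>(v2) \<chi>\<close>, then it is homotopic to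
  \<open>U2 \<circ> \<pi> + V2 \<circ> X\<close> for lifts \<open>U2\<close>, \<open>V2\<close> of \<open>u2\<close>, \<open>v2\<close>, and \<open>v \<circ> U2\<close>, \<open>v \<circ> V2\<close> are products in \<open>D\<close>.
\<close>

lemma spanned_left:
  assumes v: "Q.low_generated v" and Y: "chain_map Y" "spanned (\<lambda>p. \<alpha>' (Y p))"
  shows "spanned (\<lambda>p. v (Y p))"
proof -
  obtain u2 v2 where *: "Q.low_generated u2" "Q.low_generated v2"
    "P.cohomologous (\<lambda>p. \<alpha>' (Y p)) (\<lambda>p. u2 (\<pi> p) + v2 (X p))"
    using Y(2) unfolding spanned_def by blast
  obtain U2 where U2: "QQ.chain_map U2" "\<And>q. \<alpha>' (U2 q) = u2 q"
    using QQ.lift_of_cocycle [OF Q.low_generated_cocycle [OF *(1)]] by blast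
  obtain V2 where V2: "QQ.chain_map V2" "\<And>q. \<alpha>' (V2 q) = v2 q"
    using QQ.lift_of_cocycle [OF Q.low_generated_cocycle [OF *(2)]] by blast
  have cm: "chain_map (\<lambda>p. U2 (\<pi> p) + V2 (X p))"
    by (intro chain_map_plus chain_map_comp_left [OF \<pi>(1) U2(1)] chain_map_comp_left [OF X(1) V2(1)])
  have vc: "Q.cocycle v" using v by (rule Q.low_generated_cocycle)
  then have lin: "trivial_hom \<epsilon>' v" by (rule Q.cocycleD(3))
  have "P.cohomologous (\<lambda>p. v (Y p)) (\<lambda>p. v (U2 (\<pi> p) + V2 (X p)))"
    using *(3) by (intro lift_unique [OF Y(1) cm _ vc]) (simp add: linear_to_add [OF Q.\<alpha>_hom] U2 V2)
  then have "P.cohomologous (\<lambda>p. v (Y p)) (\<lambda>p. v (U2 (\<pi> p)) + v (V2 (X p)))"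
    by (simp add: linear_to_add [OF lin])
  moreover have "Q.low_generated (\<lambda>q. v (U2 q))" "Q.low_generated (\<lambda>q. v (V2 q))"
    using Q.low_generated.product [OF v *(1) U2] Q.low_generated.product [OF v *(2) V2] by blast+
  ultimately show ?thesis
    unfolding spanned_def using cocycle_comp [OF vc Y(1)] by blast
qed

text \<open>
  \<open>(\<phi>(u) + \<phi>(v) \<chi>) b\<close> is in the span as soon as \<open>b\<close> and \<open>\<chi> b\<close> are; \<open>F\<close> is a lift of \<open>b\<close>.
\<close>

lemma spanned_comp:
  assumes f: "spanned f" and F: "PP.chain_map F"
    and span: "spanned (\<lambda>p. \<alpha> (F p))" "spanned (\<lambda>p. \<chi> (F p))"
  shows "spanned (\<lambda>p. f (F p))"
proof -
  obtain u v where *: "Q.low_generated u" "Q.low_generated v"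
    "P.cohomologous f (\<lambda>p. u (\<pi> p) + v (X p))"
    using f unfolding spanned_def by blast
  have "spanned (\<lambda>p. u (\<pi> (F p)) + v (X (F p)))"
    using span
    by (intro spanned_plus spanned_left [OF *(1) chain_map_comp_right [OF F \<pi>(1)]]
      spanned_left [OF *(2) chain_map_comp_right [OF F X(1)]]) (simp_all add: \<pi>)
  then show ?thesis
    by (rule spanned_cohomologous)
      (use PP.cocycle_comp [OF spanned_cocycle [OF f] F] PP.cohomologous_comp [OF *(3) F] in auto)
qed

lemma \<chi>_lift_unique:
  assumes "PP.chain_map F" "PP.chain_map F'" "P.cohomologous (\<lambda>p. \<alpha> (F p)) (\<lambda>p. \<alpha> (F' p))"
    "spanned (\<lambda>p. \<chi> (F' p))"
  shows "spanned (\<lambda>p. \<chi> (F p))"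
  by (rule spanned_cohomologous [OF assms(4) PP.cocycle_comp [OF cocycle_\<chi> assms(1)]
      PP.lift_unique [OF assms(1,2,3) cocycle_\<chi>]])

lemma chain_map_ident: "PP.chain_map (\<lambda>p. p)"
  unfolding semilinear_chain_map_def
  by (auto simp: linear_to_def spread_def intro!: exI [of _ "{0}"])

text \<open>
  \<open>\<chi> \<phi>(u)\<close> is in the span for \<open>u \<in> D\<close>. For generators it has degree 2 or 3. For a product it equals
  \<open>(\<chi> \<phi>(u)) \<phi>(v)\<close>, and \<open>\<chi> \<phi>(u)\<close> is in the span by induction; so the product is as well, by the case of \<open>v\<close>.
\<close>

lemma \<chi>_times_low_generated:
  assumes "Q.low_generated u" "PP.chain_map F" "P.cohomologous (\<lambda>p. \<alpha> (F p)) (\<lambda>p. u (\<pi> p))"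
  shows "spanned (\<lambda>p. \<chi> (F p))"
  using assms
proof (induction arbitrary: F rule: Q.low_generated.induct)
  case one
  then show ?case
    using spanned_\<chi> by (intro \<chi>_lift_unique [OF one(1) chain_map_ident]) (simp_all add: \<pi>)
next
  case (low u n)
  let ?f = "\<lambda>p. u (\<pi> p)"
  have f: "P.cocycle ?f" by (rule cocycle_comp [OF low(1) \<pi>(1)])
  obtain D where D: "finite D" "spread Q.pr trivial_proj D u" "trivial_hom \<epsilon>' u"
    using Q.cocycleD(1) [OF low(1)] by (rule Q.cochainE)
  \<comment> \<open>A lift of pure cohomological degree \<open>n\<close>; an arbitrary lift of the same cocycle is homotopic to it.\<close>
  let ?E = "D \<inter> ({n} \<times> UNIV)"
  have "spread P.pr trivial_proj (?E + {0}) ?f"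
    by (rule spread_comp [OF \<pi>(3) Q.cochain_spread_inter [OF D(3,2) low(3)]])
  then have "spread P.pr trivial_proj ?E ?f" by (rule spread_mono) (auto elim!: set_plus_elim)
  moreover have "trivial_hom \<epsilon> ?f" "\<And>p. ?f (d p) = 0"
    using P.cocycleD [OF f] by blast+
  ultimately obtain F0 where F0: "linear_to lmult F0" "spread P.pr P.pr ?E F0"
    "\<And>p. F0 (d p) = d (F0 p)" "\<And>p. \<alpha> (F0 p) = ?f p"
    using PP.lift_exists [of ?f ?E] by blast
  have cm: "PP.chain_map F0"
    unfolding semilinear_chain_map_def using F0(1,2,3) D(1) by blast
  have "spread P.pr trivial_proj ({(1, 1)} + ?E) (\<lambda>p. \<chi> (F0 p))"
    by (rule spread_comp [OF F0(2) X(2)])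
  then have "spread P.pr trivial_proj ({n + 1} \<times> UNIV) (\<lambda>p. \<chi> (F0 p))"
    by (rule spread_mono) (auto elim!: set_plus_elim)
  then have "spanned (\<lambda>p. \<chi> (F0 p))"
    using low(2) by (intro spanned_low [of _ "n + 1"] PP.cocycle_comp [OF cocycle_\<chi> cm]) auto
  then show ?case using low by (intro \<chi>_lift_unique [OF low.prems(1) cm]) (simp_all add: F0)
next
  case (plus u v)
  obtain F1 where F1: "PP.chain_map F1" "\<And>p. \<alpha> (F1 p) = u (\<pi> p)"
    using PP.lift_of_cocycle [OF cocycle_comp [OF Q.low_generated_cocycle [OF plus.hyps(1)] \<pi>(1)]] by blast
  obtain F2 where F2: "PP.chain_map F2" "\<And>p. \<alpha> (F2 p) = v (\<pi> p)"
    using PP.lift_of_cocycle [OF cocycle_comp [OF Q.low_generated_cocycle [OF plus.hyps(2)] \<pi>(1)]] by blast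
  have "spanned (\<lambda>p. \<chi> (F1 p) + \<chi> (F2 p))"
    by (intro spanned_plus plus.IH(1) [OF F1(1)] plus.IH(2) [OF F2(1)] P.cohomologous_eq F1 F2)
  moreover have "\<chi> (F1 p + F2 p) = \<chi> (F1 p) + \<chi> (F2 p)" for p
    by (rule linear_to_add [OF P.cocycleD(3) [OF cocycle_\<chi>]])
  ultimately show ?case
    using plus.prems
    by (intro \<chi>_lift_unique [OF plus.prems(1) PP.chain_map_plus [OF F1(1) F2(1)]])
      (simp_all add: linear_to_add [OF P.\<alpha>_hom] F1 F2)
next
  case (scale u s)
  obtain F1 where F1: "PP.chain_map F1" "\<And>p. \<alpha> (F1 p) = u (\<pi> p)"
    using PP.lift_of_cocycle [OF cocycle_comp [OF Q.low_generated_cocycle [OF scale.hyps(1)] \<pi>(1)]] by blast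
  have "spanned (\<lambda>p. s * \<chi> (F1 p))"
    by (intro spanned_scale scale.IH [OF F1(1)] P.cohomologous_eq F1)
  moreover have "\<chi> (lmult (\<kappa> s) (F1 p)) = s * \<chi> (F1 p)" for p
    by (simp only: linear_to_act [OF P.cocycleD(3) [OF cocycle_\<chi>]] P.\<epsilon>_\<kappa>)
  ultimately show ?case
    using scale.prems
    by (intro \<chi>_lift_unique [OF scale.prems(1) PP.chain_map_scale [OF F1(1), of s]])
      (simp_all add: linear_to_act [OF P.\<alpha>_hom] F1 P.\<epsilon>_\<kappa>)
next
  case (product u v U)
  obtain F1 where F1: "PP.chain_map F1" "\<And>p. \<alpha> (F1 p) = u (\<pi> p)"
    using PP.lift_of_cocycle [OF cocycle_comp [OF Q.low_generated_cocycle [OF product.hyps(1)] \<pi>(1)]] by blast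
  obtain F2 where F2: "PP.chain_map F2" "\<And>p. \<alpha> (F2 p) = v (\<pi> p)"
    using PP.lift_of_cocycle [OF cocycle_comp [OF Q.low_generated_cocycle [OF product.hyps(2)] \<pi>(1)]] by blast
  have 1: "spanned (\<lambda>p. \<chi> (F1 p))" by (intro product.IH(1) [OF F1(1)] P.cohomologous_eq F1)
  have 2: "spanned (\<lambda>p. \<chi> (F2 p))" by (intro product.IH(2) [OF F2(1)] P.cohomologous_eq F2)
  have "spanned (\<lambda>p. \<chi> (F1 (F2 p)))"
    using 2 spanned_\<pi> [OF product.hyps(2)] by (intro spanned_comp [OF 1 F2(1)]) (simp_all add: F2)
  moreover have 3: "P.cohomologous (\<lambda>p. u (\<pi> (F2 p))) (\<lambda>p. u (U (\<pi> p)))"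
    by (rule lift_unique [OF chain_map_comp_right [OF F2(1) \<pi>(1)] chain_map_comp_left [OF \<pi>(1) product.hyps(3)]
        P.cohomologous_eq Q.low_generated_cocycle [OF product.hyps(1)]]) (simp add: \<pi> F2 product.hyps(4))
  from P.cohomologous_trans [OF product.prems(2) P.cohomologous_sym [OF 3]]
  have "P.cohomologous (\<lambda>p. \<alpha> (F p)) (\<lambda>p. \<alpha> (F1 (F2 p)))"
    by (simp add: F1)
  ultimately show ?case
    by (intro \<chi>_lift_unique [OF product.prems(1) chain_map_comp_self [OF F2(1) F1(1)]])
next
  case (cohomologous u v)
  show ?case
    using cohomologous_comp [OF cohomologous.hyps(3) \<pi>(1)] cohomologous.prems P.cohomologous_trans
    by (intro cohomologous.IH) blast+
qed

text \<open>
  \<open>\<chi> (\<phi>(u) + \<phi>(v) \<chi>) = \<chi> \<phi>(u) + (\<chi> \<phi>(v)) \<chi>\<close>, where \<open>\<chi> \<phi>(v)\<close> is in the span and \<open>\<chi> \<chi>\<close> has degree 2.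
\<close>

lemma \<chi>_times_spanned:
  assumes f: "spanned f" and F: "PP.chain_map F" "P.cohomologous (\<lambda>p. \<alpha> (F p)) f"
  shows "spanned (\<lambda>p. \<chi> (F p))"
proof -
  obtain u v where *: "Q.low_generated u" "Q.low_generated v"
    "P.cohomologous f (\<lambda>p. u (\<pi> p) + v (X p))"
    using f unfolding spanned_def by blast
  have vc: "Q.cocycle v" by (rule Q.low_generated_cocycle [OF *(2)])
  obtain F1 where F1: "PP.chain_map F1" "\<And>p. \<alpha> (F1 p) = u (\<pi> p)"
    using PP.lift_of_cocycle [OF cocycle_comp [OF Q.low_generated_cocycle [OF *(1)] \<pi>(1)]] by blast
  obtain F2 where F2: "PP.chain_map F2" "\<And>p. \<alpha> (F2 p) = v (\<pi> p)"
    using PP.lift_of_cocycle [OF cocycle_comp [OF vc \<pi>(1)]] by blast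
  have "trivial_hom \<epsilon> \<chi>" "\<And>p. \<chi> (d p) = 0" using P.cocycleD [OF cocycle_\<chi>] by blast+
  then obtain X' where X': "PP.semilinear X'" "spread P.pr P.pr {(1, 1)} X'" "\<And>p. X' (d p) = d (X' p)"
    "\<And>p. \<alpha> (X' p) = \<chi> p"
    using PP.lift_exists [OF _ X(2)] by blast
  have cmX': "PP.chain_map X'" unfolding semilinear_chain_map_def using X' by blast
  have "P.cohomologous (\<lambda>p. v (\<pi> (X' p))) (\<lambda>p. v (X p))"
    by (rule lift_unique [OF chain_map_comp_right [OF cmX' \<pi>(1)] X(1) P.cohomologous_eq vc]) (simp add: \<pi> X')
  then have "P.cohomologous (\<lambda>p. u (\<pi> p) + v (\<pi> (X' p))) (\<lambda>p. u (\<pi> p) + v (X p))"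
    by (intro P.cohomologous_plus P.cohomologous_refl)
  from P.cohomologous_trans [OF P.cohomologous_trans [OF F(2) *(3)] P.cohomologous_sym [OF this]]
  have coh: "P.cohomologous (\<lambda>p. \<alpha> (F p)) (\<lambda>p. \<alpha> (F1 p + F2 (X' p)))"
    by (simp add: linear_to_add [OF P.\<alpha>_hom] F1 F2)
  have 1: "spanned (\<lambda>p. \<chi> (F1 p))"
    by (intro \<chi>_times_low_generated [OF *(1) F1(1)] P.cohomologous_eq F1)
  have 2: "spanned (\<lambda>p. \<chi> (F2 p))"
    by (intro \<chi>_times_low_generated [OF *(2) F2(1)] P.cohomologous_eq F2)
  have "spread P.pr trivial_proj ({(1, 1)} + {(1, 1)}) (\<lambda>p. \<chi> (X' p))"
    by (rule spread_comp [OF X'(2) X(2)])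
  then have "spread P.pr trivial_proj ({2} \<times> UNIV) (\<lambda>p. \<chi> (X' p))"
    by (rule spread_mono) (auto elim!: set_plus_elim)
  then have "spanned (\<lambda>p. \<chi> (X' p))"
    by (intro spanned_low [of _ 2] PP.cocycle_comp [OF cocycle_\<chi> cmX']) auto
  then have "spanned (\<lambda>p. \<chi> (F2 (X' p)))"
    using spanned_\<chi> by (intro spanned_comp [OF 2 cmX']) (simp_all add: X')
  then have "spanned (\<lambda>p. \<chi> (F1 p) + \<chi> (F2 (X' p)))" by (rule spanned_plus [OF 1])
  moreover have "\<chi> (F1 p + F2 (X' p)) = \<chi> (F1 p) + \<chi> (F2 (X' p))" for p
    by (rule linear_to_add [OF P.cocycleD(3) [OF cocycle_\<chi>]])
  ultimately show ?thesis
    using coh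
    by (intro \<chi>_lift_unique [OF F(1) PP.chain_map_plus [OF F1(1) chain_map_comp_self [OF cmX' F2(1)]]]) simp_all
qed

lemma low_generated_spanned: "P.low_generated f \<Longrightarrow> spanned f"
proof (induction rule: P.low_generated.induct)
  case one
  then show ?case using spanned_\<pi> [OF Q.low_generated.one] by (simp add: \<pi>)
next
  case (low f n)
  then show ?case by (intro spanned_low [of f n]) auto
next
  case (product u v F)
  have "spanned (\<lambda>p. \<alpha> (F p))" using product by simp
  moreover have "spanned (\<lambda>p. \<chi> (F p))"
    using product by (intro \<chi>_times_spanned [OF product.IH(2) product.hyps(3)] P.cohomologous_eq)
  ultimately show ?case by (rule spanned_comp [OF product.IH(1) product.hyps(3)])
next
  case (cohomologous u v)
  then show ?case using spanned_cohomologous by blast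
qed (simp_all add: spanned_plus spanned_scale)

text \<open>
  \<open>\<phi>(u) = \<phi>(u') + \<phi>(v') \<chi>\<close> with \<open>u', v' \<in> D\<close>, so \<open>u = u'\<close> by the injectivity of the splitting.
\<close>

lemma low_generated_descends:
  assumes "\<And>f. P.cocycle f \<Longrightarrow> P.low_generated f" and u: "Q.cocycle u"
  shows "Q.low_generated u"
proof -
  have "spanned (\<lambda>p. u (\<pi> p))"
    using assms(1) [OF cocycle_comp [OF u \<pi>(1)]] by (rule low_generated_spanned)
  then obtain u' v' where *: "Q.low_generated u'" "Q.low_generated v'"
    "P.cohomologous (\<lambda>p. u (\<pi> p)) (\<lambda>p. u' (\<pi> p) + v' (X p))"
    unfolding spanned_def by blast
  have c: "Q.cocycle u'" "Q.cocycle v'" using * Q.low_generated_cocycle by blast+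
  obtain w where w: "P.cochain w" "\<And>p. u (\<pi> p) - (u' (\<pi> p) + v' (X p)) = w (d p)"
    using *(3) unfolding P.cohomologous_def by blast
  have "P.cohomologous (\<lambda>p. (u (\<pi> p) + - 1 * u' (\<pi> p)) + - 1 * v' (X p)) (\<lambda>p. 0)"
    unfolding P.cohomologous_def using w by (intro exI [of _ w]) (auto simp: algebra_simps)
  then have "Q.cohomologous (\<lambda>q. u q + - 1 * u' q) (\<lambda>q. 0)"
    by (rule injective [OF Q.cocycle_plus [OF u Q.cocycle_scale [OF c(1)]] Q.cocycle_scale [OF c(2)]])
  then have "Q.cohomologous u u'" unfolding Q.cohomologous_def by simp
  then show ?thesis using Q.low_generated.cohomologous [OF *(1) u] by blast
qed

end

section \<open>Graded quotients of tensor algebras\<close>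

text \<open>
  The projections \<open>c\<close> exhibit \<open>A\<close> as the direct sum of its homogeneous components, with scalars in degree 0.
\<close>

definition graded_by :: "('k::field, 'a::ring_1) graded_structure \<Rightarrow> (int \<Rightarrow> 'a \<Rightarrow> 'a) \<Rightarrow> bool"
  where "graded_by A c \<longleftrightarrow> graded_projections c \<and> unital_hom (scal A) \<and>
    (\<forall>x a. scal A x * a = a * scal A x) \<and> (\<forall>m. gr_int A m = range (c m)) \<and>
    range (c 0) = range (scal A)"

context graded_projections
begin

lemma in_range_c: "a \<in> range (c m) \<longleftrightarrow> c m a = a"
  by (metis c_c imageE rangeI)

end

text \<open>
  This turns the augmentation into the projection to degree 0, followed by the inverse of the structure map.
\<close>

lemma plus_part_graded_by:
  assumes "graded_by A c"
  shows "plus_part A = {a. c 0 a = 0}"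
proof -
  interpret graded_projections c using assms by (simp add: graded_by_def)
  have gr: "gr A m = range (c (int m))" for m
    using assms unfolding graded_by_def gr_int_def by (metis nat_int of_nat_0_le_iff)
  show ?thesis
  proof (intro equalityI subsetI CollectI)
    fix a assume "a \<in> plus_part A"
    then obtain M f where M: "finite M" "0 \<notin> M" "\<And>m. m \<in> M \<Longrightarrow> f m \<in> gr A m" "a = (\<Sum>m \<in> M. f m)"
      unfolding plus_part_def by blast
    have "c 0 (f m) = 0" if "m \<in> M" for m
    proof -
      have "c (int m) (f m) = f m" "m \<noteq> 0"
        using M(2) M(3) [OF that] that by (auto simp: gr in_range_c intro: gr_zeroI)
      then show ?thesis using c_c [of 0 "int m" "f m"] by simp
    qed
    then show "c 0 a = 0" by (simp add: M(4) c_sum)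
  next
    fix a assume "a \<in> {a. c 0 a = 0}"
    then have a: "c 0 a = 0" by simp
    let ?S = "{m. c m a \<noteq> 0}"
    have S: "m > 0" if "m \<in> ?S" for m
      using that a c_negative [of m a] by (cases m "0 :: int" rule: linorder_cases) auto
    show "a \<in> plus_part A"
      unfolding plus_part_def
    proof (intro CollectI exI conjI)
      show "finite (nat ` ?S)" by (simp add: finite_c)
      show "0 \<notin> nat ` ?S" using S by force
      show "\<forall>m \<in> nat ` ?S. c (int m) a \<in> gr A m" by (simp add: gr)
      have "(\<Sum>m \<in> nat ` ?S. c (int m) a) = (\<Sum>m \<in> ?S. c (int (nat m)) a)"
      proof (subst sum.reindex)
        show "inj_on nat ?S"
        proof (rule inj_onI)
          fix i j assume "i \<in> ?S" "j \<in> ?S" "nat i = nat j"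
          then show "i = j" using S [of i] S [of j] by linarith
        qed
      qed simp
      also have "\<dots> = (\<Sum>m \<in> ?S. c m a)" using S by (intro sum.cong) (auto dest: less_imp_le)
      finally show "a = (\<Sum>m \<in> nat ` ?S. c (int m) a)" by (simp add: sum_c)
    qed
  qed
qed

text \<open>
  The target is not the zero ring, so the image of a nonzero scalar is invertible and nonzero.
\<close>

lemma unital_hom_field_injective:
  assumes "unital_hom (s :: 'k::field \<Rightarrow> 'a::ring_1)" "s x = s y"
  shows "x = y"
proof (rule ccontr)
  assume "x \<noteq> y"
  then have "s ((x - y) * inverse (x - y)) = 1" using unital_homD(1) [OF assms(1)] by simp
  then have "s (x - y) * s (inverse (x - y)) = 1" by (simp only: unital_homD(3) [OF assms(1)])
  then show False using assms by (simp add: unital_homD(6))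
qed

lemma connected_algebra_graded_by:
  assumes A: "graded_by A c"
  shows "connected_algebra c (scal A) (augmentation A)"
proof -
  interpret graded_projections c using A by (simp add: graded_by_def)
  have s: "unital_hom (scal A)" "\<And>x a. scal A x * a = a * scal A x" "range (c 0) = range (scal A)"
    using A by (auto simp: graded_by_def)
  have scal: "c 0 (scal A x) = scal A x" for x using s(3) in_range_c by blast
  have diff: "c 0 (a - b) = c 0 a - c 0 b" for a b
    using c_add [of 0 "a - b" b] by (simp add: algebra_simps)
  have aug: "augmentation A a = x" if "c 0 a = scal A x" for a x
    unfolding augmentation_def plus_part_graded_by [OF A]
    using that by (intro the_equality) (auto simp: diff scal intro: unital_hom_field_injective [OF s(1)])
  have aug': "scal A (augmentation A a) = c 0 a" for a
  proof -
    obtain x where "c 0 a = scal A x" using s(3) by blast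
    then show ?thesis using aug by simp
  qed
  have c0: "c 0 (a * b) = c 0 a * c 0 b" for a b
  proof -
    have "c 0 (a * b) = (\<Sum>i | c i a \<noteq> 0. if i = 0 then c 0 a * c 0 b else 0)"
      unfolding c_times
    proof (rule sum.cong)
      fix i assume "i \<in> {i. c i a \<noteq> 0}"
      then have "i \<ge> 0" using c_negative [of i a] by (cases "i < 0") auto
      then show "c i a * c (0 - i) b = (if i = 0 then c 0 a * c 0 b else 0)"
        using c_negative [of "- i" b] by auto
    qed simp
    also have "\<dots> = c 0 a * c 0 b" by (cases "c 0 a = 0") (simp_all add: finite_c)
    finally show ?thesis .
  qed
  show ?thesis
  proof
    show "unital_hom (augmentation A)"
      unfolding unital_hom_def
      using scal [of 1] by (auto intro!: aug simp: aug' unital_homD [OF s(1)] c_add c0)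
    show "augmentation A (scal A x) = x" for x by (rule aug [OF scal])
  qed (rule aug' s(2))+
qed

text \<open>
  Projections pass to the quotient by a homogeneous ideal; homogeneity of the kernel makes them well defined.
\<close>

lemma graded_by_image:
  assumes A: "graded_by A c" and h: "unital_hom h" "surj h"
    and kernel: "\<And>m a. h a = 0 \<Longrightarrow> h (c m a) = 0"
  obtains c' where "graded_by (image_structure h A) c'" "\<And>m a. h (c m a) = c' m (h a)"
proof -
  interpret graded_projections c using A by (simp add: graded_by_def)
  note hom = unital_homD [OF h(1)]
  define c' where "c' m b = h (c m (inv h b))" for m b
  have c': "h (c m a) = c' m (h a)" for m a
  proof -
    have "h (c m (a - inv h (h a))) = 0" by (rule kernel) (simp add: hom surj_f_inv_f [OF h(2)])
    moreover have "c m (a - inv h (h a)) = c m a - c m (inv h (h a))"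
      using c_add [of m "a - inv h (h a)" "inv h (h a)"] by (simp add: algebra_simps)
    ultimately show ?thesis by (simp add: hom c'_def)
  qed
  have lift: "\<exists>a. b = h a" for b using surjD [OF h(2)] by blast
  have "graded_projections c'"
  proof
    show "c' m (x + y) = c' m x + c' m y" for m x y
      using lift [of x] lift [of y] by (auto simp: c_add hom simp flip: c' hom(2))
    show "c' m (c' n x) = (if m = n then c' n x else 0)" for m n x
      using lift [of x] by (auto simp: c_c hom simp flip: c')
    show "finite {m. c' m x \<noteq> 0}" for x
    proof -
      obtain a where "x = h a" using lift by blast
      then have "{m. c' m x \<noteq> 0} \<subseteq> {m. c m a \<noteq> 0}" by (auto simp: hom simp flip: c')
      then show ?thesis using finite_c finite_subset by blast
    qed
    show "(\<Sum>m | c' m x \<noteq> 0. c' m x) = x" for x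
    proof -
      obtain a where a: "x = h a" using lift by blast
      have "(\<Sum>m | c' m x \<noteq> 0. c' m x) = (\<Sum>m | c m a \<noteq> 0. c' m x)"
        by (rule sum.mono_neutral_left) (auto simp: finite_c a hom simp flip: c')
      also have "\<dots> = h (\<Sum>m | c m a \<noteq> 0. c m a)" by (simp add: a hom c')
      finally show ?thesis by (simp add: sum_c a)
    qed
    show "c' m (c' i x * y) = c' i x * c' (m - i) y" for m i x y
      using lift [of x] lift [of y] by (auto simp: c_mult simp flip: c' hom(3))
    show "c' m x = 0" if "m < 0" for m x
      using lift [of x] that by (auto simp: c_negative hom simp flip: c')
    show "c' m 1 = 0" if "m \<noteq> 0" for m
      using c' [of m 1] that by (simp add: hom c_one)
  qed
  moreover have "gr_int (image_structure h A) m = range (c' m)" for m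
  proof -
    have "gr_int (image_structure h A) m = h ` gr_int A m"
      by (simp add: gr_int_def image_structure_def hom)
    also have "\<dots> = (\<lambda>a. h (c m a)) ` UNIV" using A by (auto simp: graded_by_def)
    also have "\<dots> = c' m ` range h" by (auto simp: c')
    finally show ?thesis by (simp add: h)
  qed
  moreover have "range (c' 0) = range (\<lambda>x. h (scal A x))"
  proof -
    have "range (c' 0) = c' 0 ` range h" by (simp add: h)
    also have "\<dots> = h ` range (c 0)" by (simp add: image_image c')
    finally show ?thesis using A by (auto simp: graded_by_def)
  qed
  moreover have "unital_hom (\<lambda>x. h (scal A x))"
  proof -
    have s: "unital_hom (scal A)" using A by (simp add: graded_by_def)
    show ?thesis by (simp add: unital_hom_def [of "\<lambda>x. h (scal A x)"] unital_homD [OF s] hom)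
  qed
  moreover have "h (scal A x) * b = b * h (scal A x)" for x b
  proof -
    obtain a where "b = h a" using lift by blast
    moreover have "scal A x * a = a * scal A x" using A by (simp add: graded_by_def)
    ultimately show ?thesis by (simp flip: hom(3))
  qed
  ultimately show thesis
    using c' by (intro that [of c']) (simp_all add: graded_by_def image_structure_def)
qed

definition word_part :: "int \<Rightarrow> ('v, 'k::zero) tensor_algebra \<Rightarrow> ('v, 'k) tensor_algebra"
  where "word_part m = Poly_Mapping.mapp (\<lambda>w a. if int (length (letters w)) = m then a else 0)"

lemma lookup_word_part:
  "Poly_Mapping.lookup (word_part m t) w =
    (if int (length (letters w)) = m then Poly_Mapping.lookup t w else 0)"
  by (simp add: word_part_def lookup_mapp when_def in_keys_iff)

lemma word_part_add: "word_part m (s + t) = word_part m s + word_part m (t :: ('v, 'k::field) tensor_algebra)"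
  by (rule poly_mapping_eqI) (simp add: lookup_word_part lookup_add)

lemma word_part_single:
  "word_part m (Poly_Mapping.single w a) = (if int (length (letters w)) = m then Poly_Mapping.single w a else 0)"
  by (rule poly_mapping_eqI) (auto simp: lookup_word_part lookup_single when_def)

lemma length_letters_plus: "length (letters (u + w)) = length (letters u) + length (letters w)"
  by (simp add: plus_word_def)

lemma tensor_algebra_induct [case_names zero single plus]:
  fixes t :: "('v, 'k::field) tensor_algebra"
  assumes "P 0" "\<And>w a. P (Poly_Mapping.single w a)" "\<And>s t. P s \<Longrightarrow> P t \<Longrightarrow> P (s + t)"
  shows "P t"
proof -
  have "P (\<Sum>w \<in> S. Poly_Mapping.single w (Poly_Mapping.lookup t w))" for S
    by (induction S rule: infinite_finite_induct) (use assms in auto)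
  moreover have single: "lmult a (unit_vector w) = Poly_Mapping.single w a" for a :: 'k and w :: "'v word"
    by (rule poly_mapping_eqI) (simp add: lookup_single when_def)
  have "(\<Sum>w \<in> Poly_Mapping.keys t. Poly_Mapping.single w (Poly_Mapping.lookup t w)) = t"
    by (rule trans [OF _ unit_vector_expansion [of t, symmetric]]) (simp add: single)
  ultimately show ?thesis by metis
qed

lemma graded_by_tensor: "graded_by (tensor_structure :: ('k::field, ('v, 'k) tensor_algebra) graded_structure) word_part"
proof -
  have "graded_projections (word_part :: int \<Rightarrow> ('v, 'k) tensor_algebra \<Rightarrow> _)"
  proof
    show "word_part m (s + t) = word_part m s + word_part m t" for m and s t :: "('v, 'k) tensor_algebra"
      by (rule word_part_add)
    show "word_part m (word_part n t) = (if m = n then word_part n t else 0)"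
      for m n and t :: "('v, 'k) tensor_algebra"
      by (rule poly_mapping_eqI) (simp add: lookup_word_part)
    have sub: "{m. word_part m t \<noteq> 0} \<subseteq> (\<lambda>w. int (length (letters w))) ` Poly_Mapping.keys t"
      for t :: "('v, 'k) tensor_algebra"
    proof
      fix m assume "m \<in> {m. word_part m t \<noteq> 0}"
      then obtain w where "Poly_Mapping.lookup (word_part m t) w \<noteq> 0"
        by (metis (mono_tags) lookup_zero mem_Collect_eq poly_mapping_eqI)
      then show "m \<in> (\<lambda>w. int (length (letters w))) ` Poly_Mapping.keys t"
        by (auto simp: lookup_word_part in_keys_iff split: if_splits)
    qed
    show fin: "finite {m. word_part m t \<noteq> 0}" for t :: "('v, 'k) tensor_algebra"
      by (rule finite_subset [OF sub]) simp
    show "(\<Sum>m | word_part m t \<noteq> 0. word_part m t) = t" for t :: "('v, 'k) tensor_algebra"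
    proof (rule poly_mapping_eqI)
      fix w :: "'v word"
      let ?n = "int (length (letters w))"
      have "Poly_Mapping.lookup (\<Sum>m | word_part m t \<noteq> 0. word_part m t) w =
          (\<Sum>m | word_part m t \<noteq> 0. if m = ?n then Poly_Mapping.lookup t w else 0)"
        unfolding lookup_sum by (rule sum.cong) (auto simp: lookup_word_part)
      also have "\<dots> = (if word_part ?n t \<noteq> 0 then Poly_Mapping.lookup t w else 0)"
        by (simp add: fin)
      also have "\<dots> = Poly_Mapping.lookup t w"
        using lookup_word_part [of ?n t w] by auto
      finally show "Poly_Mapping.lookup (\<Sum>m | word_part m t \<noteq> 0. word_part m t) w = Poly_Mapping.lookup t w" .
    qed
    show "word_part m (word_part i s * t) = word_part i s * word_part (m - i) t"
      for m i and s t :: "('v, 'k) tensor_algebra"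
    proof (induction s rule: tensor_algebra_induct)
      case zero
      have "word_part m 0 = (0 :: ('v, 'k) tensor_algebra)" for m
        by (rule poly_mapping_eqI) (simp add: lookup_word_part)
      then show ?case by simp
    next
      case (single u a)
      have z: "word_part m 0 = (0 :: ('v, 'k) tensor_algebra)" for m
        by (rule poly_mapping_eqI) (simp add: lookup_word_part)
      show ?case
      proof (induction t rule: tensor_algebra_induct)
        case (single w b)
        show ?case by (auto simp: word_part_single mult_single length_letters_plus z)
      qed (simp_all add: z word_part_add algebra_simps)
    qed (simp add: word_part_add algebra_simps)
    show "word_part m t = 0" if "m < 0" for m and t :: "('v, 'k) tensor_algebra"
      using that by (intro poly_mapping_eqI) (simp add: lookup_word_part)
    show "word_part m 1 = (0 :: ('v, 'k) tensor_algebra)" if "m \<noteq> 0" for m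
      using that word_part_single [of m 0 "1 :: 'k"] by (auto simp: zero_word_def simp flip: single_one)
  qed
  moreover have "unital_hom (\<lambda>x. Poly_Mapping.single (0 :: 'v word) (x :: 'k))"
    by (simp add: unital_hom_def single_add mult_single)
  moreover have "Poly_Mapping.single 0 x * t = t * Poly_Mapping.single 0 x" for x and t :: "('v, 'k) tensor_algebra"
    by (induction t rule: tensor_algebra_induct) (simp_all add: mult_single algebra_simps)
  moreover have "gr_int (tensor_structure :: ('k, ('v, 'k) tensor_algebra) graded_structure) m = range (word_part m)" for m
  proof -
    interpret graded_projections "word_part :: int \<Rightarrow> ('v, 'k) tensor_algebra \<Rightarrow> _" by fact
    have "t \<in> gr_int tensor_structure m \<longleftrightarrow> word_part m t = t" for t :: "('v, 'k) tensor_algebra"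
    proof (cases "m \<ge> 0")
      case True
      have "word_part m t = t \<longleftrightarrow> (\<forall>w. int (length (letters w)) = m \<or> Poly_Mapping.lookup t w = 0)"
        by (auto simp: poly_mapping_eq_iff fun_eq_iff lookup_word_part)
      then show ?thesis using True
        by (auto simp: gr_int_def tensor_structure_def tensor_power_def in_keys_iff)
    next
      case False
      then show ?thesis by (auto simp: gr_int_def c_negative)
    qed
    then show ?thesis using in_range_c by blast
  qed
  moreover have "range (word_part 0) = range (\<lambda>x. Poly_Mapping.single (0 :: 'v word) (x :: 'k))"
  proof (intro equalityI subsetI)
    fix t assume "t \<in> range (\<lambda>x. Poly_Mapping.single (0 :: 'v word) (x :: 'k))"
    then obtain x where "t = Poly_Mapping.single 0 x" by blast
    then have "t = word_part 0 t" by (simp add: word_part_single zero_word_def)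
    then show "t \<in> range (word_part 0)" by blast
  next
    fix t :: "('v, 'k) tensor_algebra" assume "t \<in> range (word_part 0)"
    then obtain s where s: "t = word_part 0 s" by blast
    have "t = Poly_Mapping.single 0 (Poly_Mapping.lookup s 0)"
    proof (rule poly_mapping_eqI)
      fix w :: "'v word"
      show "Poly_Mapping.lookup t w = Poly_Mapping.lookup (Poly_Mapping.single 0 (Poly_Mapping.lookup s 0)) w"
        by (cases w) (auto simp: s lookup_word_part lookup_single when_def zero_word_def)
    qed
    then show "t \<in> range (\<lambda>x. Poly_Mapping.single 0 x)" by blast
  qed
  ultimately show ?thesis by (simp add: graded_by_def tensor_structure_def)
qed

text \<open>
  A component of \<open>a * r * b\<close> is a sum of products of \<open>r\<close> with components of \<open>a\<close> and \<open>b\<close>.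
\<close>

lemma two_sided_ideal_homogeneous:
  assumes c: "graded_projections c" and R: "\<And>r. r \<in> R \<Longrightarrow> \<exists>j. c j r = r"
    and x: "x \<in> two_sided_ideal R"
  shows "c m x \<in> two_sided_ideal R"
  using x
proof induction
  case zero
  interpret graded_projections c by (rule c)
  show ?case by (simp add: two_sided_ideal.zero)
next
  case (generator r a b)
  interpret graded_projections c by (rule c)
  obtain j where j: "c j r = r" using R generator by blast
  have "c m (a * r * b) = (\<Sum>i | c i a \<noteq> 0. c i a * c (m - i) (c j r * b))"
    by (simp add: mult.assoc c_times j)
  also have "\<dots> = (\<Sum>i | c i a \<noteq> 0. c i a * r * c (m - i - j) b)"
    by (simp only: c_mult) (simp add: j mult.assoc)
  also have "\<dots> \<in> two_sided_ideal R"
  proof -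
    have "(\<Sum>i \<in> S. c i a * r * c (m - i - j) b) \<in> two_sided_ideal R" for S
      by (induction S rule: infinite_finite_induct) (auto intro: two_sided_ideal.intros generator)
    then show ?thesis .
  qed
  finally show ?case .
next
  case (add x y)
  interpret graded_projections c by (rule c)
  show ?case using add.IH by (simp add: c_add two_sided_ideal.add)
qed

section \<open>Ext classes and their representing cocycles\<close>

definition bidegree :: "('x, 'a, 'k) augmented_complex \<Rightarrow> 'x \<Rightarrow> int \<times> int"
  where "bidegree P x = (int (hdeg P x), ideg P x)"

lemma bicomponent_proj:
  assumes A: "graded_by A c"
  shows "p \<in> bicomponent A P n j \<longleftrightarrow> proj c (bidegree P) (n, j) p = p"
proof -
  interpret graded_projections c using A by (simp add: graded_by_def)
  have gr: "a \<in> gr_int A m \<longleftrightarrow> c m a = a" for a m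
    using A in_range_c by (simp add: graded_by_def)
  show ?thesis
    unfolding bicomponent_def component_def gr poly_mapping_eq_iff [of "proj _ _ _ _"] fun_eq_iff
      mem_Collect_eq lookup_proj in_keys_iff bidegree_def Ball_def fst_conv snd_conv
    by (metis c_zero)
qed

text \<open>
  An additive map that vanishes on all bicomponents outside \<open>D\<close> depends only on the components in \<open>D\<close>.
\<close>

lemma vanishes_off_spread:
  assumes A: "graded_by A c" and f: "\<And>p q. f (p + q) = f p + f q"
  shows "vanishes_off A P D f \<longleftrightarrow> spread (proj c (bidegree P)) trivial_proj D f"
proof -
  interpret graded_projections c using A by (simp add: graded_by_def)
  let ?pr = "proj c (bidegree P)"
  have f0: "f 0 = 0" using f [of 0 0] by (simp only: add_0_right add_cancel_right_right)
  have f_sum: "f (sum g S) = (\<Sum>s \<in> S. f (g s))" for g :: "int \<times> int \<Rightarrow> _" and S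
    by (induction S rule: infinite_finite_induct) (simp_all add: f0 f)
  show ?thesis
    unfolding spread_trivial vanishes_off_def bicomponent_proj [OF A]
  proof (intro iffI allI impI ballI)
    fix p assume *: "\<forall>n j. (n, j) \<notin> D \<longrightarrow> (\<forall>p \<in> bicomponent A P n j. f p = 0)"
      and p: "\<forall>e \<in> D. ?pr e p = 0"
    have "f (?pr e p) = 0" for e
    proof (cases "e \<in> D")
      case False
      then show ?thesis
        using * [rule_format, of "fst e" "snd e" "?pr e p"] by (simp add: bicomponent_proj [OF A] proj_proj)
    qed (simp add: p f0)
    then have "f (\<Sum>e | ?pr e p \<noteq> 0. ?pr e p) = 0" by (simp add: f_sum)
    then show "f p = 0" by (simp add: sum_proj)
  next
    fix n j p
    assume *: "\<forall>p. (\<forall>e \<in> D. ?pr e p = 0) \<longrightarrow> f p = 0" and nj: "(n, j) \<notin> D" and "p \<in> bicomponent A P n j"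
    then have "?pr (n, j) p = p" by (simp add: bicomponent_proj [OF A])
    then have "\<forall>e \<in> D. ?pr e p = 0" using nj proj_proj [of "bidegree P" _ "(n, j)" p] by metis
    then show "f p = 0" using * by blast
  qed
qed

text \<open>
  Exactness is given in each homological degree separately; it extends to all elements by decomposing them
  into bihomogeneous components, on which \<open>bd P\<close> and \<open>aug P\<close> act one at a time.
\<close>

lemma free_resolution_of_graded:
  assumes A: "graded_by A c" and P: "graded_free_resolution A P"
  shows "free_resolution c (scal A) (augmentation A) (bidegree P) (bd P) (aug P)"
proof -
  interpret connected_algebra c "scal A" "augmentation A" by (rule connected_algebra_graded_by [OF A])
  let ?pr = "proj c (bidegree P)"
  have bd: "linear_to lmult (bd P)"
    and bd_bicomponent: "\<And>n j. bd P ` bicomponent A P n j \<subseteq> bicomponent A P (n - 1) j"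
    and aug: "linear_to (\<lambda>a y. augmentation A a * y) (aug P)"
    and van: "vanishes_off A P {(0, 0)} (aug P)" and surj: "aug P ` component P 0 = UNIV"
    and ex0: "{p \<in> component P 0. aug P p = 0} = bd P ` component P 1"
    and ex: "\<And>n. 1 \<le> n \<Longrightarrow> {p \<in> component P n. bd P p = 0} = bd P ` component P (n + 1)"
    using P unfolding graded_free_resolution_def module_endo_def hom_to_trivial_def linear_to_def
    by (elim conjE; simp)+
  have aug_spread: "spread ?pr trivial_proj {0} (aug P)"
    using van vanishes_off_spread [OF A linear_to_add [OF aug]] by (simp add: zero_prod_def)
  have bicomponent: "?pr e p \<in> bicomponent A P (fst e) (snd e)" for e p
    by (simp add: bicomponent_proj [OF A] proj_proj)
  have bd_proj: "?pr e' (bd P (?pr e p)) = (if e' = e - (1, 0) then bd P (?pr e p) else 0)" for e e' p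
  proof -
    have "bd P (?pr e p) \<in> bicomponent A P (fst e - 1) (snd e)"
      using bd_bicomponent bicomponent by blast
    then have "?pr (e - (1, 0)) (bd P (?pr e p)) = bd P (?pr e p)"
      by (simp add: bicomponent_proj [OF A] minus_prod_def)
    then show ?thesis by (metis proj_proj)
  qed
  have spread_bd: "spread ?pr ?pr {(1, 0)} (bd P)"
    unfolding spread_def
  proof (intro allI impI)
    fix e p assume *: "\<forall>x \<in> {(1, 0)}. ?pr (e + x) p = 0"
    have "?pr e (bd P p) = ?pr e (bd P (\<Sum>e | ?pr e p \<noteq> 0. ?pr e p))" by (simp add: sum_proj)
    also have "\<dots> = (\<Sum>e' | ?pr e' p \<noteq> 0. ?pr e (bd P (?pr e' p)))"
      by (simp add: linear_to_sum [OF bd] proj_sum)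
    also have "\<dots> = 0"
    proof (rule sum.neutral, rule ballI)
      fix e' assume "e' \<in> {e'. ?pr e' p \<noteq> 0}"
      then have "e \<noteq> e' - (1, 0)" using * by auto
      then show "?pr e (bd P (?pr e' p)) = 0" by (simp add: bd_proj)
    qed
    finally show "?pr e (bd P p) = 0" .
  qed
  interpret D: graded_differential c "bidegree P" "bd P"
    by unfold_locales (rule bd spread_bd)+
  have comp: "?pr e p \<in> component P (fst e)" for e p
    using bicomponent [of e p] by (simp add: bicomponent_def)
  have neg: "?pr e p = 0" if "fst e < 0" for e p
    using that by (intro poly_mapping_eqI) (simp add: lookup_proj bidegree_def)
  have unit: "unit_vector k \<in> component P (int (hdeg P k))" for k
    by (simp add: component_def)
  have aug_bd: "aug P (bd P p) = 0" for p
  proof -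
    have "?pr 0 (bd P p) = bd P (?pr (1, 0) p)"
      using D.d_proj [of "(1, 0)" p] by (simp add: zero_prod_def)
    moreover have "?pr (1, 0) p \<in> component P 1" using comp [of "(1, 0)" p] by simp
    ultimately have "?pr 0 (bd P p) \<in> bd P ` component P 1" by simp
    then have "aug P (?pr 0 (bd P p)) = 0" using ex0 by blast
    moreover have "aug P (bd P p - ?pr 0 (bd P p)) = 0"
    proof -
      have "?pr 0 (bd P p - ?pr 0 (bd P p)) = 0"
        using proj_add [of "bidegree P" 0 "bd P p - ?pr 0 (bd P p)" "?pr 0 (bd P p)"] by (simp add: proj_proj)
      then show ?thesis using aug_spread by (simp add: spread_trivial)
    qed
    ultimately show ?thesis by (simp add: linear_to_diff [OF aug])
  qed
  have bd_bd_component: "bd P (bd P p) = 0" if p: "p \<in> component P n" and n: "n \<ge> 2" for p n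
  proof -
    have "bd P p \<in> bd P ` component P ((n - 1) + 1)" using p by simp
    also have "\<dots> = {p \<in> component P (n - 1). bd P p = 0}" using ex [of "n - 1"] n by simp
    finally show ?thesis by simp
  qed
  have bd_bd: "bd P (bd P p) = 0" for p
  proof -
    have "bd P (bd P (?pr e p)) = 0" for e
    proof (cases "fst e \<ge> 2")
      case True then show ?thesis using bd_bd_component [OF comp] by simp
    next
      case False
      then show ?thesis
        by (simp add: D.d_proj neg)
    qed
    then have "bd P (bd P (\<Sum>e | ?pr e p \<noteq> 0. ?pr e p)) = 0"
      by (simp add: linear_to_sum [OF bd])
    then show ?thesis by (simp add: sum_proj)
  qed
  show ?thesis
  proof unfold_locales
    show "\<exists>p'. bd P p' = p" if p: "bd P p = 0" "aug P p = 0" for p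
    proof -
      have "\<exists>q. bd P q = ?pr e p" for e
      proof -
        have b: "bd P (?pr e p) = 0" using D.d_proj [of e p] p by simp
        show ?thesis
        proof (cases "fst e" "0 :: int" rule: linorder_cases)
          case less
          then show ?thesis using neg linear_to_zero [OF bd] by metis
        next
          case equal
          have "aug P (?pr e p) = 0"
          proof (cases "e = 0")
            case True
            have "?pr 0 (p - ?pr 0 p) = 0"
              using proj_add [of "bidegree P" 0 "p - ?pr 0 p" "?pr 0 p"] by (simp add: proj_proj)
            then have "aug P (p - ?pr 0 p) = 0" using aug_spread by (simp add: spread_trivial)
            then show ?thesis using p True by (simp add: linear_to_diff [OF aug])
          next
            case False
            then show ?thesis using aug_spread by (simp add: spread_trivial proj_proj)
          qed
          then have "?pr e p \<in> bd P ` component P 1" using ex0 comp [of e p] equal by auto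
          then show ?thesis by (metis imageE)
        next
          case greater
          then have "?pr e p \<in> bd P ` component P (fst e + 1)" using ex [of "fst e"] comp [of e p] b by auto
          then show ?thesis by (metis imageE)
        qed
      qed
      then obtain q where "\<And>e. bd P (q e) = ?pr e p" by metis
      then have "bd P (\<Sum>e | ?pr e p \<noteq> 0. q e) = p" by (simp add: linear_to_sum [OF bd] sum_proj)
      then show ?thesis ..
    qed
    show "\<exists>p. aug P p = 1" using surj by (metis UNIV_I imageE)
  qed (simp_all add: bidegree_def aug aug_spread aug_bd bd_bd)
qed

locale graded_resolution =
  fixes A :: "('k::field, 'a::ring_1) graded_structure" and c
    and P :: "('x, 'a, 'k) augmented_complex"
  assumes A: "graded_by A c" and P: "graded_free_resolution A P"
begin

sublocale free_resolution c "scal A" "augmentation A" "bidegree P" "bd P" "aug P"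
  by (rule free_resolution_of_graded [OF A P])

sublocale self: change_of_rings c "scal A" "augmentation A" "bidegree P" "bd P" "aug P"
    c "scal A" "augmentation A" "bidegree P" "bd P" "aug P" "\<lambda>a. a"
  by (rule change_of_rings_self)

lemma cochains_iff: "f \<in> cochains A P \<longleftrightarrow> cochain f"
proof -
  have "hom_to_trivial A f \<longleftrightarrow> trivial_hom (augmentation A) f"
    by (simp add: hom_to_trivial_def linear_to_def)
  moreover have "vanishes_off A P D f \<longleftrightarrow> spread pr trivial_proj D f"
    if "trivial_hom (augmentation A) f" for D
    by (rule vanishes_off_spread [OF A linear_to_add [OF that]])
  ultimately show ?thesis unfolding cochains_def cochain_def by auto
qed

lemma cocycles_iff: "f \<in> cocycles A P \<longleftrightarrow> cocycle f"
  by (simp add: cocycles_def cocycle_def cochains_iff)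

lemma coboundaries_iff: "(\<lambda>p. f p - f' p) \<in> coboundaries A P \<longleftrightarrow> cohomologous f f'"
  unfolding coboundaries_def cohomologous_def by (auto simp: cochains_iff fun_eq_iff)

lemma ext_class_eq: "ext_class A P f = {f'. cocycle f' \<and> cohomologous f' f}"
  unfolding ext_class_def by (simp add: coboundaries_iff cocycles_iff)

lemma ext_class_self: "cocycle f \<Longrightarrow> f \<in> ext_class A P f"
  by (simp add: ext_class_eq cohomologous_refl)

lemma ext_class_eqI: "cohomologous f f' \<Longrightarrow> ext_class A P f = ext_class A P f'"
  unfolding ext_class_eq using cohomologous_trans cohomologous_sym by blast

lemma ext_class_eqD: "cocycle f \<Longrightarrow> ext_class A P f = ext_class A P f' \<Longrightarrow> cohomologous f f'"
  using ext_class_self by (auto simp: ext_class_eq)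

text \<open>
  The operations on classes are unions over all representatives; if every representative yields the same class,
  so does the union.
\<close>

lemma UN_ext_class:
  assumes f: "cocycle f" and G: "\<And>f'. cocycle f' \<Longrightarrow> cohomologous f' f \<Longrightarrow> G f' = C"
  shows "(\<Union>f' \<in> ext_class A P f. G f') = C"
proof -
  have "(\<Union>f' \<in> ext_class A P f. G f') = (\<Union>f' \<in> ext_class A P f. C)"
    using G by (auto simp: ext_class_eq)
  then show ?thesis using ext_class_self [OF f] by auto
qed

lemma ext_add_class:
  assumes "cocycle f" "cocycle f'"
  shows "ext_add A P (ext_class A P f) (ext_class A P f') = ext_class A P (\<lambda>p. f p + f' p)"
  unfolding ext_add_def
  by (intro UN_ext_class assms ext_class_eqI cohomologous_plus)

lemma ext_scale_class:
  assumes "cocycle f"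
  shows "ext_scale A P s (ext_class A P f) = ext_class A P (\<lambda>p. s * f p)"
  unfolding ext_scale_def
  by (intro UN_ext_class assms ext_class_eqI cohomologous_scale)

text \<open>
  The bihomogeneous summands of \<open>F p\<close>, for \<open>p\<close> of bidegree \<open>(i, j)\<close>, are its projections to \<open>(i, j) - D\<close>.
\<close>

lemma graded_endo_iff: "graded_endo A P F \<longleftrightarrow> linear_to lmult F \<and> (\<exists>D. finite D \<and> spread pr pr D F)"
proof -
  have lin: "module_endo F \<longleftrightarrow> linear_to lmult F" by (simp add: module_endo_def linear_to_def)
  have "(\<forall>i j. \<forall>p \<in> bicomponent A P i j.
      \<exists>q. (\<forall>(n, m) \<in> D. q (n, m) \<in> bicomponent A P (i - n) (j - m)) \<and> F p = (\<Sum>e \<in> D. q e)) \<longleftrightarrow>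
      spread pr pr D F" (is "?l \<longleftrightarrow> ?r") if F: "linear_to lmult F" and D: "finite D" for D
  proof
    assume l: ?l
    have zero: "pr e (F (pr e' p)) = 0" if "e' - e \<notin> D" for e e' p
    proof -
      have "pr e' p \<in> bicomponent A P (fst e') (snd e')"
        by (simp add: bicomponent_proj [OF A] proj_proj)
      then obtain q where q: "\<And>n m. (n, m) \<in> D \<Longrightarrow> q (n, m) \<in> bicomponent A P (fst e' - n) (snd e' - m)"
        "F (pr e' p) = (\<Sum>e \<in> D. q e)" using l by blast
      have "pr e (q x) = 0" if "x \<in> D" for x
      proof -
        have "pr (e' - x) (q x) = q x"
          using q(1) [of "fst x" "snd x"] that by (simp add: bicomponent_proj [OF A] minus_prod_def)
        moreover have "e \<noteq> e' - x" using \<open>e' - e \<notin> D\<close> that by auto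
        ultimately show ?thesis using proj_proj by metis
      qed
      then show ?thesis by (simp add: q(2) proj_sum)
    qed
    show ?r
      unfolding spread_def
    proof (intro allI impI)
      fix e p assume *: "\<forall>x \<in> D. pr (e + x) p = 0"
      have "pr e (F (pr e' p)) = 0" for e'
      proof (cases "e' - e \<in> D")
        case True
        then have "pr e' p = 0" using * by force
        then show ?thesis by (simp add: linear_to_zero [OF F])
      qed (rule zero)
      then have "pr e (F (\<Sum>e' | pr e' p \<noteq> 0. pr e' p)) = 0"
        by (simp add: linear_to_sum [OF F] proj_sum)
      then show "pr e (F p) = 0" by (simp add: sum_proj)
    qed
  next
    assume r: ?r
    show ?l
    proof (intro allI ballI)
      fix i j p assume p: "p \<in> bicomponent A P i j"
      then have p: "pr (i, j) p = p" by (simp add: bicomponent_proj [OF A])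
      let ?q = "\<lambda>x. pr ((i, j) - x) (F p)"
      have "{e. pr e (F p) \<noteq> 0} \<subseteq> (\<lambda>x. (i, j) - x) ` D"
      proof
        fix e assume "e \<in> {e. pr e (F p) \<noteq> 0}"
        then obtain x where x: "x \<in> D" "pr (e + x) p \<noteq> 0" using spreadD [OF r] by blast
        then have "e + x = (i, j)" using proj_proj [of "bidegree P" "e + x" "(i, j)" p] p by (auto split: if_splits)
        then have "e = (i, j) - x" by (metis add_diff_cancel_right')
        then show "e \<in> (\<lambda>x. (i, j) - x) ` D" using x by blast
      qed
      then have "(\<Sum>e | pr e (F p) \<noteq> 0. pr e (F p)) = (\<Sum>e \<in> (\<lambda>x. (i, j) - x) ` D. pr e (F p))"
        using D by (intro sum.mono_neutral_left) auto
      also have "\<dots> = (\<Sum>x \<in> D. ?q x)"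
        by (subst sum.reindex) (auto simp: inj_on_def)
      finally have "F p = (\<Sum>x \<in> D. ?q x)" by (simp add: sum_proj)
      moreover have "\<forall>(n, m) \<in> D. ?q (n, m) \<in> bicomponent A P (i - n) (j - m)"
        by (auto simp: bicomponent_proj [OF A] proj_proj)
      ultimately show "\<exists>q. (\<forall>(n, m) \<in> D. q (n, m) \<in> bicomponent A P (i - n) (j - m)) \<and> F p = (\<Sum>e \<in> D. q e)"
        by (intro exI [of _ ?q] conjI)
    qed
  qed
  then show ?thesis unfolding graded_endo_def lin by blast
qed

lemma lifts_iff: "lifts A P f F \<longleftrightarrow> endo_chain_map F \<and> (\<forall>p. aug P (F p) = f p)"
  unfolding lifts_def graded_endo_iff semilinear_chain_map_def by blast

text \<open>
  The union defining the product runs over both representatives and over all lifts. Changing the left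
  representative changes the composite by a coboundary, and so does changing the right one or its lift, by \<open>lift_unique\<close>.
\<close>

lemma yoneda_product_class:
  assumes f: "cocycle f" and g: "cocycle g" and F: "endo_chain_map F" "\<And>p. aug P (F p) = f p"
  shows "yoneda_product A P (ext_class A P g) (ext_class A P f) = ext_class A P (\<lambda>p. g (F p))"
  unfolding yoneda_product_def
proof (intro UN_ext_class f g)
  fix g' f' assume g': "cocycle g'" "cohomologous g' g" and f': "cocycle f'" "cohomologous f' f"
  have "ext_class A P (\<lambda>p. g' (F' p)) = ext_class A P (\<lambda>p. g (F p))" if "lifts A P f' F'" for F'
  proof (rule ext_class_eqI)
    have F': "endo_chain_map F'" "\<And>p. aug P (F' p) = f' p" using that by (simp_all add: lifts_iff)
    have "cohomologous (\<lambda>p. g' (F' p)) (\<lambda>p. g (F' p))"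
      by (rule self.cohomologous_comp [OF g'(2) F'(1)])
    moreover have "cohomologous (\<lambda>p. g (F' p)) (\<lambda>p. g (F p))"
      using f'(2) by (intro self.lift_unique [OF F'(1) F(1) _ g]) (simp add: F F')
    ultimately show "cohomologous (\<lambda>p. g' (F' p)) (\<lambda>p. g (F p))" by (rule cohomologous_trans)
  qed
  moreover have "\<exists>F'. lifts A P f' F'"
    using self.lift_of_cocycle [OF f'(1)] lifts_iff by metis
  ultimately show "(\<Union>F \<in> {F. lifts A P f' F}. ext_class A P (\<lambda>p. g' (F p))) = ext_class A P (\<lambda>p. g (F p))"
    by auto
qed

lemma ext_part_eq: "ext_part A P n =
    ext_class A P ` {f. cocycle f \<and> spread pr trivial_proj ({int n} \<times> UNIV) f}"
proof -
  have "vanishes_off A P D f \<longleftrightarrow> spread pr trivial_proj D f" if "cocycle f" for D f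
    by (rule vanishes_off_spread [OF A linear_to_add [OF cocycleD(3) [OF that]]])
  then show ?thesis unfolding ext_part_def ext_bipart_def by (auto simp: cocycles_iff)
qed

lemma low_degree_subalgebra_eq: "low_degree_subalgebra A P = ext_class A P ` {f. low_generated f}"
proof (intro equalityI subsetI)
  fix u assume "u \<in> low_degree_subalgebra A P"
  then show "u \<in> ext_class A P ` {f. low_generated f}"
    unfolding low_degree_subalgebra_def
  proof induction
    case one
    show ?case unfolding ext_one_def using low_generated.one by blast
  next
    case (generator u)
    then show ?case
      using low_generated.low [of _ 1] low_generated.low [of _ 2] by (auto simp: ext_part_eq)
  next
    case (add u v)
    then obtain f f' where "u = ext_class A P f" "v = ext_class A P f'" "low_generated f" "low_generated f'"
      by blast
    then show ?case
      using low_generated.plus [of f f'] by (auto simp: ext_add_class low_generated_cocycle)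
  next
    case (scale u s)
    then obtain f where "u = ext_class A P f" "low_generated f" by blast
    then show ?case
      using low_generated.scale [of f s] by (auto simp: ext_scale_class low_generated_cocycle)
  next
    case (product u v)
    then obtain f f' where *: "u = ext_class A P f" "v = ext_class A P f'" "low_generated f" "low_generated f'"
      by blast
    obtain F where F: "endo_chain_map F" "\<And>p. aug P (F p) = f' p"
      using self.lift_of_cocycle [OF low_generated_cocycle [OF *(4)]] by blast
    show ?case
      using low_generated.product [OF *(3,4) F] yoneda_product_class [OF _ _ F, of f] *
      by (auto simp: low_generated_cocycle)
  qed
next
  fix u assume "u \<in> ext_class A P ` {f. low_generated f}"
  then obtain f where u: "u = ext_class A P f" and f: "low_generated f" by blast
  show "u \<in> low_degree_subalgebra A P"
    unfolding u low_degree_subalgebra_def using f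
  proof induction
    case one
    show ?case using ext_subalgebra.one [of A P] by (simp add: ext_one_def)
  next
    case (low f n)
    then have "ext_class A P f \<in> ext_part A P 1 \<union> ext_part A P 2" by (auto simp: ext_part_eq)
    then show ?case by (rule ext_subalgebra.generator)
  next
    case (plus u v)
    then show ?case using ext_subalgebra.add [OF plus.IH] by (simp add: ext_add_class low_generated_cocycle)
  next
    case (scale u s)
    then show ?case using ext_subalgebra.scale [OF scale.IH, of s] by (simp add: ext_scale_class low_generated_cocycle)
  next
    case (product u v F)
    then show ?case
      using ext_subalgebra.product [OF product.IH] yoneda_product_class [OF _ _ product.hyps(3,4)]
      by (simp add: low_generated_cocycle)
  next
    case (cohomologous u v)
    then show ?case using ext_class_eqI by metis
  qed
qed

lemma ext_class_low_generated:
  assumes "cocycle f" "ext_class A P f \<in> low_degree_subalgebra A P"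
  shows "low_generated f"
proof -
  obtain f' where "ext_class A P f = ext_class A P f'" "low_generated f'"
    using assms(2) unfolding low_degree_subalgebra_eq by blast
  then show ?thesis using low_generated.cohomologous [OF _ assms(1)] ext_class_eqD [OF assms(1)] by blast
qed

lemma K2_iff: "K2 A P \<longleftrightarrow> (\<forall>f. cocycle f \<longrightarrow> low_generated f)"
proof -
  have alg: "ext_algebra A P = ext_class A P ` {f. cocycle f}"
    by (auto simp: ext_algebra_def cocycles_iff)
  show ?thesis
    unfolding K2_def
  proof (intro iffI allI impI)
    fix f assume "ext_algebra A P = low_degree_subalgebra A P" "cocycle f"
    then show "low_generated f" by (intro ext_class_low_generated) (auto simp: alg)
  next
    assume "\<forall>f. cocycle f \<longrightarrow> low_generated f"
    then have "{f. cocycle f} = {f. low_generated f}" using low_generated_cocycle by blast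
    then show "ext_algebra A P = low_degree_subalgebra A P" by (simp add: alg low_degree_subalgebra_eq)
  qed
qed

end

section \<open>The quotient by a normal regular element of degree one\<close>

text \<open>
  The lifts \<open>\<pi>\<close> and \<open>X\<close> are chosen homogeneous, of bidegrees \<open>(0, 0)\<close> and \<open>(1, 1)\<close>, so that the cone is bigraded.
\<close>

lemma (in quotient_by_regular) low_generated_quotient:
  assumes "\<And>u. Q.cocycle u \<Longrightarrow> spread Q.pr trivial_proj ({3} \<times> UNIV) u \<Longrightarrow> Q.low_generated u"
    and "\<And>f. P.cocycle f \<Longrightarrow> P.low_generated f"
    and "Q.cocycle u"
  shows "Q.low_generated u"
proof -
  obtain \<chi> where \<chi>: "trivial_hom \<epsilon> \<chi>" "spread P.pr trivial_proj {(1, 1)} \<chi>" "\<And>p. \<chi> (d p) = 0"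
    "\<And>p w. d p = lmult g w \<Longrightarrow> \<chi> p = \<alpha> w" using dual_class by blast
  obtain X where lift_X: "semilinear X" "spread P.pr Q.pr {(1, 1)} X" "\<And>p. X (d p) = d' (X p)"
    "\<And>p. \<alpha>' (X p) = \<chi> p"
    using lift_exists [OF \<chi>(1-3)] by blast
  obtain \<pi> where lift_\<pi>: "semilinear \<pi>" "spread P.pr Q.pr {0} \<pi>" "\<And>p. \<pi> (d p) = d' (\<pi> p)"
    "\<And>p. \<alpha>' (\<pi> p) = \<alpha> p"
    using lift_exists [OF P.\<alpha>_hom P.\<alpha>_spread P.\<alpha>_d] by blast
  interpret lifted_pair c \<kappa> \<epsilon> deg d \<alpha> c' \<kappa>' \<epsilon>' deg' d' \<alpha>' h g \<pi> X
    by unfold_locales (simp_all add: lift_\<pi> lift_X \<chi>)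
  interpret gysin_sequence c \<kappa> \<epsilon> deg d \<alpha> c' \<kappa>' \<epsilon>' deg' d' \<alpha>' h \<pi> X
  proof unfold_locales
    show "chain_map \<pi>" "chain_map X"
      unfolding semilinear_chain_map_def using lift_\<pi> lift_X by blast+
    show "spread P.pr trivial_proj {(1, 1)} (\<lambda>p. \<alpha>' (X p))" using \<chi>(2) by (simp add: lift_X)
    show "\<exists>u v. Q.cocycle u \<and> Q.cocycle v \<and> P.cohomologous f (\<lambda>p. u (\<pi> p) + v (X p)) \<and>
        (\<forall>n. spread P.pr trivial_proj ({n} \<times> UNIV) f \<longrightarrow>
          spread Q.pr trivial_proj ({n} \<times> UNIV) u \<and> spread Q.pr trivial_proj ({n - 1} \<times> UNIV) v)"
      if "P.cocycle f" for f by (rule gysin_splitting [OF that]) blast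
  qed (use lift_\<pi> gysin_injective assms(1) in blast)+
  show ?thesis using assms(2,3) by (rule low_generated_descends)
qed

theorem theorem8p2:
  fixes R :: "('v::finite, 'k::field) tensor_algebra set"
    and pr :: "('v, 'k) tensor_algebra \<Rightarrow> 'a::ring_1"
    and qu :: "'a \<Rightarrow> 'b::ring_1"
    and g :: 'a
    and A :: "('k, 'a) graded_structure"
    and B :: "('k, 'b) graded_structure"
    and P :: "('x, 'a, 'k) augmented_complex"
    and Q :: "('y, 'b, 'k) augmented_complex"
  assumes "admissible_relations R"
    and "ring_quotient pr (two_sided_ideal R)"
    and "A = image_structure pr tensor_structure"
    and "g \<in> gr A 1"
    and "normal_element g"
    and "regular_element g"
    and "ring_quotient qu {g * a | a. True}"
    and "B = image_structure qu A"
    and "graded_free_resolution A P"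
    and "graded_free_resolution B Q"
    and "K2 A P"
    and "ext_part B Q 3 \<subseteq> low_degree_subalgebra B Q"
  shows "K2 B Q"
proof -
  have pr: "unital_hom pr" "surj pr" "{t. pr t = 0} = two_sided_ideal R"
    and qu: "unital_hom qu" "surj qu" "\<And>a. qu a = 0 \<longleftrightarrow> (\<exists>b. a = g * b)"
    using assms(2,7) unfolding ring_quotient_def unital_hom_def by (auto simp: set_eq_iff)
  have tensor: "graded_projections (word_part :: int \<Rightarrow> ('v, 'k) tensor_algebra \<Rightarrow> _)"
    using graded_by_tensor by (auto simp: graded_by_def)
  have homogeneous: "\<exists>j. word_part j r = r" if "r \<in> R" for r
  proof -
    obtain m where m: "r \<in> tensor_power m" using assms(1) \<open>r \<in> R\<close> unfolding admissible_relations_def by blast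
    have "word_part (int m) r = r"
      using m by (intro poly_mapping_eqI) (auto simp: lookup_word_part tensor_power_def in_keys_iff)
    then show ?thesis ..
  qed
  have "pr (word_part m t) = 0" if "pr t = 0" for m t
    using two_sided_ideal_homogeneous [OF tensor homogeneous, of R t m] that pr(3) by blast
  then obtain c where A: "graded_by A c"
    using graded_by_image [OF graded_by_tensor pr(1,2)] assms(3) by metis
  interpret graded_projections c using A by (simp add: graded_by_def)
  have g: "c 1 g = g"
  proof -
    have "g \<in> gr_int A 1" using assms(4) by (simp add: gr_int_def)
    then show ?thesis using A by (simp add: graded_by_def in_range_c)
  qed
  have "qu (c m a) = 0" if "qu a = 0" for m a
  proof -
    obtain b where "a = g * b" using \<open>qu a = 0\<close> qu(3) by blast
    then have "c m a = g * c (m - 1) b" using c_mult [of m 1 g b] g by simp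
    then show ?thesis using qu(3) by blast
  qed
  then obtain c' where B: "graded_by B c'" and c': "\<And>m a. qu (c m a) = c' m (qu a)"
    using graded_by_image [OF A qu(1,2)] assms(8) by metis
  interpret P: graded_resolution A c P by unfold_locales (rule A assms(9))+
  interpret Q: graded_resolution B c' Q by unfold_locales (rule B assms(10))+
  have aug: "augmentation B (qu a) = augmentation A a" for a
  proof -
    have "scal B (augmentation A a) = qu (scal A (augmentation A a))"
      by (simp add: assms(8) image_structure_def)
    also have "\<dots> = scal B (augmentation B (qu a))" by (simp add: P.\<kappa>_\<epsilon> Q.\<kappa>_\<epsilon> c')
    finally show ?thesis by (metis Q.\<epsilon>_\<kappa>)
  qed
  interpret quotient_by_regular c "scal A" "augmentation A" "bidegree P" "bd P" "aug P"
    c' "scal B" "augmentation B" "bidegree Q" "bd Q" "aug Q" qu g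
  proof unfold_locales
    show "unital_hom qu" "surj qu" by (rule qu)+
    show "qu (c m a) = c' m (qu a)" "augmentation B (qu a) = augmentation A a" for m a by (rule c' aug)+
    show "\<exists>b. a = g * b" if "qu a = 0" for a using qu(3) that by blast
    show "qu g = 0" unfolding qu(3) by (rule exI [of _ 1]) simp
    show "c 1 g = g" by (rule g)
    show "a = 0" if "g * a = 0" for a using assms(6) that unfolding regular_element_def by blast
  qed
  have "Q.low_generated u" if "Q.cocycle u" "spread Q.pr trivial_proj ({3} \<times> UNIV) u" for u
  proof (rule Q.ext_class_low_generated [OF that(1)])
    have "ext_class B Q u \<in> ext_part B Q 3" using that by (auto simp: Q.ext_part_eq)
    then show "ext_class B Q u \<in> low_degree_subalgebra B Q" using assms(12) by blast
  qed
  then show ?thesis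
    using low_generated_quotient assms(11) unfolding P.K2_iff Q.K2_iff by blast
qed

end
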